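(* Let $\{X(t):t\in\mathbb{R}\}$ be a centered stationary real Gaussian process with unit variance and absolutely continuous sample paths, whose spectral measure has a bounded, continuous density $p(\lambda)$ on $\mathbb{R}$ with $\int\lambda^2p(\lambda)\,d\lambda<\infty$. Let $\alpha:=\mathbb{E}N_X([0,1])$. Then there exist a finite constant $C$ and a function $c:(0,\infty)\to(0,\infty)$ such that $$\mathbb{P}\big(N_X([0,T])-\alpha T\le-\eta T\big)\le Ce^{-c(\eta)T}\qquad\text{for all }\eta>0\text{ and all }0<T<\infty.$$
   Context: The covariance is $r(t-s)=\mathrm{Cov}[X(t),X(s)]$, $r(0)=1$, and the spectral measure $\rho$ is the (symmetric) probability measure on $\mathbb{R}$ with $r(t)=\int_{\mathbb{R}}e^{-i\lambda t}\,d\rho(\lambda)$. For an interval $I\subset\mathbb{R}$, $N_X(I)=|\{t\in I:X(t)=0\}|$ is the (possibly infinite) number of zeroes of the sample path in $I$. By the Kac-Rice formula $\alpha=\frac1\pi\big(\int\lambda^2\,d\rho\big)^{1/2}<\infty$. *)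

theory Defs
  imports "HOL-Probability.Probability"
begin

(* Constants count as (degenerate) Gaussian variables. *)
definition gaussian_law :: "real measure \<Rightarrow> bool" where
  "gaussian_law \<nu> \<longleftrightarrow>
     (\<exists>\<mu> \<sigma>. \<sigma> > 0 \<and> \<nu> = density lborel (normal_density \<mu> \<sigma>)) \<or> (\<exists>\<mu>. \<nu> = return borel \<mu>)"

definition gaussian_process :: "'a measure \<Rightarrow> (real \<Rightarrow> 'a \<Rightarrow> real) \<Rightarrow> bool" where
  "gaussian_process M X \<longleftrightarrow>
     (\<forall>t. X t \<in> borel_measurable M) \<and>
     (\<forall>F a. finite F \<longrightarrow> gaussian_law (distr M borel (\<lambda>\<omega>. \<Sum>t\<in>F. a t * X t \<omega>)))"

definition stationary_process :: "'a measure \<Rightarrow> (real \<Rightarrow> 'a \<Rightarrow> real) \<Rightarrow> bool" where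
  "stationary_process M X \<longleftrightarrow>
     (\<forall>F h. finite F \<longrightarrow>
        distr M (\<Pi>\<^sub>M t\<in>F. borel) (\<lambda>\<omega>. \<lambda>t\<in>F. X (t + h) \<omega>) =
        distr M (\<Pi>\<^sub>M t\<in>F. borel) (\<lambda>\<omega>. \<lambda>t\<in>F. X t \<omega>))"

definition covariance :: "'a measure \<Rightarrow> ('a \<Rightarrow> real) \<Rightarrow> ('a \<Rightarrow> real) \<Rightarrow> real" where
  "covariance M Y Z =
     (\<integral>\<omega>. (Y \<omega> - (\<integral>\<omega>'. Y \<omega>' \<partial>M)) * (Z \<omega> - (\<integral>\<omega>'. Z \<omega>' \<partial>M)) \<partial>M)"

definition spectral_measure :: "'a measure \<Rightarrow> (real \<Rightarrow> 'a \<Rightarrow> real) \<Rightarrow> real measure \<Rightarrow> bool" where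
  "spectral_measure M X \<rho> \<longleftrightarrow>
     prob_space \<rho> \<and> sets \<rho> = sets borel \<and> distr \<rho> borel uminus = \<rho> \<and>
     (\<forall>t s. complex_of_real (covariance M (X t) (X s)) =
        (\<integral>l. exp (- \<i> * complex_of_real (l * (t - s))) \<partial>\<rho>))"

definition absolutely_continuous_on :: "real \<Rightarrow> real \<Rightarrow> (real \<Rightarrow> real) \<Rightarrow> bool" where
  "absolutely_continuous_on a b f \<longleftrightarrow>
     (\<forall>\<epsilon>>0. \<exists>\<delta>>0. \<forall>D. finite D \<and> (\<forall>(x, y)\<in>D. a \<le> x \<and> x \<le> y \<and> y \<le> b) \<and>
        disjoint_family_on (\<lambda>(x, y). {x<..<y}) D \<and> (\<Sum>(x, y)\<in>D. y - x) < \<delta> \<longrightarrow>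
        (\<Sum>(x, y)\<in>D. \<bar>f y - f x\<bar>) < \<epsilon>)"

(* For a path indexed by the whole line: absolute continuity on every compact interval. *)
definition absolutely_continuous_path :: "(real \<Rightarrow> real) \<Rightarrow> bool" where
  "absolutely_continuous_path f \<longleftrightarrow> (\<forall>a b. absolutely_continuous_on a b f)"

(* Counting measure, so that an infinite zero set has count \<infinity> (card would give 0). *)
definition zero_count :: "(real \<Rightarrow> 'a \<Rightarrow> real) \<Rightarrow> real set \<Rightarrow> 'a \<Rightarrow> ennreal" where
  "zero_count X I \<omega> = emeasure (count_space UNIV) {t \<in> I. X t \<omega> = 0}"

(* Sample paths are only assumed regular almost surely, so zero counts are measurable up to
   null sets; hence the completion, which changes nothing for events and variables already
   measurable with respect to M. *)
definition expected_zero_count :: "'a measure \<Rightarrow> (real \<Rightarrow> 'a \<Rightarrow> real) \<Rightarrow> real set \<Rightarrow> ennreal" where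
  "expected_zero_count M X I = (\<integral>\<^sup>+ \<omega>. zero_count X I \<omega> \<partial>completion M)"

end

theory Submission
  imports Defs
begin

text \<open>The number of zeros is bounded below by a smooth functional of the path that has nearly the right mean
and to which Gaussian concentration applies.

Fix a distance \<open>d\<close>. A continuous path has at least as many zeros in \<open>[0, T]\<close> as it has sign changes along any
grid of spacing \<open>d\<close>. Averaging over \<open>m\<close> grids, shifted by multiples of \<open>h = d / m\<close>, shows that
the number of zeros is at least \<open>(\<Sum>k. 1{X (k * h) * X (k * h + d) < 0}) / m\<close>, and the indicator may be replaced
by a continuously differentiable minorant (lemma \<open>averaged_sign_changes_le_zero_count\<close>). Two things
are to be shown about the resulting functional \<open>F\<close>.

The mean. By stationarity it is about \<open>T / d\<close> times the probability of a sign change over the distance \<open>d\<close>, so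
it suffices that the expected number \<open>\<alpha>\<close> of zeros in \<open>[0, 1]\<close> is at most the lower limit, as \<open>d = 1 / 2 ^ n\<close>
tends to \<open>0\<close>, of this probability divided by \<open>d\<close> (lemma \<open>expected_zero_count_le\<close>). Near a zero, the values
along a fine dyadic grid enter a band \<open>[-u, u]\<close> and leave it again. Each such change is a crossing of the level
\<open>u\<close> or \<open>-u\<close> between neighbouring grid points \<open>s\<close> and \<open>t\<close>, and a nonzero level is crossed with at most the
probability of the level \<open>0\<close>: the variables \<open>X s + X t\<close> and \<open>X s - X t\<close> are independent, and a centered normal
law gives the largest mass to an interval of prescribed length when it is centred at \<open>0\<close>. Fatou's lemma
concludes. The same representation bounds the crossing probability by a multiple of \<open>d\<close>, so that \<open>\<alpha>\<close> is
finite.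

The deviations. By the Maurey-Pisier rotation argument (lemma \<open>gaussian_concentration\<close>) it is enough to bound the
variance of the linear forms \<open>\<Sum>k. a k * X (k * h)\<close> that occur as derivatives of \<open>F\<close>, where the
coefficients are of order \<open>1 / m\<close>. This variance is the integral of the square modulus of a trigonometric
polynomial against the spectral density \<open>p\<close>. On the frequencies up to \<open>pi / h\<close>, boundedness of \<open>p\<close> and
orthogonality give a bound of order \<open>T\<close>, uniformly in \<open>h\<close>; beyond, the second spectral moment gives one of
order \<open>T\<^sup>2 * h\<^sup>2\<close>, which is again of order \<open>T\<close> when \<open>m\<^sup>2 \<ge> T\<close> (lemma \<open>spectral_quadratic_form_le\<close>). A deviation of
order \<open>T\<close> from the mean then has probability at most \<open>exp (- c * T)\<close>. For small \<open>T\<close> the claim is made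
trivial by decreasing \<open>c\<close> and taking \<open>C = exp 1\<close>.\<close>

section \<open>Laws determined by their linear combinations\<close>

lemma char_distr:
  assumes [measurable]: "Y \<in> borel_measurable M"
  shows "char (distr M borel Y) s = (\<integral>\<omega>. iexp (s * Y \<omega>) \<partial>M)"
  by (simp add: char_def integral_distr)

text \<open>One-dimensional uniqueness with a bounded signed weight. Levy's theorem speaks of probability
measures, so the weight \<open>U\<close> is replaced by the positive density \<open>(2 + U) / c\<close>; the constant \<open>2\<close> is
harmless because the unweighted transforms agree as well, and it keeps the total mass away from \<open>0\<close>.\<close>

lemma integral_iexp_weight_eqD:
  fixes M :: "'a measure" and N :: "'b measure"
  assumes "prob_space M" "prob_space N"
  assumes [measurable]: "Y \<in> borel_measurable M" "Z \<in> borel_measurable N"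
    "U \<in> borel_measurable M" "V \<in> borel_measurable N"
  assumes U: "\<And>\<omega>. \<bar>U \<omega>\<bar> \<le> (1::real)" and V: "\<And>\<omega>. \<bar>V \<omega>\<bar> \<le> (1::real)"
  assumes eq: "\<And>s. (\<integral>\<omega>. complex_of_real (U \<omega>) * iexp (s * Y \<omega>) \<partial>M)
      = (\<integral>\<omega>. complex_of_real (V \<omega>) * iexp (s * Z \<omega>) \<partial>N)"
    and eq1: "\<And>s. (\<integral>\<omega>. iexp (s * Y \<omega>) \<partial>M) = (\<integral>\<omega>. iexp (s * Z \<omega>) \<partial>N)"
    and [measurable]: "B \<in> sets borel"
  shows "(\<integral>\<omega>. U \<omega> * indicator B (Y \<omega>) \<partial>M) = (\<integral>\<omega>. V \<omega> * indicator B (Z \<omega>) \<partial>N)"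
proof -
  interpret M: prob_space M by fact
  interpret N: prob_space N by fact
  define c where "c = 2 + (\<integral>\<omega>. U \<omega> \<partial>M)"
  have intU: "integrable M U" using U by (intro M.integrable_const_bound[where B=1]) auto
  have intV: "integrable N V" using V by (intro N.integrable_const_bound[where B=1]) auto
  have "complex_of_real (\<integral>\<omega>. U \<omega> \<partial>M) = complex_of_real (\<integral>\<omega>. V \<omega> \<partial>N)"
    using eq[of 0] by simp
  then have c2: "c = 2 + (\<integral>\<omega>. V \<omega> \<partial>N)" unfolding c_def by (simp only: of_real_eq_iff)
  have "\<bar>\<integral>\<omega>. U \<omega> \<partial>M\<bar> \<le> 1"
    using M.integral_le_const[OF intU, of 1] M.integral_ge_const[OF intU, of "-1"] U
    by (smt (verit, best) AE_I2)
  then have c: "c > 0" unfolding c_def by simp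
  have key: "real_distribution (distr (density P (\<lambda>\<omega>. ennreal ((2 + W \<omega>) / c))) borel R)
      \<and> (\<forall>s. char (distr (density P (\<lambda>\<omega>. ennreal ((2 + W \<omega>) / c))) borel R) s =
        (2 * (\<integral>\<omega>. iexp (s * R \<omega>) \<partial>P) + (\<integral>\<omega>. complex_of_real (W \<omega>) * iexp (s * R \<omega>) \<partial>P)) / complex_of_real c)
      \<and> measure (distr (density P (\<lambda>\<omega>. ennreal ((2 + W \<omega>) / c))) borel R) B
        = (2 * measure (distr P borel R) B + (\<integral>\<omega>. W \<omega> * indicator B (R \<omega>) \<partial>P)) / c"
    if P: "prob_space P" and [measurable]: "W \<in> borel_measurable P" "R \<in> borel_measurable P"
      and W: "\<And>\<omega>. \<bar>W \<omega>\<bar> \<le> 1" and cW: "c = 2 + (\<integral>\<omega>. W \<omega> \<partial>P)"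
    for P :: "'c measure" and W R
  proof -
    interpret P: prob_space P by fact
    have intW: "integrable P W" using W by (intro P.integrable_const_bound[where B=1]) auto
    have pos: "0 \<le> (2 + W \<omega>) / c" for \<omega> using W[of \<omega>] c by auto
    let ?D = "density P (\<lambda>\<omega>. ennreal ((2 + W \<omega>) / c))"
    have "emeasure ?D (space ?D) = (\<integral>\<^sup>+\<omega>. ennreal ((2 + W \<omega>) / c) \<partial>P)"
      by (auto simp: emeasure_density intro!: nn_integral_cong)
    also have "\<dots> = ennreal (\<integral>\<omega>. (2 + W \<omega>) / c \<partial>P)"
      using pos intW by (intro nn_integral_eq_integral) auto
    also have "(\<integral>\<omega>. (2 + W \<omega>) / c \<partial>P) = 1"
      using intW c cW by (simp add: P.prob_space)
    finally interpret D: prob_space ?D by (intro prob_spaceI) simp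
    have 1: "real_distribution (distr ?D borel R)"
      by (simp add: real_distribution_def real_distribution_axioms_def D.prob_space_distr)
    have 2: "char (distr ?D borel R) s =
        (2 * (\<integral>\<omega>. iexp (s * R \<omega>) \<partial>P) + (\<integral>\<omega>. complex_of_real (W \<omega>) * iexp (s * R \<omega>) \<partial>P)) / complex_of_real c" for s
    proof -
      have i1: "integrable P (\<lambda>\<omega>. iexp (s * R \<omega>))"
        by (intro P.integrable_const_bound[where B=1]) auto
      have i2: "integrable P (\<lambda>\<omega>. complex_of_real (W \<omega>) * iexp (s * R \<omega>))"
        using W by (intro P.integrable_const_bound[where B=1]) (auto simp: norm_mult)
      have "char (distr ?D borel R) s = (\<integral>\<omega>. iexp (s * R \<omega>) \<partial>?D)" by (rule char_distr) simp
      also have "\<dots> = (\<integral>\<omega>. ((2 + W \<omega>) / c) *\<^sub>R iexp (s * R \<omega>) \<partial>P)"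
        using pos by (intro integral_density) auto
      also have "\<dots> = (\<integral>\<omega>. (2 * iexp (s * R \<omega>) + complex_of_real (W \<omega>) * iexp (s * R \<omega>)) / complex_of_real c \<partial>P)"
        by (intro Bochner_Integration.integral_cong) (auto simp: scaleR_conv_of_real field_simps)
      also have "\<dots> = (2 * (\<integral>\<omega>. iexp (s * R \<omega>) \<partial>P) + (\<integral>\<omega>. complex_of_real (W \<omega>) * iexp (s * R \<omega>) \<partial>P)) / complex_of_real c"
        using i1 i2 by simp
      finally show ?thesis .
    qed
    have 3: "measure (distr ?D borel R) B
        = (2 * measure (distr P borel R) B + (\<integral>\<omega>. W \<omega> * indicator B (R \<omega>) \<partial>P)) / c"
    proof -
      have i2: "integrable P (\<lambda>\<omega>. W \<omega> * indicator B (R \<omega>))"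
        using W by (intro P.integrable_const_bound[where B=1]) (auto simp: indicator_def)
      have i1: "integrable P (\<lambda>\<omega>. indicator B (R \<omega>) :: real)"
        by (intro P.integrable_const_bound[where B=1]) auto
      interpret dD: prob_space "distr ?D borel R" by (intro D.prob_space_distr) simp
      interpret dP: prob_space "distr P borel R" by (intro P.prob_space_distr) simp
      have "measure (distr ?D borel R) B = (\<integral>x. indicator B x \<partial>distr ?D borel R)" by simp
      also have "\<dots> = (\<integral>\<omega>. indicator B (R \<omega>) \<partial>?D)" by (rule integral_distr) auto
      also have "\<dots> = (\<integral>\<omega>. ((2 + W \<omega>) / c) *\<^sub>R indicator B (R \<omega>) \<partial>P)"
        using pos by (intro integral_density) auto
      also have "\<dots> = (\<integral>\<omega>. (2 * indicator B (R \<omega>) + W \<omega> * indicator B (R \<omega>)) / c \<partial>P)"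
        by (intro Bochner_Integration.integral_cong) (auto simp: field_simps)
      also have "\<dots> = (2 * (\<integral>\<omega>. indicator B (R \<omega>) \<partial>P) + (\<integral>\<omega>. W \<omega> * indicator B (R \<omega>) \<partial>P)) / c"
        using i1 i2 by simp
      also have "(\<integral>\<omega>. indicator B (R \<omega>) \<partial>P) = (\<integral>x. (indicator B x :: real) \<partial>distr P borel R)"
        by (rule integral_distr[symmetric]) auto
      finally show ?thesis by simp
    qed
    show ?thesis using 1 2 3 by blast
  qed
  note k1 = key[OF assms(1) assms(5) assms(3) U c_def] and k2 = key[OF assms(2) assms(6) assms(4) V c2]
  have e1: "distr (density M (\<lambda>\<omega>. ennreal ((2 + U \<omega>) / c))) borel Y
      = distr (density N (\<lambda>\<omega>. ennreal ((2 + V \<omega>) / c))) borel Z"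
    using k1 k2 by (intro Levy_uniqueness ext) (auto simp only: eq eq1)
  have e2: "distr M borel Y = distr N borel Z"
    by (intro Levy_uniqueness ext, unfold char_distr[OF assms(3)] char_distr[OF assms(4)] eq1)
      (simp_all add: real_distribution_def real_distribution_axioms_def M.prob_space_distr N.prob_space_distr)
  show ?thesis using k1 k2 e1 e2 c by simp
qed

text \<open>The same for complex weights. Replacing \<open>s\<close> by \<open>-s\<close> and conjugating turns the hypothesis for \<open>U\<close> into
one for \<open>cnj U\<close>, so that the real and the imaginary part can be treated separately.\<close>

lemma integral_iexp_complex_weight_eqD:
  fixes M :: "'a measure" and N :: "'b measure"
  assumes P: "prob_space M" "prob_space N"
  assumes [measurable]: "Y \<in> borel_measurable M" "Z \<in> borel_measurable N"
    "U \<in> borel_measurable M" "V \<in> borel_measurable N"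
  assumes U: "\<And>\<omega>. cmod (U \<omega>) \<le> 1" and V: "\<And>\<omega>. cmod (V \<omega>) \<le> 1"
  assumes eq: "\<And>s. (\<integral>\<omega>. U \<omega> * iexp (s * Y \<omega>) \<partial>M) = (\<integral>\<omega>. V \<omega> * iexp (s * Z \<omega>) \<partial>N)"
    and eq1: "\<And>s. (\<integral>\<omega>. iexp (s * Y \<omega>) \<partial>M) = (\<integral>\<omega>. iexp (s * Z \<omega>) \<partial>N)"
    and [measurable]: "B \<in> sets borel"
  shows "(\<integral>\<omega>. U \<omega> * indicator B (Y \<omega>) \<partial>M) = (\<integral>\<omega>. V \<omega> * indicator B (Z \<omega>) \<partial>N)"
proof -
  interpret M: prob_space M by fact
  interpret N: prob_space N by fact
  have cnj_eq: "(\<integral>\<omega>. cnj (U \<omega>) * iexp (s * Y \<omega>) \<partial>M) = (\<integral>\<omega>. cnj (V \<omega>) * iexp (s * Z \<omega>) \<partial>N)" for s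
  proof -
    have "(\<integral>\<omega>. cnj (W \<omega>) * iexp (s * R \<omega>) \<partial>P) = cnj (\<integral>\<omega>. W \<omega> * iexp ((-s) * R \<omega>) \<partial>P)" for W R and P :: "'c measure"
      unfolding Bochner_Integration.integral_cnj[symmetric] by (intro Bochner_Integration.integral_cong) (simp_all add: exp_cnj)
    then show ?thesis using eq[of "-s"] by (metis (no_types))
  qed
  have int: "integrable P (\<lambda>\<omega>. W \<omega> * iexp (s * R \<omega>))"
    if "prob_space P" "W \<in> borel_measurable P" "R \<in> borel_measurable P" "\<And>\<omega>. cmod (W \<omega>) \<le> 1"
    for P :: "'c measure" and W R s
  proof -
    interpret P: prob_space P by fact
    note [measurable] = that(2,3)
    show ?thesis using that(4) by (intro P.integrable_const_bound[where B=1]) (auto simp: norm_mult)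
  qed
  have [measurable]: "(\<lambda>\<omega>. cnj (U \<omega>)) \<in> borel_measurable M" "(\<lambda>\<omega>. cnj (V \<omega>)) \<in> borel_measurable N"
    using borel_measurable_continuous_onI[OF continuous_on_cnj[OF continuous_on_id]]
    by (auto intro: measurable_compose)
  have intc: "integrable M (\<lambda>\<omega>. U \<omega> * iexp (s * Y \<omega>))" "integrable N (\<lambda>\<omega>. V \<omega> * iexp (s * Z \<omega>))"
    "integrable M (\<lambda>\<omega>. cnj (U \<omega>) * iexp (s * Y \<omega>))" "integrable N (\<lambda>\<omega>. cnj (V \<omega>) * iexp (s * Z \<omega>))" for s
    by (rule int; simp add: P U V)+
  have Re: "(\<integral>\<omega>. Re (U \<omega>) * indicator B (Y \<omega>) \<partial>M) = (\<integral>\<omega>. Re (V \<omega>) * indicator B (Z \<omega>) \<partial>N)"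
  proof (rule integral_iexp_weight_eqD[OF P])
    show "(\<integral>\<omega>. complex_of_real (Re (U \<omega>)) * iexp (s * Y \<omega>) \<partial>M)
      = (\<integral>\<omega>. complex_of_real (Re (V \<omega>)) * iexp (s * Z \<omega>) \<partial>N)" for s
    proof -
      have *: "complex_of_real (Re z) * w = (z * w + cnj z * w) / 2" for z w
        by (simp add: complex_eq_iff field_simps)
      show ?thesis unfolding * using intc[of s] eq[of s] cnj_eq[of s] by simp
    qed
  qed (use U V abs_Re_le_cmod order_trans eq1 in \<open>auto, blast+\<close>)
  have Im: "(\<integral>\<omega>. Im (U \<omega>) * indicator B (Y \<omega>) \<partial>M) = (\<integral>\<omega>. Im (V \<omega>) * indicator B (Z \<omega>) \<partial>N)"
  proof (rule integral_iexp_weight_eqD[OF P])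
    show "(\<integral>\<omega>. complex_of_real (Im (U \<omega>)) * iexp (s * Y \<omega>) \<partial>M)
      = (\<integral>\<omega>. complex_of_real (Im (V \<omega>)) * iexp (s * Z \<omega>) \<partial>N)" for s
    proof -
      have *: "complex_of_real (Im z) * w = (- \<i> / 2) * (z * w - cnj z * w)" for z w
        by (simp add: complex_eq_iff field_simps)
      show ?thesis unfolding * using intc[of s] eq[of s] cnj_eq[of s] by simp
    qed
  qed (use U V abs_Im_le_cmod order_trans eq1 in \<open>auto, blast+\<close>)
  have int2: "integrable P (\<lambda>\<omega>. W \<omega> * indicator B (R \<omega>))"
    if "prob_space P" "W \<in> borel_measurable P" "R \<in> borel_measurable P" "\<And>\<omega>. cmod (W \<omega>) \<le> 1"
    for P :: "'c measure" and W R
  proof -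
    interpret P: prob_space P by fact
    note [measurable] = that(2,3)
    show ?thesis using that(4) by (intro P.integrable_const_bound[where B=1]) (auto simp: indicator_def)
  qed
  have ind: "Re (indicator B x) = indicator B x" "Im (indicator B x) = 0" for x
    by (auto simp: indicator_def)
  show ?thesis
    using Re Im int2[OF P(1), of U Y] int2[OF P(2), of V Z] U V
    by (auto simp: complex_eq_iff ind integral_Re[symmetric] integral_Im[symmetric] simp del: integral_Re integral_Im)
qed

text \<open>A finite family of random variables has its joint law determined by the characteristic functions of
its linear combinations (the uniqueness behind the Cramer-Wold device). The coordinates are converted
one at a time: having replaced the factors \<open>iexp (a i * Y i)\<close> with \<open>i \<in> J\<close> by indicators of Borel sets,
the remaining expression is, as a function of one further coefficient, the transform of a complex
weight on the line, and the previous lemma replaces one more factor.\<close>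

lemma distr_eq_if_char_linear_combinations_eq:
  fixes M :: "'a measure" and N :: "'b measure" and Y :: "'i \<Rightarrow> 'a \<Rightarrow> real" and Z :: "'i \<Rightarrow> 'b \<Rightarrow> real"
  assumes P: "prob_space M" "prob_space N" and I: "finite I"
  assumes Y: "\<And>i. i \<in> I \<Longrightarrow> Y i \<in> borel_measurable M" and Z: "\<And>i. i \<in> I \<Longrightarrow> Z i \<in> borel_measurable N"
  assumes eq: "\<And>a. (\<integral>\<omega>. iexp (\<Sum>i\<in>I. a i * Y i \<omega>) \<partial>M) = (\<integral>\<omega>. iexp (\<Sum>i\<in>I. a i * Z i \<omega>) \<partial>N)"
  shows "distr M (PiM I (\<lambda>_. borel)) (\<lambda>\<omega>. \<lambda>i\<in>I. Y i \<omega>) = distr N (PiM I (\<lambda>_. borel)) (\<lambda>\<omega>. \<lambda>i\<in>I. Z i \<omega>)"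
proof -
  interpret M: prob_space M by fact
  interpret N: prob_space N by fact
  note [measurable] = Y Z
  have cf: "(\<integral>\<omega>. (\<Prod>i\<in>J. indicator (B i) (Y i \<omega>)) * iexp (\<Sum>i\<in>I-J. a i * Y i \<omega>) \<partial>M)
      = (\<integral>\<omega>. (\<Prod>i\<in>J. indicator (B i) (Z i \<omega>)) * iexp (\<Sum>i\<in>I-J. a i * Z i \<omega>) \<partial>N)"
    if "finite J" "J \<subseteq> I" "\<And>i. B i \<in> sets borel" for J a and B :: "'i \<Rightarrow> real set"
    using that(1,2)
  proof (induction J arbitrary: a rule: finite_induct)
    case empty
    then show ?case using eq by simp
  next
    case (insert j J)
    note [measurable] = that(3)
    have jI: "j \<in> I" and JI: "\<And>i. i \<in> J \<Longrightarrow> i \<in> I" using insert by auto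
    have split: "I - J = insert j (I - insert j J)" "j \<notin> I - insert j J" using insert by auto
    let ?U = "\<lambda>Y \<omega>. (\<Prod>i\<in>J. indicator (B i) (Y i \<omega>)) * iexp (\<Sum>i\<in>I - insert j J. a i * Y i \<omega>)"
    have bnd: "cmod (?U R \<omega>) \<le> 1" for R :: "'i \<Rightarrow> 'c \<Rightarrow> real" and \<omega>
      by (auto simp: norm_mult prod_norm[symmetric] indicator_def intro!: prod_le_1)
    have mU [measurable]: "?U Y \<in> borel_measurable M" "?U Z \<in> borel_measurable N"
      using JI by (auto intro!: borel_measurable_times borel_measurable_prod)
    have "(\<integral>\<omega>. ?U Y \<omega> * indicator (B j) (Y j \<omega>) \<partial>M) = (\<integral>\<omega>. ?U Z \<omega> * indicator (B j) (Z j \<omega>) \<partial>N)"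
    proof (rule integral_iexp_complex_weight_eqD[OF P])
      fix s
      let ?a = "a(j := s)"
      have s: "(\<Sum>i\<in>I - J. ?a i * R i \<omega>) = s * R j \<omega> + (\<Sum>i\<in>I - insert j J. a i * R i \<omega>)" for R :: "'i \<Rightarrow> 'c \<Rightarrow> real" and \<omega>
        unfolding split(1) using I split(2) by (subst sum.insert) (auto intro!: sum.cong)
      have *: "?U R \<omega> * iexp (s * R j \<omega>) = (\<Prod>i\<in>J. indicator (B i) (R i \<omega>)) * iexp (\<Sum>i\<in>I - J. ?a i * R i \<omega>)"
        for R :: "'i \<Rightarrow> 'c \<Rightarrow> real" and \<omega>
        unfolding s by (simp add: exp_add[symmetric] algebra_simps)
      show "(\<integral>\<omega>. ?U Y \<omega> * iexp (s * Y j \<omega>) \<partial>M) = (\<integral>\<omega>. ?U Z \<omega> * iexp (s * Z j \<omega>) \<partial>N)"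
        unfolding * using insert.IH[of ?a] insert.prems by blast
    next
      fix s
      have *: "(\<Sum>i\<in>I. (if i = j then s else 0) * R i \<omega>) = s * R j \<omega>" for R :: "'i \<Rightarrow> 'c \<Rightarrow> real" and \<omega>
        using I jI by (simp add: if_distrib[of "\<lambda>x. x * _"] sum.delta cong: if_cong)
      show "(\<integral>\<omega>. iexp (s * Y j \<omega>) \<partial>M) = (\<integral>\<omega>. iexp (s * Z j \<omega>) \<partial>N)"
        using eq[of "\<lambda>i. if i = j then s else 0"] unfolding * .
    qed (use jI bnd mU in \<open>simp_all only: Y Z that(3)\<close>)
    then show ?case using insert by (simp add: mult_ac)
  qed
  show ?thesis
  proof (rule measure_eqI_PiM_finite[OF I])
    let ?D1 = "distr M (PiM I (\<lambda>_. borel)) (\<lambda>\<omega>. \<lambda>i\<in>I. Y i \<omega>)"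
    let ?D2 = "distr N (PiM I (\<lambda>_. borel)) (\<lambda>\<omega>. \<lambda>i\<in>I. Z i \<omega>)"
    have mY [measurable]: "(\<lambda>\<omega>. \<lambda>i\<in>I. Y i \<omega>) \<in> M \<rightarrow>\<^sub>M PiM I (\<lambda>_. borel)" by measurable
    have mZ [measurable]: "(\<lambda>\<omega>. \<lambda>i\<in>I. Z i \<omega>) \<in> N \<rightarrow>\<^sub>M PiM I (\<lambda>_. borel)" by measurable
    interpret D1: prob_space ?D1 by (rule M.prob_space_distr) fact
    interpret D2: prob_space ?D2 by (rule N.prob_space_distr) fact
    fix A :: "'i \<Rightarrow> real set" assume A: "\<And>i. i \<in> I \<Longrightarrow> A i \<in> sets borel"
    define B where "B i = (if i \<in> I then A i else {})" for i
    have B [measurable]: "B i \<in> sets borel" for i using A by (auto simp: B_def)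
    have AB: "Pi\<^sub>E I A = Pi\<^sub>E I B" by (auto simp: B_def PiE_def Pi_def)
    have S [measurable]: "Pi\<^sub>E I B \<in> sets (PiM I (\<lambda>_. borel))" using I by (intro sets_PiM_I_finite) auto
    have ind: "indicator (Pi\<^sub>E I B) (\<lambda>i\<in>I. R i \<omega>) = (\<Prod>i\<in>I. indicator (B i) (R i \<omega>) :: complex)"
      for R :: "'i \<Rightarrow> 'c \<Rightarrow> real" and \<omega>
    proof (cases "\<forall>i\<in>I. R i \<omega> \<in> B i")
      case False
      then have "(\<Prod>i\<in>I. indicator (B i) (R i \<omega>) :: complex) = 0"
        using I by (auto intro!: prod_zero simp: indicator_def)
      then show ?thesis using False by (auto simp: indicator_def PiE_def Pi_def)
    qed (auto simp: indicator_def PiE_def Pi_def)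
    have "complex_of_real (measure ?D1 (Pi\<^sub>E I B)) = (\<integral>x. complex_of_real (indicator (Pi\<^sub>E I B) x) \<partial>?D1)"
      by (subst integral_complex_of_real) simp
    also have "\<dots> = (\<integral>\<omega>. (\<Prod>i\<in>I. indicator (B i) (Y i \<omega>)) \<partial>M)"
      by (subst integral_distr[OF mY]) (auto simp: of_real_indicator ind simp del: integral_complex_of_real)
    also have "\<dots> = (\<integral>\<omega>. (\<Prod>i\<in>I. indicator (B i) (Z i \<omega>)) \<partial>N)"
      using cf[of I B "\<lambda>_. 0"] I B by simp
    also have "\<dots> = (\<integral>x. complex_of_real (indicator (Pi\<^sub>E I B) x) \<partial>?D2)"
      by (subst integral_distr[OF mZ]) (auto simp: of_real_indicator ind simp del: integral_complex_of_real)
    also have "\<dots> = complex_of_real (measure ?D2 (Pi\<^sub>E I B))"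
      by (subst integral_complex_of_real) simp
    finally show "emeasure ?D1 (Pi\<^sub>E I A) = emeasure ?D2 (Pi\<^sub>E I A)"
      unfolding AB by (simp add: D1.emeasure_eq_measure D2.emeasure_eq_measure)
  next
    show "range (\<lambda>n::nat. space (PiM I (\<lambda>_. borel :: real measure))) \<subseteq> prod_algebra I (\<lambda>_. borel)"
      using I by (auto simp: space_PiM intro!: prod_algebraI_finite)
    show "emeasure (distr M (PiM I (\<lambda>_. borel)) (\<lambda>\<omega>. \<lambda>i\<in>I. Y i \<omega>)) (space (PiM I (\<lambda>_. borel))) \<noteq> \<infinity>"
      by (subst emeasure_distr) (auto simp: M.emeasure_eq_measure)
  qed auto
qed

section \<open>Centered normal laws\<close>

text \<open>The law concentrated at \<open>0\<close> is included, as linear combinations of a Gaussian family may degenerate.\<close>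

definition centered_normal_law :: "real measure \<Rightarrow> bool" where
  "centered_normal_law \<nu> \<longleftrightarrow>
     (\<exists>\<sigma>>0. \<nu> = density lborel (normal_density 0 \<sigma>)) \<or> \<nu> = return borel 0"

lemma centered_normal_law_cases [consumes 1, case_names normal degenerate]:
  assumes "centered_normal_law \<nu>"
  obtains \<sigma> where "\<sigma> > 0" "\<nu> = density lborel (normal_density 0 \<sigma>)" | "\<nu> = return borel 0"
  using assms unfolding centered_normal_law_def by blast

lemma centered_normal_lawI:
  assumes "gaussian_law \<nu>" "(\<integral>x. x \<partial>\<nu>) = 0"
  shows "centered_normal_law \<nu>"
  using assms unfolding gaussian_law_def
proof (elim disjE exE conjE)
  fix \<mu> \<sigma> :: real
  assume *: "\<sigma> > 0" "\<nu> = density lborel (normal_density \<mu> \<sigma>)"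
  have "(\<integral>x. x \<partial>\<nu>) = \<mu>"
    using integral_normal_moment_nz_1[OF *(1), of \<mu>] by (simp add: *(2) integral_density)
  then show ?thesis using * assms(2) by (auto simp: centered_normal_law_def)
next
  fix \<mu> :: real assume "\<nu> = return borel \<mu>"
  then show ?thesis using assms(2) by (simp add: centered_normal_law_def integral_return)
qed

lemma centered_normal_law_moments:
  assumes "centered_normal_law \<nu>"
  shows "integrable \<nu> (\<lambda>x. x) \<and> integrable \<nu> (\<lambda>x. x\<^sup>2)"
  using assms
proof (cases rule: centered_normal_law_cases)
  case (normal \<sigma>)
  show ?thesis
    using integrable_normal_moment[OF normal(1), of 0 1] integrable_normal_moment[OF normal(1), of 0 2]
    by (simp add: normal(2) integrable_density)
next
  case degenerate
  show ?thesis
    unfolding degenerate by (simp add: integrable_iff_bounded nn_integral_return)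
qed

lemma variance_normal_density:
  assumes "\<sigma> > 0"
  shows "(\<integral>x. x\<^sup>2 \<partial>density lborel (normal_density 0 \<sigma>)) = \<sigma>\<^sup>2"
  using integral_normal_moment_even[OF assms, of 0 1]
  by (simp add: integral_density fact_numeral)

lemma centered_normal_law_char:
  assumes "centered_normal_law \<nu>"
  shows "(\<integral>x. iexp x \<partial>\<nu>) = complex_of_real (exp (- (\<integral>x. x\<^sup>2 \<partial>\<nu>) / 2))"
  using assms
proof (cases rule: centered_normal_law_cases)
  case (normal \<sigma>)
  interpret std: prob_space std_normal_distribution by (rule prob_space_normal_density) simp
  have "distributed std_normal_distribution lborel (\<lambda>x. x) std_normal_density"
    by (auto simp: distributed_def distr_id2)
  from std.normal_density_affine[OF this, of \<sigma> 0] normal(1)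
  have eq: "\<nu> = distr std_normal_distribution lborel (\<lambda>x. \<sigma> * x)"
    by (simp add: distributed_def normal(2))
  have "(\<integral>x. iexp x \<partial>\<nu>) = char std_normal_distribution \<sigma>"
    unfolding eq by (subst integral_distr) (auto simp: char_def)
  then show ?thesis
    unfolding char_std_normal_distribution by (simp add: normal variance_normal_density)
qed (simp add: integral_return)

lemma centered_normal_law_mgf:
  assumes "centered_normal_law \<nu>"
  shows "(\<integral>\<^sup>+x. ennreal (exp x) \<partial>\<nu>) = ennreal (exp ((\<integral>x. x\<^sup>2 \<partial>\<nu>) / 2))"
  using assms
proof (cases rule: centered_normal_law_cases)
  case (normal \<sigma>)
  \<comment> \<open>Completing the square in the exponent.\<close>
  have sq: "normal_density 0 \<sigma> x * exp x = exp (\<sigma>\<^sup>2 / 2) * normal_density (\<sigma>\<^sup>2) \<sigma> x" for x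
  proof -
    have "- x\<^sup>2 / (2 * \<sigma>\<^sup>2) + x = \<sigma>\<^sup>2 / 2 + - (x - \<sigma>\<^sup>2)\<^sup>2 / (2 * \<sigma>\<^sup>2)"
    proof -
      have "- a / (2 * s) + x = s / 2 + - (a - 2 * s * x + s * s) / (2 * s)" if "s \<noteq> 0" for s a :: real
        using that by (simp add: divide_simps)
      from this[of "\<sigma>\<^sup>2" "x\<^sup>2"] normal(1) show ?thesis
        by (simp add: power2_diff power2_eq_square[of "\<sigma>\<^sup>2"] mult_ac)
    qed
    then have "exp (- x\<^sup>2 / (2 * \<sigma>\<^sup>2)) * exp x = exp (\<sigma>\<^sup>2 / 2) * exp (- (x - \<sigma>\<^sup>2)\<^sup>2 / (2 * \<sigma>\<^sup>2))"
      by (simp only: exp_add[symmetric])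
    then show ?thesis by (simp add: normal_density_def)
  qed
  have "(\<integral>\<^sup>+x. ennreal (exp x) \<partial>\<nu>) = (\<integral>\<^sup>+x. ennreal (normal_density 0 \<sigma> x * exp x) \<partial>lborel)"
    by (simp add: normal(2) nn_integral_density ennreal_mult)
  also have "\<dots> = ennreal (exp (\<sigma>\<^sup>2 / 2)) * (\<integral>\<^sup>+x. ennreal (normal_density (\<sigma>\<^sup>2) \<sigma> x) \<partial>lborel)"
    unfolding sq by (subst nn_integral_cmult[symmetric]) (auto simp: ennreal_mult)
  also have "(\<integral>\<^sup>+x. ennreal (normal_density (\<sigma>\<^sup>2) \<sigma> x) \<partial>lborel) = 1"
    using normal(1) by (subst nn_integral_eq_integral) auto
  finally show ?thesis by (simp add: normal variance_normal_density)
qed (simp add: integral_return nn_integral_return)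

lemma measure_density_lborel:
  assumes [measurable]: "f \<in> borel_measurable borel" "A \<in> sets borel"
    and f: "\<And>x. 0 \<le> f x" "integrable lborel f"
  shows "measure (density lborel f) A = (\<integral>x. f x * indicator A x \<partial>lborel)"
proof -
  have int: "integrable lborel (\<lambda>x. f x * indicator A x)" using f(2) by (intro integrable_real_mult_indicator) auto
  have "emeasure (density lborel f) A = (\<integral>\<^sup>+x. ennreal (f x * indicator A x) \<partial>lborel)"
    by (auto simp: emeasure_density intro!: nn_integral_cong split: split_indicator)
  also have "\<dots> = ennreal (\<integral>x. f x * indicator A x \<partial>lborel)"
    using f int by (intro nn_integral_eq_integral) auto
  finally show ?thesis
    using f by (simp add: measure_def integral_nonneg_AE)
qed

text \<open>Among all translates of an interval, the one centred at \<open>0\<close> has the largest mass: the reflection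
\<open>x \<mapsto> v - x\<close> exchanges the two intervals, and it maps what the translate has in excess to points closer
to \<open>0\<close>, where the density is larger.\<close>

lemma centered_normal_law_interval_le:
  assumes "centered_normal_law \<nu>" "c \<ge> 0"
  shows "measure \<nu> {v - c..v + c} \<le> measure \<nu> {- c..c}"
  using assms(1)
proof (cases rule: centered_normal_law_cases)
  case (normal \<sigma>)
  let ?f = "normal_density 0 \<sigma>"
  have [simp]: "integrable lborel (\<lambda>x. ?f x * indicator A x)" if "A \<in> sets borel" for A
    using normal(1) that by (intro integrable_real_mult_indicator) auto
  have mono: "?f x \<le> ?f y" if "\<bar>y\<bar> \<le> \<bar>x\<bar>" for x y
  proof -
    have "y\<^sup>2 \<le> x\<^sup>2" using that by (rule abs_le_square_iff[THEN iffD1])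
    then have "- (x - 0)\<^sup>2 / (2 * \<sigma>\<^sup>2) \<le> - (y - 0)\<^sup>2 / (2 * \<sigma>\<^sup>2)"
      by (intro divide_right_mono) auto
    then show ?thesis unfolding normal_density_def by (intro mult_left_mono) auto
  qed
  define I J where IJ: "I = {v - c..v + c}" "J = {- c..c}"
  have [simp]: "I \<in> sets borel" "J \<in> sets borel" by (simp_all add: IJ)
  then have [simp]: "I - J \<in> sets borel" "J - I \<in> sets borel" by (auto simp del: sets.Diff intro: sets.Diff)
  have split: "(\<integral>x. ?f x * indicator A x \<partial>lborel)
      = (\<integral>x. ?f x * indicator (A \<inter> B) x \<partial>lborel) + (\<integral>x. ?f x * indicator (A - B) x \<partial>lborel)"
    if "A \<in> sets borel" "B \<in> sets borel" for A B
  proof -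
    have "?f x * indicator A x = ?f x * indicator (A \<inter> B) x + ?f x * indicator (A - B) x" for x
      by (simp add: indicator_def)
    then show ?thesis using that by (simp add: Bochner_Integration.integral_add)
  qed
  have meas: "measure \<nu> A = (\<integral>x. ?f x * indicator A x \<partial>lborel)" if "A \<in> sets borel" for A
    unfolding normal(2) using normal(1) that by (intro measure_density_lborel) auto
  have "(\<integral>x. ?f x * indicator (I - J) x \<partial>lborel) = (\<integral>x. ?f (v - x) * indicator (I - J) (v - x) \<partial>lborel)"
    using lborel_integral_real_affine[of "-1" "\<lambda>x. ?f x * indicator (I - J) x" v] by simp
  also have "\<dots> \<le> (\<integral>x. ?f x * indicator (J - I) x \<partial>lborel)"
  proof (rule integral_mono)
    have "integrable lborel (\<lambda>x. ?f x * indicator (I - J) x)" by simp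
    from lborel_integrable_real_affine[OF this, of "-1" v]
    show "integrable lborel (\<lambda>x. ?f (v - x) * indicator (I - J) (v - x))" by simp
    show "?f (v - x) * indicator (I - J) (v - x) \<le> ?f x * indicator (J - I) x" for x
    proof (cases "v - x \<in> I - J")
      case True
      then have "x \<in> J - I" "\<bar>x\<bar> \<le> \<bar>v - x\<bar>" unfolding IJ using assms(2) by auto
      with mono[of x "v - x"] True show ?thesis by (simp add: indicator_def)
    next
      case False
      then show ?thesis by (simp del: Diff_iff)
    qed
  qed simp
  finally have "measure \<nu> I \<le> measure \<nu> J"
    by (simp add: meas split[of I J] split[of J I] Int_commute)
  then show ?thesis by (simp add: IJ)
next
  case degenerate
  then show ?thesis using assms(2) by (auto simp: measure_return indicator_def)
qed

text \<open>A normal density with variance at least \<open>1\<close> is bounded by \<open>1\<close>.\<close>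

lemma centered_normal_law_interval_le_length:
  assumes "centered_normal_law \<nu>" "c \<ge> 0" and var: "1 \<le> (\<integral>x. x\<^sup>2 \<partial>\<nu>)"
  shows "measure \<nu> {- c..c} \<le> 2 * c"
  using assms(1)
proof (cases rule: centered_normal_law_cases)
  case (normal \<sigma>)
  let ?f = "normal_density 0 \<sigma>"
  have \<sigma>: "1 \<le> \<sigma>\<^sup>2" using var normal by (simp add: variance_normal_density)
  have "1 \<le> sqrt (2 * pi * \<sigma>\<^sup>2)"
  proof -
    have "1 * 1 \<le> 2 * pi * \<sigma>\<^sup>2" using pi_gt3 \<sigma> by (intro mult_mono) auto
    then show ?thesis by simp
  qed
  then have "1 / sqrt (2 * pi * \<sigma>\<^sup>2) \<le> 1" by simp
  moreover have "exp (- x\<^sup>2 / (2 * \<sigma>\<^sup>2)) \<le> 1" for x by simp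
  ultimately have f1: "?f x \<le> 1" for x
    unfolding normal_density_def by (intro mult_le_one) auto
  have "measure \<nu> {- c..c} = (\<integral>x. ?f x * indicator {-c..c} x \<partial>lborel)"
    unfolding normal(2) using normal(1) by (intro measure_density_lborel) auto
  also have "\<dots> \<le> (\<integral>x. indicator {-c..c} x \<partial>lborel)"
    using normal(1) f1
    by (intro integral_mono integrable_real_mult_indicator integrable_real_indicator) (auto simp: emeasure_lborel_Icc_eq split: split_indicator)
  also have "\<dots> = 2 * c" using assms(2) by simp
  finally show ?thesis .
qed (use var in \<open>simp add: integral_return\<close>)

section \<open>Quadratic forms with bounded spectral density\<close>

lemma sum_cos_diff_eq:
  fixes a \<theta> :: "nat \<Rightarrow> real"
  shows "(\<Sum>j<n. \<Sum>k<n. a j * a k * cos (\<theta> j - \<theta> k)) = (\<Sum>j<n. a j * cos (\<theta> j))\<^sup>2 + (\<Sum>j<n. a j * sin (\<theta> j))\<^sup>2"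
  by (simp add: power2_eq_square sum_product cos_diff sum.distrib[symmetric] algebra_simps)

lemma sum_cos_diff_le:
  fixes a \<theta> :: "nat \<Rightarrow> real"
  shows "(\<Sum>j<n. \<Sum>k<n. a j * a k * cos (\<theta> j - \<theta> k)) \<le> (\<Sum>j<n. \<bar>a j\<bar>)\<^sup>2"
proof -
  have "(\<Sum>j<n. \<Sum>k<n. a j * a k * cos (\<theta> j - \<theta> k)) \<le> (\<Sum>j<n. \<Sum>k<n. \<bar>a j\<bar> * \<bar>a k\<bar> * 1)"
  proof (intro sum_mono)
    fix j k
    have "a j * a k * cos (\<theta> j - \<theta> k) \<le> \<bar>a j * a k\<bar> * \<bar>cos (\<theta> j - \<theta> k)\<bar>"
      by (metis abs_ge_self abs_mult)
    also have "\<dots> \<le> \<bar>a j * a k\<bar> * 1" by (intro mult_left_mono) auto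
    finally show "a j * a k * cos (\<theta> j - \<theta> k) \<le> \<bar>a j\<bar> * \<bar>a k\<bar> * 1" by (simp add: abs_mult)
  qed
  then show ?thesis by (simp add: power2_eq_square sum_product)
qed

lemma has_bochner_integral_cos_period:
  assumes "h > (0::real)"
  shows "has_bochner_integral lborel (\<lambda>l. cos (l * (h * of_int i)) * indicator {- (pi / h)..pi / h} l)
    (if i = 0 then 2 * pi / h else 0)"
proof (cases "i = 0")
  case True
  have "has_bochner_integral lborel (\<lambda>l. (1::real) * indicator {- (pi / h)..pi / h} l) (pi / h - (- (pi / h)))"
    using assms by (intro has_bochner_integral_FTC_Icc_real) (auto intro!: derivative_eq_intros)
  then show ?thesis using True by simp
next
  case False
  have "has_bochner_integral lborel (\<lambda>l. cos (l * (h * of_int i)) * indicator {- (pi / h)..pi / h} l)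
    (sin (pi / h * (h * of_int i)) / (h * of_int i) - sin (- (pi / h) * (h * of_int i)) / (h * of_int i))"
    using assms False by (intro has_bochner_integral_FTC_Icc_real) (auto intro!: derivative_eq_intros)
  moreover have "pi / h * (h * of_int i) = of_int i * pi" "- (pi / h) * (h * of_int i) = - (of_int i * pi)"
    using assms by simp_all
  ultimately show ?thesis using False sin_npi_int[of i] by (simp add: mult.commute)
qed

text \<open>The quadratic form is the integral of the square modulus of a trigonometric polynomial against \<open>p\<close>.
On one period \<open>\<bar>l\<bar> \<le> pi / h\<close> it is estimated by orthogonality and the bound \<open>P\<close> for the density. Outside,
the polynomial is bounded trivially and \<open>1 \<le> (l * h / pi)\<^sup>2\<close> brings in the second spectral moment; this
contribution is of order \<open>h\<^sup>2\<close> and is made small by refining the mesh. Since no periodisation of \<open>p\<close> is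
formed, the first contribution stays bounded uniformly in \<open>h\<close> once \<open>h\<close> is taken out of the coefficients.\<close>

lemma spectral_quadratic_form_le:
  fixes p :: "real \<Rightarrow> real" and a :: "nat \<Rightarrow> real"
  assumes p: "\<And>l. 0 \<le> p l" "\<And>l. p l \<le> P" "integrable lborel p" "integrable lborel (\<lambda>l. l\<^sup>2 * p l)"
    and h: "h > 0"
  shows "(\<Sum>j<n. \<Sum>k<n. a j * a k * (\<integral>l. cos (l * (h * (real j - real k))) * p l \<partial>lborel))
    \<le> P * (2 * pi / h) * (\<Sum>k<n. (a k)\<^sup>2) + (\<Sum>k<n. \<bar>a k\<bar>)\<^sup>2 * (h\<^sup>2 / pi\<^sup>2) * (\<integral>l. l\<^sup>2 * p l \<partial>lborel)"
proof -
  define S where "S l = (\<Sum>j<n. \<Sum>k<n. a j * a k * cos (l * (h * (real j - real k))))" for l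
  have S: "S l = (\<Sum>j<n. \<Sum>k<n. a j * a k * cos (l * h * j - l * h * k))" for l
    by (simp add: S_def algebra_simps)
  have S0: "0 \<le> S l" for l
    unfolding S by (subst sum_cos_diff_eq) simp
  have S1: "S l \<le> (\<Sum>k<n. \<bar>a k\<bar>)\<^sup>2" for l
    unfolding S by (rule sum_cos_diff_le)
  have [measurable]: "p \<in> borel_measurable borel" using p(3) by simp
  have int: "integrable lborel (\<lambda>l. cos (l * (h * (real j - real k))) * p l)" for j k :: nat
    by (rule Bochner_Integration.integrable_bound[OF p(3)]) (auto simp: abs_mult p(1) intro!: mult_left_le_one_le)
  let ?I = "{- (pi / h)..pi / h}"
  have per: "has_bochner_integral lborel (\<lambda>l. a j * a k * (cos (l * (h * (real j - real k))) * indicator ?I l))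
    (a j * a k * (if j = k then 2 * pi / h else 0))" for j k :: nat
    using has_bochner_integral_mult_right[OF has_bochner_integral_cos_period[OF h, of "int j - int k"], of "a j * a k"]
    by simp
  have perS: "has_bochner_integral lborel (\<lambda>l. S l * indicator ?I l) (2 * pi / h * (\<Sum>k<n. (a k)\<^sup>2))"
  proof -
    have "has_bochner_integral lborel (\<lambda>l. \<Sum>j<n. \<Sum>k<n. a j * a k * (cos (l * (h * (real j - real k))) * indicator ?I l))
      (\<Sum>j<n. \<Sum>k<n. a j * a k * (if j = k then 2 * pi / h else 0))"
      by (intro has_bochner_integral_sum per)
    moreover have "(\<Sum>j<n. \<Sum>k<n. a j * a k * (if j = k then 2 * pi / h else 0)) = 2 * pi / h * (\<Sum>k<n. (a k)\<^sup>2)"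
      by (simp add: if_distrib sum.delta power2_eq_square sum_distrib_left mult_ac cong: if_cong)
    moreover have "(\<Sum>j<n. \<Sum>k<n. a j * a k * (cos (l * (h * (real j - real k))) * indicator ?I l)) = S l * indicator ?I l" for l
      by (simp only: S_def sum_distrib_right mult.assoc)
    ultimately show ?thesis by simp
  qed
  have "(\<Sum>j<n. \<Sum>k<n. a j * a k * (\<integral>l. cos (l * (h * (real j - real k))) * p l \<partial>lborel)) = (\<integral>l. S l * p l \<partial>lborel)"
    using int by (simp add: S_def sum_distrib_right mult.assoc)
  also have "\<dots> \<le> (\<integral>l. P * (S l * indicator ?I l) + (\<Sum>k<n. \<bar>a k\<bar>)\<^sup>2 * (h\<^sup>2 / pi\<^sup>2) * (l\<^sup>2 * p l) \<partial>lborel)"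
  proof (rule integral_mono)
    show "integrable lborel (\<lambda>l. S l * p l)"
      using int by (simp add: S_def sum_distrib_right mult.assoc)
    show "integrable lborel (\<lambda>l. P * (S l * indicator ?I l) + (\<Sum>k<n. \<bar>a k\<bar>)\<^sup>2 * (h\<^sup>2 / pi\<^sup>2) * (l\<^sup>2 * p l))"
      using perS p(4) by (auto simp: has_bochner_integral_iff)
    fix l
    show "S l * p l \<le> P * (S l * indicator ?I l) + (\<Sum>k<n. \<bar>a k\<bar>)\<^sup>2 * (h\<^sup>2 / pi\<^sup>2) * (l\<^sup>2 * p l)"
    proof (cases "l \<in> ?I")
      case True
      have "S l * p l \<le> S l * P" using S0 p(2) by (intro mult_left_mono)
      moreover have "0 \<le> (\<Sum>k<n. \<bar>a k\<bar>)\<^sup>2 * (h\<^sup>2 / pi\<^sup>2) * (l\<^sup>2 * p l)" using p(1) by simp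
      ultimately show ?thesis using True by (simp add: mult_ac)
    next
      case False
      then have "\<bar>l\<bar> \<ge> pi / h" by auto
      then have "pi \<le> \<bar>l\<bar> * h" using h by (simp add: divide_simps)
      then have "pi\<^sup>2 \<le> (\<bar>l\<bar> * h)\<^sup>2" by (intro power_mono) auto
      then have "1 \<le> h\<^sup>2 / pi\<^sup>2 * l\<^sup>2" by (simp add: power_mult_distrib divide_simps mult_ac)
      then have "1 * p l \<le> h\<^sup>2 / pi\<^sup>2 * l\<^sup>2 * p l" by (intro mult_right_mono p(1))
      then have "(\<Sum>k<n. \<bar>a k\<bar>)\<^sup>2 * p l \<le> (\<Sum>k<n. \<bar>a k\<bar>)\<^sup>2 * (h\<^sup>2 / pi\<^sup>2 * l\<^sup>2 * p l)"
        by (intro mult_left_mono) auto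
      moreover have "S l * p l \<le> (\<Sum>k<n. \<bar>a k\<bar>)\<^sup>2 * p l" using S1 p(1) by (intro mult_right_mono)
      ultimately show ?thesis using False by (simp add: mult.assoc)
    qed
  qed
  also have "\<dots> = P * (2 * pi / h) * (\<Sum>k<n. (a k)\<^sup>2) + (\<Sum>k<n. \<bar>a k\<bar>)\<^sup>2 * (h\<^sup>2 / pi\<^sup>2) * (\<integral>l. l\<^sup>2 * p l \<partial>lborel)"
    using perS p(4) by (simp add: has_bochner_integral_iff)
  finally show ?thesis .
qed

section \<open>Concentration of smooth functionals of Gaussian vectors\<close>

lemma nn_integral_eq_if_char_linear_combinations_eq:
  assumes P: "prob_space M" "prob_space N" and I: "finite I"
  assumes [measurable]: "\<And>i. i \<in> I \<Longrightarrow> Y i \<in> borel_measurable M" "\<And>i. i \<in> I \<Longrightarrow> Z i \<in> borel_measurable N"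
  assumes eq: "\<And>a. (\<integral>\<omega>. iexp (\<Sum>i\<in>I. a i * Y i \<omega>) \<partial>M) = (\<integral>\<omega>. iexp (\<Sum>i\<in>I. a i * Z i \<omega>) \<partial>N)"
  assumes f [measurable]: "f \<in> borel_measurable (PiM I (\<lambda>_. borel))"
  shows "(\<integral>\<^sup>+\<omega>. f (\<lambda>i\<in>I. Y i \<omega>) \<partial>M) = (\<integral>\<^sup>+\<omega>. f (\<lambda>i\<in>I. Z i \<omega>) \<partial>N)"
proof -
  have mY [measurable]: "(\<lambda>\<omega>. \<lambda>i\<in>I. Y i \<omega>) \<in> M \<rightarrow>\<^sub>M PiM I (\<lambda>_. borel)" by measurable
  have mZ [measurable]: "(\<lambda>\<omega>. \<lambda>i\<in>I. Z i \<omega>) \<in> N \<rightarrow>\<^sub>M PiM I (\<lambda>_. borel)" by measurable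
  have "(\<integral>\<^sup>+\<omega>. f (\<lambda>i\<in>I. Y i \<omega>) \<partial>M) = (\<integral>\<^sup>+x. f x \<partial>distr M (PiM I (\<lambda>_. borel)) (\<lambda>\<omega>. \<lambda>i\<in>I. Y i \<omega>))"
    by (simp add: nn_integral_distr)
  also have "\<dots> = (\<integral>\<^sup>+x. f x \<partial>distr N (PiM I (\<lambda>_. borel)) (\<lambda>\<omega>. \<lambda>i\<in>I. Z i \<omega>))"
    using distr_eq_if_char_linear_combinations_eq[OF P I assms(4,5) eq] by simp
  also have "\<dots> = (\<integral>\<^sup>+\<omega>. f (\<lambda>i\<in>I. Z i \<omega>) \<partial>N)"
    by (simp add: nn_integral_distr)
  finally show ?thesis .
qed

text \<open>Jensen's inequality for the exponential of an average over the quarter circle.\<close>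

lemma exp_increment_le_average:
  fixes f f' :: "real \<Rightarrow> real"
  assumes der: "\<And>\<theta>. (f has_real_derivative f' \<theta>) (at \<theta>)" and cont: "\<And>\<theta>. isCont f' \<theta>"
  shows "ennreal (exp (f (pi / 2) - f 0)) \<le>
    (\<integral>\<^sup>+\<theta>. ennreal (2 / pi) * indicator {0..pi / 2} \<theta> * ennreal (exp (pi / 2 * f' \<theta>)) \<partial>lborel)"
proof -
  let ?U = "uniform_measure lborel {0..pi / 2}"
  have em: "emeasure lborel {0..pi / 2} = ennreal (pi / 2)" by simp
  interpret U: prob_space ?U by (rule prob_space_uniform_measure) (auto simp: em)
  have contf: "continuous_on UNIV f'" using cont by (simp add: continuous_on_eq_continuous_at)
  then have [measurable]: "f' \<in> borel_measurable borel" by (rule borel_measurable_continuous_onI)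
  have inv: "1 / ennreal (pi / 2) = ennreal (2 / pi)"
  proof -
    have "ennreal 1 / ennreal (pi / 2) = ennreal (1 / (pi / 2))" by (rule divide_ennreal) auto
    moreover have "1 / (pi / 2) = 2 / pi" by simp
    ultimately show ?thesis by (simp only: ennreal_1)
  qed
  have dens: "?U = density lborel (\<lambda>\<theta>. ennreal (2 / pi * indicator {0..pi / 2} \<theta>))"
    unfolding uniform_measure_def em
    by (intro density_cong AE_I2) (auto simp: indicator_def inv)
  have "has_bochner_integral lborel (\<lambda>\<theta>. f' \<theta> * indicator {0..pi / 2} \<theta>) (f (pi / 2) - f 0)"
    using der cont by (intro has_bochner_integral_FTC_Icc_real) auto
  note FTC = this
  have int: "integrable ?U (\<lambda>\<theta>. pi / 2 * f' \<theta>)"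
    using FTC unfolding dens by (simp add: integrable_density has_bochner_integral_iff mult_ac)
  have "(\<integral>\<theta>. pi / 2 * f' \<theta> \<partial>?U) = (\<integral>\<theta>. (2 / pi * indicator {0..pi / 2} \<theta>) *\<^sub>R (pi / 2 * f' \<theta>) \<partial>lborel)"
    unfolding dens by (intro integral_density) auto
  also have "\<dots> = (\<integral>\<theta>. f' \<theta> * indicator {0..pi / 2} \<theta> \<partial>lborel)"
    by (intro Bochner_Integration.integral_cong) auto
  finally have avg: "(\<integral>\<theta>. pi / 2 * f' \<theta> \<partial>?U) = f (pi / 2) - f 0"
    using FTC by (simp add: has_bochner_integral_iff)
  have iexp: "integrable ?U (\<lambda>\<theta>. exp (pi / 2 * f' \<theta>))"
  proof -
    have "set_integrable lborel {0..pi / 2} (\<lambda>\<theta>. exp (pi / 2 * f' \<theta>))"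
      using continuous_on_subset[OF contf]
      by (intro borel_integrable_atLeastAtMost') (auto intro!: continuous_intros)
    then show ?thesis
      unfolding dens set_integrable_def by (simp add: integrable_density mult_ac)
  qed
  have "exp (\<integral>\<theta>. pi / 2 * f' \<theta> \<partial>?U) \<le> (\<integral>\<theta>. exp (pi / 2 * f' \<theta>) \<partial>?U)"
    using int iexp exp_convex by (intro U.jensens_inequality[where I=UNIV]) auto
  then have "ennreal (exp (f (pi / 2) - f 0)) \<le> ennreal (\<integral>\<theta>. exp (pi / 2 * f' \<theta>) \<partial>?U)"
    unfolding avg by (rule ennreal_leI)
  also have "\<dots> = (\<integral>\<^sup>+\<theta>. ennreal (exp (pi / 2 * f' \<theta>)) \<partial>?U)"
    using iexp by (intro nn_integral_eq_integral[symmetric]) auto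
  also have "\<dots> = (\<integral>\<^sup>+\<theta>. ennreal (2 / pi) * indicator {0..pi / 2} \<theta> * ennreal (exp (pi / 2 * f' \<theta>)) \<partial>lborel)"
    unfolding dens by (subst nn_integral_density) (auto simp: indicator_def intro!: nn_integral_cong)
  finally show ?thesis .
qed

text \<open>Given two independent copies of \<open>X\<close>, the components with first index \<open>True\<close> form the copy rotated by
\<open>\<theta>\<close>, and those with first index \<open>False\<close> form its derivative with respect to \<open>\<theta>\<close>.\<close>

definition rotation :: "real \<Rightarrow> ('i \<Rightarrow> 'a \<Rightarrow> real) \<Rightarrow> bool \<times> 'i \<Rightarrow> 'a \<times> 'a \<Rightarrow> real" where
  "rotation \<theta> X = (\<lambda>(b, t) (\<omega>, \<omega>').
     if b then cos \<theta> * X t \<omega> + sin \<theta> * X t \<omega>' else - sin \<theta> * X t \<omega> + cos \<theta> * X t \<omega>')"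

text \<open>Centered Gaussian vectors are described by their characteristic function, which also covers singular
covariance matrices.\<close>

definition centered_gaussian_vector :: "'a measure \<Rightarrow> 'i set \<Rightarrow> ('i \<Rightarrow> 'a \<Rightarrow> real) \<Rightarrow> bool" where
  "centered_gaussian_vector M I X \<longleftrightarrow>
     (\<forall>t\<in>I. X t \<in> borel_measurable M \<and> integrable M (\<lambda>\<omega>. (X t \<omega>)\<^sup>2)) \<and>
     (\<forall>a. (\<integral>\<omega>. iexp (\<Sum>t\<in>I. a t * X t \<omega>) \<partial>M)
        = complex_of_real (exp (- (\<integral>\<omega>. (\<Sum>t\<in>I. a t * X t \<omega>)\<^sup>2 \<partial>M) / 2)))"

lemma integrable_mult_if_integrable_squares:
  fixes f g :: "'a \<Rightarrow> real"
  assumes [measurable]: "f \<in> borel_measurable M" "g \<in> borel_measurable M"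
    and sq: "integrable M (\<lambda>\<omega>. (f \<omega>)\<^sup>2)" "integrable M (\<lambda>\<omega>. (g \<omega>)\<^sup>2)"
  shows "integrable M (\<lambda>\<omega>. f \<omega> * g \<omega>)"
proof (rule Bochner_Integration.integrable_bound[of _ "\<lambda>\<omega>. (f \<omega>)\<^sup>2 + (g \<omega>)\<^sup>2"])
  show "AE \<omega> in M. norm (f \<omega> * g \<omega>) \<le> norm ((f \<omega>)\<^sup>2 + (g \<omega>)\<^sup>2)"
  proof (rule AE_I2)
    fix \<omega>
    have "0 \<le> (\<bar>f \<omega>\<bar> - \<bar>g \<omega>\<bar>)\<^sup>2" by simp
    then have "2 * \<bar>f \<omega> * g \<omega>\<bar> \<le> (f \<omega>)\<^sup>2 + (g \<omega>)\<^sup>2"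
      by (simp add: power2_diff abs_mult)
    then show "norm (f \<omega> * g \<omega>) \<le> norm ((f \<omega>)\<^sup>2 + (g \<omega>)\<^sup>2)" by simp
  qed
qed (use sq in auto)

lemma (in prob_space) integral_pair_iexp_split:
  assumes [measurable]: "f \<in> borel_measurable M" "g \<in> borel_measurable M"
  shows "(\<integral>z. iexp (f (fst z) + g (snd z)) \<partial>(M \<Otimes>\<^sub>M M)) = (\<integral>\<omega>. iexp (f \<omega>) \<partial>M) * (\<integral>\<omega>. iexp (g \<omega>) \<partial>M)"
proof -
  interpret P: pair_prob_space M M ..
  have "integrable (M \<Otimes>\<^sub>M M) (\<lambda>z. iexp (f (fst z) + g (snd z)))"
    by (intro P.integrable_const_bound[where B=1]) auto
  from P.integral_fst'[OF this]
  have "(\<integral>z. iexp (f (fst z) + g (snd z)) \<partial>(M \<Otimes>\<^sub>M M)) = (\<integral>x. (\<integral>y. iexp (f x) * iexp (g y) \<partial>M) \<partial>M)"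
    by (simp add: exp_add distrib_left)
  then show ?thesis by simp
qed

text \<open>Rotation invariance: the rotated pair has the same joint law as the original pair of independent copies,
because the sum of the two variances in the exponent is unchanged by a rotation of the coefficients.\<close>

lemma integral_rotated_iexp:
  assumes "prob_space M" and I: "finite I" and X: "centered_gaussian_vector M I X"
  shows "(\<integral>z. iexp (\<Sum>i\<in>UNIV \<times> I. a i * rotation \<theta> X i z) \<partial>(M \<Otimes>\<^sub>M M))
    = (\<integral>z. iexp (\<Sum>i\<in>UNIV \<times> I. a i * rotation 0 X i z) \<partial>(M \<Otimes>\<^sub>M M))"
proof -
  interpret prob_space M by fact
  have [measurable]: "\<And>t. t \<in> I \<Longrightarrow> X t \<in> borel_measurable M"
    and sq: "\<And>t. t \<in> I \<Longrightarrow> integrable M (\<lambda>\<omega>. (X t \<omega>)\<^sup>2)"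
    and cf: "\<And>a. (\<integral>\<omega>. iexp (\<Sum>t\<in>I. a t * X t \<omega>) \<partial>M)
        = complex_of_real (exp (- (\<integral>\<omega>. (\<Sum>t\<in>I. a t * X t \<omega>)\<^sup>2 \<partial>M) / 2))"
    using X by (auto simp: centered_gaussian_vector_def)
  define L where "L v \<omega> = (\<Sum>t\<in>I. v t * X t \<omega>)" for v \<omega>
  have [measurable]: "L v \<in> borel_measurable M" for v unfolding L_def by measurable
  have prod: "integrable M (\<lambda>\<omega>. X s \<omega> * X t \<omega>)" if "s \<in> I" "t \<in> I" for s t
    using that sq by (intro integrable_mult_if_integrable_squares) auto
  have intLL: "integrable M (\<lambda>\<omega>. L v \<omega> * L w \<omega>)" for v w
  proof -
    have "L v \<omega> * L w \<omega> = (\<Sum>s\<in>I. \<Sum>t\<in>I. v s * w t * (X s \<omega> * X t \<omega>))" for \<omega>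
      by (simp add: L_def sum_product mult_ac)
    then show ?thesis using prod by simp
  qed
  define b c where "b t = a (True, t)" and "c t = a (False, t)" for t
  have rot: "(\<integral>z. iexp (\<Sum>i\<in>UNIV \<times> I. a i * rotation \<theta> X i z) \<partial>(M \<Otimes>\<^sub>M M))
      = complex_of_real (exp (- (\<integral>\<omega>. (L b \<omega>)\<^sup>2 + (L c \<omega>)\<^sup>2 \<partial>M) / 2))" for \<theta>
  proof -
    define v w where "v t = cos \<theta> * b t - sin \<theta> * c t" and "w t = sin \<theta> * b t + cos \<theta> * c t" for t
    have v: "L v \<omega> = cos \<theta> * L b \<omega> - sin \<theta> * L c \<omega>" and w: "L w \<omega> = sin \<theta> * L b \<omega> + cos \<theta> * L c \<omega>" for \<omega>
      by (simp_all add: L_def v_def w_def sum_distrib_left sum_subtractf[symmetric] sum.distrib[symmetric] algebra_simps)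
    have "(\<Sum>i\<in>UNIV \<times> I. a i * rotation \<theta> X i z) = L v (fst z) + L w (snd z)" for z
    proof -
      have "(\<Sum>i\<in>UNIV \<times> I. a i * rotation \<theta> X i z) = (\<Sum>x\<in>UNIV. \<Sum>t\<in>I. a (x, t) * rotation \<theta> X (x, t) z)"
        by (simp add: sum.cartesian_product split_beta')
      also have "\<dots> = L v (fst z) + L w (snd z)"
        by (simp add: UNIV_bool rotation_def L_def v_def w_def b_def c_def split_beta'
          sum.distrib[symmetric] algebra_simps)
      finally show ?thesis .
    qed
    then have "(\<integral>z. iexp (\<Sum>i\<in>UNIV \<times> I. a i * rotation \<theta> X i z) \<partial>(M \<Otimes>\<^sub>M M))
        = (\<integral>\<omega>. iexp (L v \<omega>) \<partial>M) * (\<integral>\<omega>. iexp (L w \<omega>) \<partial>M)"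
      using integral_pair_iexp_split[of "L v" "L w"] by simp
    also have "\<dots> = complex_of_real (exp (- ((\<integral>\<omega>. (L v \<omega>)\<^sup>2 \<partial>M) + (\<integral>\<omega>. (L w \<omega>)\<^sup>2 \<partial>M)) / 2))"
      unfolding L_def cf by (simp add: exp_add[symmetric] of_real_mult[symmetric] add_divide_distrib
        del: of_real_mult of_real_exp)
    also have "(\<integral>\<omega>. (L v \<omega>)\<^sup>2 \<partial>M) + (\<integral>\<omega>. (L w \<omega>)\<^sup>2 \<partial>M) = (\<integral>\<omega>. (L v \<omega>)\<^sup>2 + (L w \<omega>)\<^sup>2 \<partial>M)"
      using intLL[of v v] intLL[of w w] by (simp add: power2_eq_square)
    also have "(\<lambda>\<omega>. (L v \<omega>)\<^sup>2 + (L w \<omega>)\<^sup>2) = (\<lambda>\<omega>. (L b \<omega>)\<^sup>2 + (L c \<omega>)\<^sup>2)"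
    proof
      fix \<omega>
      have "(co * x - si * y)\<^sup>2 + (si * x + co * y)\<^sup>2 = (si\<^sup>2 + co\<^sup>2) * (x\<^sup>2 + y\<^sup>2)" for co si x y :: real
        by (simp add: power2_eq_square algebra_simps)
      then show "(L v \<omega>)\<^sup>2 + (L w \<omega>)\<^sup>2 = (L b \<omega>)\<^sup>2 + (L c \<omega>)\<^sup>2"
        unfolding v w by simp
    qed
    finally show ?thesis .
  qed
  show ?thesis unfolding rot ..
qed

text \<open>The Maurey-Pisier argument. For an independent copy \<open>X'\<close>, the increment \<open>F X' - F X\<close> is the integral of
the derivative of \<open>F\<close> along the quarter circle from \<open>X\<close> to \<open>X'\<close>. By Jensen's inequality its exponential
moment is at most an average over \<open>\<theta>\<close> of exponential moments of \<open>D X\<^sub>\<theta> Y\<^sub>\<theta>\<close>, where \<open>X\<^sub>\<theta>\<close> is the rotated vector and \<open>Y\<^sub>\<theta>\<close> its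
derivative; rotation invariance makes each of them equal to that of \<open>D X X'\<close>, in which \<open>X'\<close> may be
averaged first with \<open>X\<close> held fixed. The hypothesis on exponential moments therefore plays the part of a Lipschitz
bound for \<open>F\<close> in the metric of the covariance.\<close>

lemma gaussian_concentration:
  fixes F :: "('i \<Rightarrow> real) \<Rightarrow> real" and D :: "('i \<Rightarrow> real) \<Rightarrow> ('i \<Rightarrow> real) \<Rightarrow> real"
  assumes M: "prob_space M" and I: "finite I" and X: "centered_gaussian_vector M I X"
  assumes F_meas [measurable]: "(\<lambda>\<omega>. F (\<lambda>t. X t \<omega>)) \<in> borel_measurable M" and F_bdd: "\<And>x. \<bar>F x\<bar> \<le> b"
    and D_meas: "(\<lambda>z. D (\<lambda>t. z (True, t)) (\<lambda>t. z (False, t))) \<in> borel_measurable (PiM (UNIV \<times> I) (\<lambda>_. borel))"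
    and D_local: "\<And>x x' y y'. (\<And>t. t \<in> I \<Longrightarrow> x t = x' t) \<Longrightarrow> (\<And>t. t \<in> I \<Longrightarrow> y t = y' t) \<Longrightarrow> D x y = D x' y'"
    and D_deriv: "\<And>x y \<theta>. ((\<lambda>\<theta>. F (\<lambda>t. cos \<theta> * x t + sin \<theta> * y t)) has_real_derivative
        D (\<lambda>t. cos \<theta> * x t + sin \<theta> * y t) (\<lambda>t. - sin \<theta> * x t + cos \<theta> * y t)) (at \<theta>)"
    and D_cont: "\<And>x y \<theta>. isCont (\<lambda>\<theta>. D (\<lambda>t. cos \<theta> * x t + sin \<theta> * y t) (\<lambda>t. - sin \<theta> * x t + cos \<theta> * y t)) \<theta>"
    and mgf: "\<And>x \<kappa>. (\<integral>\<^sup>+\<omega>. ennreal (exp (\<kappa> * D x (\<lambda>t. X t \<omega>))) \<partial>M) \<le> ennreal (exp (\<kappa>\<^sup>2 * K / 2))"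
    and K: "K > 0" and s: "s > 0"
  shows "measure M {\<omega> \<in> space M. F (\<lambda>t. X t \<omega>) \<le> (\<integral>\<omega>. F (\<lambda>t. X t \<omega>) \<partial>M) - s} \<le> exp (- (2 * s\<^sup>2 / (pi\<^sup>2 * K)))"
proof -
  interpret prob_space M by fact
  interpret PP: pair_prob_space M M ..
  have [measurable]: "\<And>t. t \<in> I \<Longrightarrow> X t \<in> borel_measurable M"
    using X by (auto simp: centered_gaussian_vector_def)
  define \<Phi> where "\<Phi> \<omega> = F (\<lambda>t. X t \<omega>)" for \<omega>
  define m where "m = (\<integral>\<omega>. \<Phi> \<omega> \<partial>M)"
  have [measurable]: "\<Phi> \<in> borel_measurable M" unfolding \<Phi>_def by measurable
  have int\<Phi>: "integrable M \<Phi>"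
    using F_bdd by (intro integrable_const_bound[where B=b]) (auto simp: \<Phi>_def)
  \<comment> \<open>The value of \<open>l\<close> minimising the exponent \<open>(l * pi / 2)\<^sup>2 * K / 2 - l * s\<close> obtained at the end.\<close>
  define l where "l = 4 * s / (pi\<^sup>2 * K)"
  have l: "l > 0" using K s by (simp add: l_def)
  define f where "f z = ennreal (exp (l * pi / 2 * D (\<lambda>t. z (True, t)) (\<lambda>t. z (False, t))))" for z
  have f_meas [measurable]: "f \<in> borel_measurable (PiM (UNIV \<times> I) (\<lambda>_. borel))"
    unfolding f_def using D_meas by simp
  have rot_meas [measurable]: "rotation \<theta> X i \<in> borel_measurable (M \<Otimes>\<^sub>M M)" if "i \<in> UNIV \<times> I" for i \<theta>
    using that by (auto simp: rotation_def split_beta')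
  define R where "R \<theta> z = (\<lambda>i\<in>UNIV \<times> I. rotation \<theta> X i z)" for \<theta> z
  have [measurable]: "(\<lambda>(\<theta>, z). R \<theta> z) \<in> borel \<Otimes>\<^sub>M (M \<Otimes>\<^sub>M M) \<rightarrow>\<^sub>M PiM (UNIV \<times> I) (\<lambda>_. borel)"
    unfolding R_def split_beta'
    by (rule measurable_restrict) (auto simp: rotation_def split_beta')
  have fR: "f (R \<theta> (\<omega>, \<omega>')) = ennreal (exp (l * pi / 2 * D (\<lambda>t. cos \<theta> * X t \<omega> + sin \<theta> * X t \<omega>')
      (\<lambda>t. - sin \<theta> * X t \<omega> + cos \<theta> * X t \<omega>')))" for \<theta> \<omega> \<omega>'
    unfolding f_def R_def
    by (intro arg_cong[where f=ennreal] arg_cong[where f=exp] arg_cong2[where f="(*)"] D_local refl)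
       (auto simp: rotation_def)
  have interp: "ennreal (exp (l * (\<Phi> \<omega>' - \<Phi> \<omega>)))
      \<le> (\<integral>\<^sup>+\<theta>. ennreal (2 / pi) * indicator {0..pi / 2} \<theta> * f (R \<theta> (\<omega>, \<omega>')) \<partial>lborel)" for \<omega> \<omega>'
    using exp_increment_le_average[OF DERIV_cmult[OF D_deriv, of l] isCont_mult[OF continuous_const D_cont],
      of "\<lambda>t. X t \<omega>" "\<lambda>t. X t \<omega>'"]
    by (simp add: fR \<Phi>_def right_diff_distrib mult_ac)
  have rotated: "(\<integral>\<^sup>+z. f (R \<theta> z) \<partial>(M \<Otimes>\<^sub>M M)) \<le> ennreal (exp ((l * pi / 2)\<^sup>2 * K / 2))" for \<theta>
  proof -
    have "(\<integral>\<^sup>+z. f (R \<theta> z) \<partial>(M \<Otimes>\<^sub>M M)) = (\<integral>\<^sup>+z. f (R 0 z) \<partial>(M \<Otimes>\<^sub>M M))"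
      unfolding R_def using I
      by (intro nn_integral_eq_if_char_linear_combinations_eq integral_rotated_iexp M X PP.prob_space_axioms) auto
    also have "\<dots> = (\<integral>\<^sup>+\<omega>. \<integral>\<^sup>+\<omega>'. f (R 0 (\<omega>, \<omega>')) \<partial>M \<partial>M)"
      by (intro nn_integral_fst[symmetric]) simp
    also have "\<dots> \<le> (\<integral>\<^sup>+\<omega>. ennreal (exp ((l * pi / 2)\<^sup>2 * K / 2)) \<partial>M)"
      unfolding fR using mgf[of "l * pi / 2"] by (intro nn_integral_mono) simp
    also have "\<dots> = ennreal (exp ((l * pi / 2)\<^sup>2 * K / 2))" by (simp add: emeasure_space_1)
    finally show ?thesis .
  qed
  have symm: "(\<integral>\<^sup>+z. ennreal (exp (l * (\<Phi> (snd z) - \<Phi> (fst z)))) \<partial>(M \<Otimes>\<^sub>M M)) \<le> ennreal (exp ((l * pi / 2)\<^sup>2 * K / 2))"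
  proof -
    interpret LP: pair_sigma_finite "M \<Otimes>\<^sub>M M" lborel ..
    have "(\<integral>\<^sup>+z. ennreal (exp (l * (\<Phi> (snd z) - \<Phi> (fst z)))) \<partial>(M \<Otimes>\<^sub>M M))
        \<le> (\<integral>\<^sup>+z. \<integral>\<^sup>+\<theta>. ennreal (2 / pi) * indicator {0..pi / 2} \<theta> * f (R \<theta> z) \<partial>lborel \<partial>(M \<Otimes>\<^sub>M M))"
      using interp by (intro nn_integral_mono) (auto simp: split_beta')
    also have "\<dots> = (\<integral>\<^sup>+\<theta>. \<integral>\<^sup>+z. ennreal (2 / pi) * indicator {0..pi / 2} \<theta> * f (R \<theta> z) \<partial>(M \<Otimes>\<^sub>M M) \<partial>lborel)"
      by (rule LP.Fubini'[symmetric]) measurable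
    also have "\<dots> = (\<integral>\<^sup>+\<theta>. ennreal (2 / pi) * indicator {0..pi / 2} \<theta> * (\<integral>\<^sup>+z. f (R \<theta> z) \<partial>(M \<Otimes>\<^sub>M M)) \<partial>lborel)"
      by (intro nn_integral_cong nn_integral_cmult) measurable
    also have "\<dots> \<le> (\<integral>\<^sup>+\<theta>. (ennreal (2 / pi) * indicator {0..pi / 2} \<theta>) * ennreal (exp ((l * pi / 2)\<^sup>2 * K / 2)) \<partial>lborel)"
      by (intro nn_integral_mono mult_left_mono rotated) auto
    also have "\<dots> = ennreal (2 / pi) * ennreal (pi / 2) * ennreal (exp ((l * pi / 2)\<^sup>2 * K / 2))"
      by (simp add: nn_integral_multc nn_integral_cmult)
    also have "ennreal (2 / pi) * ennreal (pi / 2) = 1"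
      by (subst ennreal_mult[symmetric]) auto
    finally show ?thesis by simp
  qed
  \<comment> \<open>Jensen once more: averaging over the independent copy inside the exponential replaces it by the mean.\<close>
  have "(\<integral>\<^sup>+\<omega>. ennreal (exp (l * (m - \<Phi> \<omega>))) \<partial>M) \<le> (\<integral>\<^sup>+\<omega>. \<integral>\<^sup>+\<omega>'. ennreal (exp (l * (\<Phi> \<omega>' - \<Phi> \<omega>))) \<partial>M \<partial>M)"
  proof (intro nn_integral_mono)
    fix \<omega>
    have i: "integrable M (\<lambda>\<omega>'. exp (l * (\<Phi> \<omega>' - \<Phi> \<omega>)))"
    proof (rule integrable_const_bound[where B="exp (l * (b - \<Phi> \<omega>))"])
      show "AE \<omega>' in M. norm (exp (l * (\<Phi> \<omega>' - \<Phi> \<omega>))) \<le> exp (l * (b - \<Phi> \<omega>))"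
      proof (rule AE_I2)
        fix \<omega>'
        have "\<Phi> \<omega>' \<le> b" using F_bdd[of "\<lambda>t. X t \<omega>'"] by (simp add: \<Phi>_def)
        then show "norm (exp (l * (\<Phi> \<omega>' - \<Phi> \<omega>))) \<le> exp (l * (b - \<Phi> \<omega>))" using l by simp
      qed
    qed simp
    have "exp (\<integral>\<omega>'. l * (\<Phi> \<omega>' - \<Phi> \<omega>) \<partial>M) \<le> (\<integral>\<omega>'. exp (l * (\<Phi> \<omega>' - \<Phi> \<omega>)) \<partial>M)"
      using int\<Phi> i exp_convex by (intro jensens_inequality[where I=UNIV]) auto
    also have "(\<integral>\<omega>'. l * (\<Phi> \<omega>' - \<Phi> \<omega>) \<partial>M) = l * (m - \<Phi> \<omega>)"
      using int\<Phi> by (simp add: m_def prob_space)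
    finally have "ennreal (exp (l * (m - \<Phi> \<omega>))) \<le> ennreal (\<integral>\<omega>'. exp (l * (\<Phi> \<omega>' - \<Phi> \<omega>)) \<partial>M)"
      by (rule ennreal_leI)
    also have "\<dots> = (\<integral>\<^sup>+\<omega>'. ennreal (exp (l * (\<Phi> \<omega>' - \<Phi> \<omega>))) \<partial>M)"
      using i by (intro nn_integral_eq_integral[symmetric]) auto
    finally show "ennreal (exp (l * (m - \<Phi> \<omega>))) \<le> (\<integral>\<^sup>+\<omega>'. ennreal (exp (l * (\<Phi> \<omega>' - \<Phi> \<omega>))) \<partial>M)" .
  qed
  also have "\<dots> = (\<integral>\<^sup>+z. ennreal (exp (l * (\<Phi> (snd z) - \<Phi> (fst z)))) \<partial>(M \<Otimes>\<^sub>M M))"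
    by (subst nn_integral_fst[symmetric]) auto
  also note symm
  finally have mgf_low: "(\<integral>\<^sup>+\<omega>. ennreal (exp (l * (m - \<Phi> \<omega>))) \<partial>M) \<le> ennreal (exp ((l * pi / 2)\<^sup>2 * K / 2))" .
  have "ennreal (exp (l * s)) * emeasure M {\<omega> \<in> space M. \<Phi> \<omega> \<le> m - s}
      = (\<integral>\<^sup>+\<omega>. ennreal (exp (l * s)) * indicator {\<omega> \<in> space M. \<Phi> \<omega> \<le> m - s} \<omega> \<partial>M)"
    by (rule nn_integral_cmult_indicator[symmetric]) measurable
  also have "\<dots> \<le> (\<integral>\<^sup>+\<omega>. ennreal (exp (l * (m - \<Phi> \<omega>))) \<partial>M)"
    using l by (intro nn_integral_mono) (auto split: split_indicator)
  also note mgf_low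
  finally have "exp (l * s) * prob {\<omega> \<in> space M. \<Phi> \<omega> \<le> m - s} \<le> exp ((l * pi / 2)\<^sup>2 * K / 2)"
    by (simp add: emeasure_eq_measure ennreal_mult[symmetric])
  then have "prob {\<omega> \<in> space M. \<Phi> \<omega> \<le> m - s} \<le> exp ((l * pi / 2)\<^sup>2 * K / 2) / exp (l * s)"
    by (simp add: field_simps)
  also have "\<dots> = exp ((l * pi / 2)\<^sup>2 * K / 2 - l * s)" by (rule exp_diff[symmetric])
  also have "(l * pi / 2)\<^sup>2 * K / 2 - l * s = - (2 * s\<^sup>2 / (pi\<^sup>2 * K))"
  proof -
    have "l * (pi\<^sup>2 * K) = 4 * s" using K by (simp add: l_def)
    then have "l * (l * (pi\<^sup>2 * K)) = l * (4 * s)" by simp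
    then have "(l * pi / 2)\<^sup>2 * K / 2 = l * s / 2" by (simp add: power2_eq_square mult_ac)
    moreover have "l * s / 2 = 2 * s\<^sup>2 / (pi\<^sup>2 * K)" by (simp add: l_def power2_eq_square)
    ultimately show ?thesis by simp
  qed
  finally show ?thesis by (simp add: \<Phi>_def m_def)
qed

section \<open>Zeros, sign changes and visits to a band\<close>

text \<open>The intermediate value theorem puts a zero into the interior of every cell with a sign change, and these
interiors are disjoint.\<close>

lemma card_sign_changes_le_zero_count:
  fixes f :: "real \<Rightarrow> real"
  assumes f: "continuous_on UNIV f" and d: "d > 0" and sub: "{x..x + of_nat Q * d} \<subseteq> I"
  shows "ennreal (real (card {q. q < Q \<and> f (x + real q * d) * f (x + real (Suc q) * d) < 0}))
    \<le> emeasure (count_space UNIV) {t \<in> I. f t = 0}"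
proof -
  define S where "S = {q. q < Q \<and> f (x + real q * d) * f (x + real (Suc q) * d) < 0}"
  have "\<exists>t. x + real q * d < t \<and> t < x + real (Suc q) * d \<and> f t = 0" if "q \<in> S" for q
  proof -
    have neg: "f (x + real q * d) * f (x + real (Suc q) * d) < 0" using that by (simp add: S_def)
    have le: "x + real q * d \<le> x + real (Suc q) * d" using d by (simp add: algebra_simps)
    have c: "continuous_on {x + real q * d..x + real (Suc q) * d} f"
      using f continuous_on_subset by blast
    have "\<exists>t. x + real q * d \<le> t \<and> t \<le> x + real (Suc q) * d \<and> f t = 0"
      using neg IVT'[of f "x + real q * d" 0 "x + real (Suc q) * d"]
        IVT2'[of f "x + real (Suc q) * d" 0 "x + real q * d"] le c
      by (auto simp: mult_less_0_iff)
    then obtain t where t: "x + real q * d \<le> t" "t \<le> x + real (Suc q) * d" "f t = 0" by blast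
    moreover have "t \<noteq> x + real q * d" "t \<noteq> x + real (Suc q) * d" using neg t(3) by auto
    ultimately show ?thesis by (intro exI[of _ t]) auto
  qed
  then obtain z where z: "\<And>q. q \<in> S \<Longrightarrow> x + real q * d < z q \<and> z q < x + real (Suc q) * d \<and> f (z q) = 0"
    by metis
  have inj: "inj_on z S"
  proof (rule linorder_inj_onI)
    fix q r assume "q < r" "q \<in> S" "r \<in> S"
    then have "real (Suc q) * d \<le> real r * d" using d by (intro mult_right_mono) auto
    then show "z q \<noteq> z r" using z[OF \<open>q \<in> S\<close>] z[OF \<open>r \<in> S\<close>] by linarith
  qed auto
  have zI: "z q \<in> {t \<in> I. f t = 0}" if "q \<in> S" for q
  proof -
    have "real (Suc q) * d \<le> of_nat Q * d" "0 \<le> real q * d"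
      using that d by (auto simp: S_def intro!: mult_right_mono)
    then have "z q \<in> {x..x + of_nat Q * d}" using z[OF that] by auto
    then show ?thesis using sub z[OF that] by auto
  qed
  have "finite S" by (simp add: S_def)
  then have "ennreal (real (card S)) = emeasure (count_space UNIV) (z ` S)"
    using inj by (simp add: emeasure_count_space_finite card_image ennreal_of_nat_eq_real_of_nat)
  also have "\<dots> \<le> emeasure (count_space UNIV) {t \<in> I. f t = 0}"
    using zI by (intro emeasure_mono) auto
  finally show ?thesis unfolding S_def .
qed

text \<open>The points \<open>k * h\<close> split into \<open>m\<close> grids of spacing \<open>m * h\<close>, according to \<open>k mod m\<close>. Each of them shows at
most as many sign changes as there are zeros, hence so does their average.\<close>

lemma averaged_sign_changes_le_zero_count:
  fixes f :: "real \<Rightarrow> real" and \<psi> :: "real \<Rightarrow> real \<Rightarrow> real"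
  assumes f: "continuous_on UNIV f" and h: "h > 0" and m: "m > 0"
    and \<psi>: "\<And>x y. \<psi> x y \<le> (if x * y < 0 then 1 else 0)"
    and T: "real (m * Suc Q) * h \<le> T"
  shows "ennreal ((\<Sum>k<Q * m. \<psi> (f (real k * h)) (f (real (k + m) * h))) / m)
    \<le> emeasure (count_space UNIV) {t \<in> {0..T}. f t = 0}"
proof (cases "emeasure (count_space UNIV) {t \<in> {0..T}. f t = 0}" rule: ennreal_cases)
  case (real z)
  have blk: "(\<Sum>q<Q. \<psi> (f (real (q * m + i) * h)) (f (real (q * m + i + m) * h))) \<le> z" if i: "i < m" for i
  proof -
    let ?S = "{q. q < Q \<and> f (real i * h + real q * (m * h)) * f (real i * h + real (Suc q) * (m * h)) < 0}"
    have "(\<Sum>q<Q. \<psi> (f (real (q * m + i) * h)) (f (real (q * m + i + m) * h)))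
        \<le> (\<Sum>q<Q. if q \<in> ?S then 1 else 0)"
    proof (rule sum_mono)
      fix q assume "q \<in> {..<Q}"
      moreover have "real (q * m + i) * h = real i * h + real q * (m * h)"
        "real (q * m + i + m) * h = real i * h + real (Suc q) * (m * h)" by (simp_all add: algebra_simps)
      ultimately show "\<psi> (f (real (q * m + i) * h)) (f (real (q * m + i + m) * h)) \<le> (if q \<in> ?S then 1 else 0)"
        using \<psi> by simp
    qed
    also have "\<dots> = real (card ?S)" by (simp add: sum.If_cases Int_def conj_commute lessThan_def)
    also have "\<dots> \<le> z"
    proof -
      have "real i * h + real Q * (m * h) \<le> real (m * Suc Q) * h"
      proof -
        have "real i * h \<le> real m * h" using i h by (intro mult_right_mono) auto
        then show ?thesis by (simp add: algebra_simps)
      qed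
      then have "{real i * h..real i * h + real Q * (m * h)} \<subseteq> {0..T}" using T h by auto
      with card_sign_changes_le_zero_count[OF f, of "m * h" "real i * h" Q "{0..T}"]
      have "ennreal (real (card ?S)) \<le> ennreal z" using h m real by simp
      then show ?thesis using real by simp
    qed
    finally show ?thesis .
  qed
  have "(\<Sum>k<Q * m. \<psi> (f (real k * h)) (f (real (k + m) * h)))
      = (\<Sum>q<Q. \<Sum>k\<in>{q * m..<q * m + m}. \<psi> (f (real k * h)) (f (real (k + m) * h)))"
    by (rule sum.nat_group[symmetric])
  also have "\<dots> = (\<Sum>q<Q. \<Sum>i<m. \<psi> (f (real (q * m + i) * h)) (f (real (q * m + i + m) * h)))"
  proof (rule sum.cong)
    fix q
    show "(\<Sum>k\<in>{q * m..<q * m + m}. \<psi> (f (real k * h)) (f (real (k + m) * h)))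
      = (\<Sum>i<m. \<psi> (f (real (q * m + i) * h)) (f (real (q * m + i + m) * h)))"
      using sum.shift_bounds_nat_ivl[of "\<lambda>k. \<psi> (f (real k * h)) (f (real (k + m) * h))" 0 "q * m" m]
      by (simp add: lessThan_atLeast0 add.commute add.left_commute)
  qed simp
  also have "\<dots> = (\<Sum>i<m. \<Sum>q<Q. \<psi> (f (real (q * m + i) * h)) (f (real (q * m + i + m) * h)))"
    by (rule sum.swap)
  also have "\<dots> \<le> (\<Sum>i<m. z)" using blk by (intro sum_mono) auto
  also have "\<dots> = m * z" by simp
  finally have "(\<Sum>k<Q * m. \<psi> (f (real k * h)) (f (real (k + m) * h))) / m \<le> z"
    using m by (simp add: divide_simps mult.commute)
  then show ?thesis unfolding real(2) by (rule ennreal_leI)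
qed simp

text \<open>How often, along the dyadic grid of order \<open>n\<close>, the value enters or leaves the band \<open>[-u, u]\<close>. Unlike
sign changes, this also registers zeros at which the function does not change its sign.\<close>

definition level_changes :: "(real \<Rightarrow> real) \<Rightarrow> nat \<Rightarrow> real \<Rightarrow> nat" where
  "level_changes f n u =
     card {j. j < 2 ^ n \<and> (\<bar>f (real j / 2 ^ n)\<bar> \<le> u) \<noteq> (\<bar>f (real (Suc j) / 2 ^ n)\<bar> \<le> u)}"

lemma change_between:
  assumes "a \<le> (c::nat)" "b a \<noteq> b c"
  shows "\<exists>j\<in>{a..<c}. b j \<noteq> b (Suc j)"
  using assms
proof (induction c rule: dec_induct)
  case (step n)
  then show ?case by (cases "b a = b n") (auto intro: less_imp_le_nat)
qed simp

lemma card_changes_ge_2: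
  assumes "lo \<le> mid" "mid \<le> hi" "b lo \<noteq> b mid" "b mid \<noteq> b hi"
  shows "2 \<le> card {j\<in>{lo..<hi::nat}. b j \<noteq> b (Suc j)}"
proof -
  obtain i j where "i \<in> {lo..<mid}" "j \<in> {mid..<hi}" "b i \<noteq> b (Suc i)" "b j \<noteq> b (Suc j)"
    using change_between[OF assms(1,3)] change_between[OF assms(2,4)] by auto
  then have "{i, j} \<subseteq> {j\<in>{lo..<hi}. b j \<noteq> b (Suc j)}" "i \<noteq> j" by auto
  moreover have "finite {j\<in>{lo..<hi}. b j \<noteq> b (Suc j)}" by simp
  ultimately have "card {i, j} \<le> card {j\<in>{lo..<hi}. b j \<noteq> b (Suc j)}" by (intro card_mono)
  with \<open>i \<noteq> j\<close> show ?thesis by simp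
qed

lemma nat_floor_bounds:
  assumes "0 \<le> (x::real)"
  shows "real (nat \<lfloor>x\<rfloor>) \<le> x" "x < real (Suc (nat \<lfloor>x\<rfloor>))"
proof -
  have "real (nat \<lfloor>x\<rfloor>) = of_int \<lfloor>x\<rfloor>" using assms by simp
  then show "real (nat \<lfloor>x\<rfloor>) \<le> x" "x < real (Suc (nat \<lfloor>x\<rfloor>))"
    using floor_correct[of x] by linarith+
qed

lemma dyadic_floor_tendsto: "(\<lambda>n. real (nat \<lfloor>t * 2 ^ n\<rfloor>) / 2 ^ n) \<longlonglongrightarrow> t" if "0 \<le> t" for t :: real
proof (rule tendsto_sandwich)
  have b: "t - 1 / 2 ^ n \<le> real (nat \<lfloor>t * 2 ^ n\<rfloor>) / 2 ^ n" "real (nat \<lfloor>t * 2 ^ n\<rfloor>) / 2 ^ n \<le> t" for n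
  proof -
    have "t * 2 ^ n - 1 \<le> real (nat \<lfloor>t * 2 ^ n\<rfloor>)" "real (nat \<lfloor>t * 2 ^ n\<rfloor>) \<le> t * 2 ^ n"
      using nat_floor_bounds[of "t * 2 ^ n"] that by simp_all
    then have "(t * 2 ^ n - 1) / 2 ^ n \<le> real (nat \<lfloor>t * 2 ^ n\<rfloor>) / 2 ^ n"
      "real (nat \<lfloor>t * 2 ^ n\<rfloor>) / 2 ^ n \<le> t * 2 ^ n / 2 ^ n"
      by (intro divide_right_mono; simp)+
    then show "t - 1 / 2 ^ n \<le> real (nat \<lfloor>t * 2 ^ n\<rfloor>) / 2 ^ n" "real (nat \<lfloor>t * 2 ^ n\<rfloor>) / 2 ^ n \<le> t"
      by (simp_all only: diff_divide_distrib) simp_all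
  qed
  show "\<forall>\<^sub>F n in sequentially. t - 1 / 2 ^ n \<le> real (nat \<lfloor>t * 2 ^ n\<rfloor>) / 2 ^ n"
    "\<forall>\<^sub>F n in sequentially. real (nat \<lfloor>t * 2 ^ n\<rfloor>) / 2 ^ n \<le> t"
    using b by simp_all
  have "(\<lambda>n. 1 / 2 ^ n :: real) \<longlonglongrightarrow> 0"
    using LIMSEQ_realpow_zero[of "1/2::real"] by (simp add: power_one_over)
  then show "(\<lambda>n. t - 1 / 2 ^ n) \<longlonglongrightarrow> t" using tendsto_diff[OF tendsto_const[of t]] by fastforce
qed simp

text \<open>Once the dyadic cells of some order \<open>N\<close> separate the zeros, every cell with a zero inside has end points at
which \<open>\<bar>f\<bar> > u\<close>. A sufficiently fine grid meets the band \<open>[-u, u]\<close> near the zero, so the band is entered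
and left again within the cell, which makes two changes for every zero.\<close>

lemma level_changes_ge_zeros:
  fixes f :: "real \<Rightarrow> real"
  assumes f: "continuous_on UNIV f" and nz: "\<And>n j. f (real j / 2 ^ n) \<noteq> 0"
    and S: "finite S" "S \<subseteq> {t \<in> {0..1}. f t = 0}"
  shows "\<exists>u0>0. \<forall>u. 0 < u \<and> u < u0 \<longrightarrow> (\<forall>\<^sub>F n in sequentially. 2 * card S \<le> level_changes f n u)"
proof -
  define g where "g n t = nat \<lfloor>t * 2 ^ n\<rfloor>" for n :: nat and t :: real
  have cell: "real (g n t) \<le> t * 2 ^ n" "t * 2 ^ n < real (Suc (g n t))" if "t \<in> S" for n t
  proof -
    have "0 \<le> t * 2 ^ n" using that S by auto
    then show "real (g n t) \<le> t * 2 ^ n" "t * 2 ^ n < real (Suc (g n t))"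
      unfolding g_def by (rule nat_floor_bounds)+
  qed
  have "\<forall>\<^sub>F n in sequentially. \<forall>t\<in>S. \<forall>t'\<in>S. t \<noteq> t' \<longrightarrow> g n t \<noteq> g n t'"
  proof (intro eventually_ball_finite S(1) ballI)
    fix t t' assume tt: "t \<in> S" "t' \<in> S"
    show "\<forall>\<^sub>F n in sequentially. t \<noteq> t' \<longrightarrow> g n t \<noteq> g n t'"
    proof (cases "t = t'")
      case False
      have lim: "(\<lambda>n. real (g n t) / 2 ^ n - real (g n t') / 2 ^ n) \<longlonglongrightarrow> t - t'"
        using tt S unfolding g_def by (intro tendsto_diff dyadic_floor_tendsto) auto
      have "\<forall>\<^sub>F n in sequentially. real (g n t) / 2 ^ n - real (g n t') / 2 ^ n \<noteq> 0"
        by (rule tendsto_imp_eventually_ne[OF lim]) (use False in simp)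
      then show ?thesis by (rule eventually_mono) auto
    qed simp
  qed
  then obtain N where N: "inj_on (g N) S"
    by (auto simp: eventually_sequentially inj_on_def)
  \<comment> \<open>Below this level, all grid points of order \<open>N\<close> lie outside the band.\<close>
  define u0 where "u0 = Min ((\<lambda>j. \<bar>f (real j / 2 ^ N)\<bar>) ` {..2 ^ N})"
  have u0: "u0 > 0" unfolding u0_def using nz by (subst Min_gr_iff) auto
  have u0_le: "u0 \<le> \<bar>f (real j / 2 ^ N)\<bar>" if "j \<le> 2 ^ N" for j
    unfolding u0_def using that by (intro Min_le) auto
  have gN: "g N t < 2 ^ N" if "t \<in> S" for t
  proof -
    have "f 1 \<noteq> 0" using nz[of 1 0] by simp
    moreover have "t \<le> 1" "f t = 0" using that S by auto
    ultimately have "t < 1" by (cases "t = 1") auto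
    then have "t * 2 ^ N < 2 ^ N" by simp
    with cell(1)[OF that, of N] have "real (g N t) < 2 ^ N" by linarith
    then have "real (g N t) < real (2 ^ N)" by simp
    then show ?thesis by (simp only: of_nat_less_iff)
  qed
  have "\<forall>\<^sub>F n in sequentially. 2 * card S \<le> level_changes f n u" if u: "0 < u" "u < u0" for u
  proof -
    have "\<forall>\<^sub>F n in sequentially. \<forall>t\<in>S. \<bar>f (real (g n t) / 2 ^ n)\<bar> < u"
    proof (intro eventually_ball_finite S(1) ballI)
      fix t assume t: "t \<in> S"
      have "(\<lambda>n. real (g n t) / 2 ^ n) \<longlonglongrightarrow> t"
        using t S unfolding g_def by (intro dyadic_floor_tendsto) auto
      moreover have "isCont f t" using f by (simp add: continuous_on_eq_continuous_at)
      ultimately have "(\<lambda>n. f (real (g n t) / 2 ^ n)) \<longlonglongrightarrow> f t" by (rule isCont_tendsto_compose[rotated])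
      then have "(\<lambda>n. \<bar>f (real (g n t) / 2 ^ n)\<bar>) \<longlonglongrightarrow> 0" using t S tendsto_rabs by fastforce
      then show "\<forall>\<^sub>F n in sequentially. \<bar>f (real (g n t) / 2 ^ n)\<bar> < u"
        using u(1) by (rule order_tendstoD)
    qed
    moreover have "\<forall>\<^sub>F n in sequentially. N \<le> n" by (rule eventually_ge_at_top)
    ultimately show ?thesis
    proof eventually_elim
      case (elim n)
      define l where "l = n - N"
      have n: "n = N + l" using elim by (simp add: l_def)
      define b where "b j = (\<bar>f (real j / 2 ^ n)\<bar> \<le> u)" for j
      define B where "B i = {j\<in>{i * 2 ^ l..<Suc i * 2 ^ l}. b j \<noteq> b (Suc j)}" for i
      have coarse: "real (i * 2 ^ l) / 2 ^ n = real i / 2 ^ N" for i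
        by (simp add: n power_add)
      have B2: "2 \<le> card (B (g N t))" if t: "t \<in> S" for t
      proof -
        have c: "real (g N t) * 2 ^ l \<le> t * 2 ^ n" "t * 2 ^ n < real (Suc (g N t)) * 2 ^ l"
          using cell[OF t, of N] by (simp_all add: n power_add mult.assoc[symmetric])
        have "real (g N t * 2 ^ l) < real (Suc (g n t))" using c(1) cell(2)[OF t, of n] by simp
        then have lo: "g N t * 2 ^ l \<le> g n t" by (simp only: of_nat_less_iff less_Suc_eq_le)
        have "real (g n t) < real (Suc (g N t) * 2 ^ l)"
          using c(2) cell(1)[OF t, of n] by (simp only: of_nat_mult of_nat_power of_nat_numeral)
        then have hi: "g n t \<le> Suc (g N t) * 2 ^ l" by (simp only: of_nat_less_iff less_imp_le)
        have "b (g n t)" using elim t by (simp add: b_def less_imp_le)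
        moreover have "\<not> b (g N t * 2 ^ l)" "\<not> b (Suc (g N t) * 2 ^ l)"
          using u0_le[of "g N t"] u0_le[of "Suc (g N t)"] gN[OF t] u(2) unfolding b_def coarse by auto
        ultimately show ?thesis unfolding B_def using lo hi by (intro card_changes_ge_2) auto
      qed
      have disj: "B i \<inter> B i' = {}" if "i < i'" for i i'
      proof -
        have "Suc i * 2 ^ l \<le> i' * 2 ^ l" using that by (intro mult_right_mono) auto
        then show ?thesis by (auto simp: B_def)
      qed
      have fin: "finite (B i)" for i by (simp add: B_def)
      have "2 * card S = (\<Sum>t\<in>S. 2)" by simp
      also have "\<dots> \<le> (\<Sum>t\<in>S. card (B (g N t)))" using B2 by (intro sum_mono)
      also have "\<dots> = (\<Sum>i\<in>g N ` S. card (B i))" using N by (simp add: sum.reindex)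
      also have "\<dots> = card (\<Union>i\<in>g N ` S. B i)"
      proof (rule card_UN_disjoint[symmetric])
        show "\<forall>i\<in>g N ` S. \<forall>j\<in>g N ` S. i \<noteq> j \<longrightarrow> B i \<inter> B j = {}"
          using disj by (metis Int_commute linorder_neqE_nat)
      qed (use S fin in auto)
      also have "\<dots> \<le> level_changes f n u"
        unfolding level_changes_def
      proof (rule card_mono)
        show "(\<Union>i\<in>g N ` S. B i) \<subseteq> {j. j < 2 ^ n \<and> (\<bar>f (real j / 2 ^ n)\<bar> \<le> u) \<noteq> (\<bar>f (real (Suc j) / 2 ^ n)\<bar> \<le> u)}"
        proof clarify
          fix t j assume t: "t \<in> S" and j: "j \<in> B (g N t)"
          have "j < Suc (g N t) * 2 ^ l" using j by (simp add: B_def)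
          also have "\<dots> \<le> 2 ^ N * 2 ^ l" using gN[OF t] by (intro mult_right_mono) auto
          finally have "j < 2 ^ n" by (simp add: n power_add)
          then show "j < 2 ^ n \<and> (\<bar>f (real j / 2 ^ n)\<bar> \<le> u) \<noteq> (\<bar>f (real (Suc j) / 2 ^ n)\<bar> \<le> u)"
            using j by (simp add: B_def b_def)
        qed
      qed simp
      finally show ?case .
    qed
  qed
  then show ?thesis using u0 by blast
qed

lemma emeasure_count_space_le_if_finite_subsets:
  assumes "\<And>S. finite S \<Longrightarrow> S \<subseteq> A \<Longrightarrow> ennreal (real (card S)) \<le> B"
  shows "emeasure (count_space UNIV) A \<le> B"
proof (cases "finite A")
  case True
  then show ?thesis using assms[of A]
    by (simp add: ennreal_of_nat_eq_real_of_nat)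
next
  case False
  have "B = \<top>"
  proof (rule ccontr)
    assume "B \<noteq> \<top>"
    then obtain b where b: "B = ennreal b" "b \<ge> 0" by (cases B rule: ennreal_cases) auto
    obtain n where n: "b < real n" using reals_Archimedean2 by blast
    obtain S where "finite S" "card S = n" "S \<subseteq> A" using infinite_arbitrarily_large[OF False] by blast
    then have "real n \<le> b" using assms[of S] b by simp
    then show False using n by simp
  qed
  then show ?thesis by simp
qed

lemma zero_count_le_liminf_level_changes:
  fixes f :: "real \<Rightarrow> real"
  assumes f: "continuous_on UNIV f" and nz: "\<And>n j. f (real j / 2 ^ n) \<noteq> 0"
  shows "emeasure (count_space UNIV) {t \<in> {0..1}. f t = 0}
    \<le> liminf (\<lambda>k. liminf (\<lambda>n. ennreal (real (level_changes f n (1 / real (Suc k))) / 2)))"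
proof (rule emeasure_count_space_le_if_finite_subsets)
  fix S assume S: "finite S" "S \<subseteq> {t \<in> {0..1}. f t = 0}"
  obtain u0 where u0: "u0 > 0"
    "\<And>u. 0 < u \<Longrightarrow> u < u0 \<Longrightarrow> (\<forall>\<^sub>F n in sequentially. 2 * card S \<le> level_changes f n u)"
    using level_changes_ge_zeros[OF f nz S] by blast
  have "\<forall>\<^sub>F k in sequentially. 1 / real (Suc k) < u0"
    using order_tendstoD(2)[OF LIMSEQ_inverse_real_of_nat u0(1)] by (simp add: inverse_eq_divide)
  then have "\<forall>\<^sub>F k in sequentially. ennreal (real (card S))
      \<le> liminf (\<lambda>n. ennreal (real (level_changes f n (1 / real (Suc k))) / 2))"
  proof eventually_elim
    case (elim k)
    have "\<forall>\<^sub>F n in sequentially. 2 * card S \<le> level_changes f n (1 / real (Suc k))"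
      using elim by (intro u0(2)) auto
    then show ?case
    proof (intro Liminf_bounded, eventually_elim)
      case (elim n)
      then have "real (card S) \<le> real (level_changes f n (1 / real (Suc k))) / 2" by linarith
      then show ?case by (rule ennreal_leI)
    qed
  qed
  then show "ennreal (real (card S))
      \<le> liminf (\<lambda>k. liminf (\<lambda>n. ennreal (real (level_changes f n (1 / real (Suc k))) / 2)))"
    by (rule Liminf_bounded)
qed

section \<open>Level crossings of stationary Gaussian processes\<close>

lemma absolutely_continuous_path_imp_continuous:
  assumes "absolutely_continuous_path f"
  shows "continuous_on UNIV f"
  unfolding continuous_on_iff
proof (intro ballI allI impI)
  fix x e :: real assume "e > 0"
  have "absolutely_continuous_on (x - 1) (x + 1) f"
    using assms by (simp add: absolutely_continuous_path_def)
  from this[unfolded absolutely_continuous_on_def, rule_format, OF \<open>e > 0\<close>]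
  obtain d where d: "d > 0" "\<And>D. finite D \<and> (\<forall>(u, v)\<in>D. x - 1 \<le> u \<and> u \<le> v \<and> v \<le> x + 1) \<and>
      disjoint_family_on (\<lambda>(u, v). {u<..<v}) D \<and> (\<Sum>(u, v)\<in>D. v - u) < d \<Longrightarrow>
      (\<Sum>(u, v)\<in>D. \<bar>f v - f u\<bar>) < e" by blast
  show "\<exists>d>0. \<forall>y\<in>UNIV. dist y x < d \<longrightarrow> dist (f y) (f x) < e"
  proof (intro exI[of _ "min d 1"] conjI ballI impI)
    fix y assume y: "dist y x < min d 1"
    have "\<bar>f (max x y) - f (min x y)\<bar> < e"
      using d(2)[of "{(min x y, max x y)}"] y
      by (auto simp: dist_real_def disjoint_family_on_def abs_if min_def max_def split: if_splits)
    then show "dist (f y) (f x) < e" by (auto simp: dist_real_def min_def max_def abs_minus_commute split: if_splits)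
  qed (use d(1) in auto)
qed

lemma sum_le_difference_iff: "\<bar>x + y\<bar> \<le> \<bar>x - y\<bar> \<longleftrightarrow> x * y \<le> 0" for x y :: real
  by (simp add: abs_le_square_iff power2_sum power2_diff)

context prob_space
begin

lemma centered_normal_rv:
  assumes [measurable]: "Y \<in> borel_measurable M" and law: "centered_normal_law (distr M borel Y)"
  shows "integrable M Y" "integrable M (\<lambda>\<omega>. (Y \<omega>)\<^sup>2)"
    and "(\<integral>\<omega>. iexp (Y \<omega>) \<partial>M) = complex_of_real (exp (- (\<integral>\<omega>. (Y \<omega>)\<^sup>2 \<partial>M) / 2))"
    and "(\<integral>\<^sup>+\<omega>. ennreal (exp (Y \<omega>)) \<partial>M) = ennreal (exp ((\<integral>\<omega>. (Y \<omega>)\<^sup>2 \<partial>M) / 2))"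
proof -
  show "integrable M Y" "integrable M (\<lambda>\<omega>. (Y \<omega>)\<^sup>2)"
    using centered_normal_law_moments[OF law] by (simp_all add: integrable_distr_eq)
  have var: "(\<integral>x. x\<^sup>2 \<partial>distr M borel Y) = (\<integral>\<omega>. (Y \<omega>)\<^sup>2 \<partial>M)" by (simp add: integral_distr)
  show "(\<integral>\<omega>. iexp (Y \<omega>) \<partial>M) = complex_of_real (exp (- (\<integral>\<omega>. (Y \<omega>)\<^sup>2 \<partial>M) / 2))"
    using centered_normal_law_char[OF law] unfolding var by (simp add: integral_distr)
  show "(\<integral>\<^sup>+\<omega>. ennreal (exp (Y \<omega>)) \<partial>M) = ennreal (exp ((\<integral>\<omega>. (Y \<omega>)\<^sup>2 \<partial>M) / 2))"
    using centered_normal_law_mgf[OF law] unfolding var by (simp add: nn_integral_distr)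
qed

text \<open>The joint characteristic function factorises, so that replacing \<open>\<omega>\<close> by an independent \<open>\<omega>'\<close> in the second variable
does not change the joint law.\<close>

lemma uncorrelated_gaussians_independent:
  assumes [measurable]: "G \<in> borel_measurable M" "H \<in> borel_measurable M"
    and law: "\<And>a b. centered_normal_law (distr M borel (\<lambda>\<omega>. a * G \<omega> + b * H \<omega>))"
    and uncorr: "(\<integral>\<omega>. G \<omega> * H \<omega> \<partial>M) = 0"
    and f [measurable]: "case_prod f \<in> borel_measurable (borel \<Otimes>\<^sub>M borel)"
  shows "(\<integral>\<^sup>+\<omega>. f (G \<omega>) (H \<omega>) \<partial>M) = (\<integral>\<^sup>+\<omega>'. \<integral>\<^sup>+\<omega>. f (G \<omega>) (H \<omega>') \<partial>M \<partial>M)"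
proof -
  interpret PP: pair_prob_space M M ..
  note rv = centered_normal_rv[OF _ law]
  have G2: "integrable M (\<lambda>\<omega>. (G \<omega>)\<^sup>2)" and H2: "integrable M (\<lambda>\<omega>. (H \<omega>)\<^sup>2)"
    using rv(2)[of 1 0] rv(2)[of 0 1] by simp_all
  then have GH: "integrable M (\<lambda>\<omega>. G \<omega> * H \<omega>)"
    by (intro integrable_mult_if_integrable_squares) auto
  have var: "(\<integral>\<omega>. (a * G \<omega> + b * H \<omega>)\<^sup>2 \<partial>M) = (\<integral>\<omega>. (a * G \<omega>)\<^sup>2 \<partial>M) + (\<integral>\<omega>. (b * H \<omega>)\<^sup>2 \<partial>M)" for a b
  proof -
    have "(\<integral>\<omega>. (a * G \<omega> + b * H \<omega>)\<^sup>2 \<partial>M) = (\<integral>\<omega>. a\<^sup>2 * (G \<omega>)\<^sup>2 + b\<^sup>2 * (H \<omega>)\<^sup>2 + 2 * a * b * (G \<omega> * H \<omega>) \<partial>M)"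
      by (intro Bochner_Integration.integral_cong) (auto simp: power2_eq_square algebra_simps)
    also have "\<dots> = a\<^sup>2 * (\<integral>\<omega>. (G \<omega>)\<^sup>2 \<partial>M) + b\<^sup>2 * (\<integral>\<omega>. (H \<omega>)\<^sup>2 \<partial>M)"
      using G2 H2 GH uncorr by simp
    finally show ?thesis by (simp add: power_mult_distrib)
  qed
  define Y where "Y i \<omega> = (if i then G \<omega> else H \<omega>)" for i \<omega>
  define Z where "Z i z = (if i then G (fst z) else H (snd z))" for i :: bool and z :: "'a \<times> 'a"
  have mY: "Y i \<in> borel_measurable M" for i
    unfolding Y_def by measurable
  have mZ: "Z i \<in> borel_measurable (M \<Otimes>\<^sub>M M)" for i
    unfolding Z_def by measurable
  have eq: "(\<integral>\<omega>. iexp (\<Sum>i\<in>UNIV. a i * Y i \<omega>) \<partial>M) = (\<integral>z. iexp (\<Sum>i\<in>UNIV. a i * Z i z) \<partial>(M \<Otimes>\<^sub>M M))" for a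
  proof -
    have "(\<integral>\<omega>. iexp (\<Sum>i\<in>UNIV. a i * Y i \<omega>) \<partial>M) = (\<integral>\<omega>. iexp (a True * G \<omega> + a False * H \<omega>) \<partial>M)"
      by (simp add: UNIV_bool Y_def add.commute)
    also have "\<dots> = (\<integral>\<omega>. iexp (a True * G \<omega>) \<partial>M) * (\<integral>\<omega>. iexp (a False * H \<omega>) \<partial>M)"
      using rv(3)[of "a True" "a False"] rv(3)[of "a True" 0] rv(3)[of 0 "a False"]
      by (simp add: var exp_add[symmetric] add_divide_distrib of_real_mult[symmetric] del: of_real_mult of_real_exp)
    also have "\<dots> = (\<integral>z. iexp (a True * G (fst z) + a False * H (snd z)) \<partial>(M \<Otimes>\<^sub>M M))"
      by (rule integral_pair_iexp_split[symmetric]) measurable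
    also have "\<dots> = (\<integral>z. iexp (\<Sum>i\<in>UNIV. a i * Z i z) \<partial>(M \<Otimes>\<^sub>M M))"
      by (simp add: UNIV_bool Z_def add.commute)
    finally show ?thesis .
  qed
  have f2: "(\<lambda>z. f (z True) (z False)) \<in> borel_measurable (PiM UNIV (\<lambda>_::bool. borel))"
    using measurable_compose[OF _ f, of "\<lambda>z. (z True, z False)" "PiM UNIV (\<lambda>_::bool. borel)"] by simp
  have "(\<integral>\<^sup>+\<omega>. f (G \<omega>) (H \<omega>) \<partial>M) = (\<integral>\<^sup>+z. f (G (fst z)) (H (snd z)) \<partial>(M \<Otimes>\<^sub>M M))"
    using nn_integral_eq_if_char_linear_combinations_eq[OF prob_space_axioms PP.prob_space_axioms finite mY mZ eq f2]
    by (simp add: Y_def Z_def)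
  also have "\<dots> = (\<integral>\<^sup>+\<omega>'. \<integral>\<^sup>+\<omega>. f (G \<omega>) (H \<omega>') \<partial>M \<partial>M)"
    by (subst PP.nn_integral_snd[symmetric]) auto
  finally show ?thesis .
qed

lemma emeasure_pair_eq_nn_integral:
  fixes A B :: "'a \<Rightarrow> real"
  assumes [measurable]: "A \<in> borel_measurable M" "B \<in> borel_measurable M"
    and Q: "Measurable.pred (borel \<Otimes>\<^sub>M borel) (\<lambda>z. Q (fst z) (snd z))"
  shows "emeasure M {\<omega> \<in> space M. Q (A \<omega>) (B \<omega>)} = (\<integral>\<^sup>+\<omega>. indicator {z. Q (fst z) (snd z)} (A \<omega>, B \<omega>) \<partial>M)"
proof -
  have "{\<omega> \<in> space M. Q (A \<omega>) (B \<omega>)} \<in> sets M"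
    using measurable_compose[OF _ Q, of "\<lambda>\<omega>. (A \<omega>, B \<omega>)" M] by simp
  then have "emeasure M {\<omega> \<in> space M. Q (A \<omega>) (B \<omega>)} = (\<integral>\<^sup>+\<omega>. indicator {\<omega> \<in> space M. Q (A \<omega>) (B \<omega>)} \<omega> \<partial>M)"
    by (rule nn_integral_indicator[symmetric])
  also have "\<dots> = (\<integral>\<^sup>+\<omega>. indicator {z. Q (fst z) (snd z)} (A \<omega>, B \<omega>) \<partial>M)"
    by (intro nn_integral_cong) (simp add: indicator_def)
  finally show ?thesis .
qed

text \<open>Conditioning on \<open>H\<close> turns the event \<open>\<bar>G - v\<bar> \<le> \<bar>H\<bar>\<close> into one that \<open>G\<close> lies in an interval of given centre
and length, to which the two estimates for centered normal laws apply.\<close>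

lemma prob_strip_eq:
  assumes [measurable]: "G \<in> borel_measurable M" "H \<in> borel_measurable M"
    and law: "\<And>a b. centered_normal_law (distr M borel (\<lambda>\<omega>. a * G \<omega> + b * H \<omega>))"
    and uncorr: "(\<integral>\<omega>. G \<omega> * H \<omega> \<partial>M) = 0"
  shows "emeasure M {\<omega> \<in> space M. \<bar>G \<omega> - v\<bar> \<le> \<bar>H \<omega>\<bar>}
    = (\<integral>\<^sup>+\<omega>'. ennreal (measure (distr M borel G) {v - \<bar>H \<omega>'\<bar>..v + \<bar>H \<omega>'\<bar>}) \<partial>M)"
proof -
  interpret dG: prob_space "distr M borel G" by (rule prob_space_distr) simp
  have "emeasure M {\<omega> \<in> space M. \<bar>G \<omega> - v\<bar> \<le> \<bar>H \<omega>\<bar>}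
      = (\<integral>\<^sup>+\<omega>. indicator {z. \<bar>fst z - v\<bar> \<le> \<bar>snd z\<bar>} (G \<omega>, H \<omega>) \<partial>M)"
    by (rule emeasure_pair_eq_nn_integral) measurable
  also have "\<dots> = (\<integral>\<^sup>+\<omega>'. \<integral>\<^sup>+\<omega>. indicator {z. \<bar>fst z - v\<bar> \<le> \<bar>snd z\<bar>} (G \<omega>, H \<omega>') \<partial>M \<partial>M)"
    by (rule uncorrelated_gaussians_independent[OF assms]) measurable
  also have "\<dots> = (\<integral>\<^sup>+\<omega>'. ennreal (measure (distr M borel G) {v - \<bar>H \<omega>'\<bar>..v + \<bar>H \<omega>'\<bar>}) \<partial>M)"
  proof (intro nn_integral_cong)
    fix \<omega>'
    have "(\<integral>\<^sup>+\<omega>. indicator {z. \<bar>fst z - v\<bar> \<le> \<bar>snd z\<bar>} (G \<omega>, H \<omega>') \<partial>M)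
        = (\<integral>\<^sup>+\<omega>. indicator {v - \<bar>H \<omega>'\<bar>..v + \<bar>H \<omega>'\<bar>} (G \<omega>) \<partial>M)"
      by (intro nn_integral_cong) (auto split: split_indicator)
    also have "\<dots> = (\<integral>\<^sup>+x. indicator {v - \<bar>H \<omega>'\<bar>..v + \<bar>H \<omega>'\<bar>} x \<partial>distr M borel G)"
      by (rule nn_integral_distr[symmetric]) measurable
    also have "\<dots> = ennreal (measure (distr M borel G) {v - \<bar>H \<omega>'\<bar>..v + \<bar>H \<omega>'\<bar>})"
      by (subst nn_integral_indicator) (simp, rule dG.emeasure_eq_measure)
    finally show "(\<integral>\<^sup>+\<omega>. indicator {z. \<bar>fst z - v\<bar> \<le> \<bar>snd z\<bar>} (G \<omega>, H \<omega>') \<partial>M)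
      = ennreal (measure (distr M borel G) {v - \<bar>H \<omega>'\<bar>..v + \<bar>H \<omega>'\<bar>})" .
  qed
  finally show ?thesis .
qed

lemma prob_strip_le:
  assumes [measurable]: "G \<in> borel_measurable M" "H \<in> borel_measurable M"
    and law: "\<And>a b. centered_normal_law (distr M borel (\<lambda>\<omega>. a * G \<omega> + b * H \<omega>))"
    and uncorr: "(\<integral>\<omega>. G \<omega> * H \<omega> \<partial>M) = 0"
  shows "prob {\<omega> \<in> space M. \<bar>G \<omega> - v\<bar> \<le> \<bar>H \<omega>\<bar>} \<le> prob {\<omega> \<in> space M. \<bar>G \<omega>\<bar> \<le> \<bar>H \<omega>\<bar>}"
proof -
  have "centered_normal_law (distr M borel G)" using law[of 1 0] by simp
  then have "emeasure M {\<omega> \<in> space M. \<bar>G \<omega> - v\<bar> \<le> \<bar>H \<omega>\<bar>} \<le> emeasure M {\<omega> \<in> space M. \<bar>G \<omega> - 0\<bar> \<le> \<bar>H \<omega>\<bar>}"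
    unfolding prob_strip_eq[OF assms]
    by (intro nn_integral_mono ennreal_leI) (simp add: centered_normal_law_interval_le)
  then show ?thesis by (simp add: emeasure_eq_measure)
qed

lemma prob_strip_le_deviation:
  assumes [measurable]: "G \<in> borel_measurable M" "H \<in> borel_measurable M"
    and law: "\<And>a b. centered_normal_law (distr M borel (\<lambda>\<omega>. a * G \<omega> + b * H \<omega>))"
    and uncorr: "(\<integral>\<omega>. G \<omega> * H \<omega> \<partial>M) = 0"
    and varG: "1 \<le> (\<integral>\<omega>. (G \<omega>)\<^sup>2 \<partial>M)"
  shows "prob {\<omega> \<in> space M. \<bar>G \<omega>\<bar> \<le> \<bar>H \<omega>\<bar>} \<le> 2 * sqrt (\<integral>\<omega>. (H \<omega>)\<^sup>2 \<partial>M)"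
proof -
  have G: "centered_normal_law (distr M borel G)" and H: "centered_normal_law (distr M borel H)"
    using law[of 1 0] law[of 0 1] by simp_all
  have iH: "integrable M (\<lambda>\<omega>. \<bar>H \<omega>\<bar>)" and iH2: "integrable M (\<lambda>\<omega>. (H \<omega>)\<^sup>2)"
    using centered_normal_rv(1,2)[OF _ H] by simp_all
  have "emeasure M {\<omega> \<in> space M. \<bar>G \<omega> - 0\<bar> \<le> \<bar>H \<omega>\<bar>} \<le> (\<integral>\<^sup>+\<omega>. ennreal (2 * \<bar>H \<omega>\<bar>) \<partial>M)"
    unfolding prob_strip_eq[OF assms(1-4)] using varG
    by (intro nn_integral_mono ennreal_leI)
       (simp add: centered_normal_law_interval_le_length[OF G] integral_distr)
  also have "\<dots> = ennreal (\<integral>\<omega>. 2 * \<bar>H \<omega>\<bar> \<partial>M)"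
    using iH by (intro nn_integral_eq_integral) auto
  finally have "prob {\<omega> \<in> space M. \<bar>G \<omega>\<bar> \<le> \<bar>H \<omega>\<bar>} \<le> 2 * (\<integral>\<omega>. \<bar>H \<omega>\<bar> \<partial>M)"
    using iH by (simp add: emeasure_eq_measure ennreal_le_iff integral_nonneg_AE)
  also have "(\<integral>\<omega>. \<bar>H \<omega>\<bar> \<partial>M) \<le> sqrt (\<integral>\<omega>. (H \<omega>)\<^sup>2 \<partial>M)"
  proof -
    have "(\<integral>\<omega>. \<bar>H \<omega>\<bar> \<partial>M)\<^sup>2 \<le> (\<integral>\<omega>. \<bar>H \<omega>\<bar>\<^sup>2 \<partial>M)"
      using iH iH2 by (intro jensens_inequality[where I=UNIV and q="\<lambda>x. x\<^sup>2"] convex_power2) auto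
    then show ?thesis by (intro real_le_rsqrt) simp
  qed
  finally show ?thesis by simp
qed

end

locale spectral_density_process = prob_space M for M :: "'a measure" +
  fixes X :: "real \<Rightarrow> 'a \<Rightarrow> real" and p :: "real \<Rightarrow> real" and P :: real
  assumes gaussian: "gaussian_process M X"
    and stationary: "stationary_process M X"
    and mean_zero: "\<And>t. (\<integral>\<omega>. X t \<omega> \<partial>M) = 0"
    and abs_cont: "AE \<omega> in M. absolutely_continuous_path (\<lambda>t. X t \<omega>)"
    and density_nonneg: "\<And>l. 0 \<le> p l"
    and density_le: "\<And>l. p l \<le> P"
    and density_meas [measurable]: "p \<in> borel_measurable borel"
    and spectral: "spectral_measure M X (density lborel p)"
    and second_moment: "integrable lborel (\<lambda>l. l\<^sup>2 * p l)"
begin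

definition spectral_moment :: real where "spectral_moment = (\<integral>l. l\<^sup>2 * p l \<partial>lborel)"

definition r :: "real \<Rightarrow> real" where "r t = (\<integral>l. cos (l * t) * p l \<partial>lborel)"

lemma spectral_moment_nonneg: "0 \<le> spectral_moment"
  unfolding spectral_moment_def by (intro integral_nonneg_AE) (auto simp: density_nonneg)

lemma X_meas [measurable]: "X t \<in> borel_measurable M"
  using gaussian by (simp add: gaussian_process_def)

lemma linear_combination_law:
  assumes F: "finite F"
  shows "centered_normal_law (distr M borel (\<lambda>\<omega>. \<Sum>t\<in>F. a t * X t \<omega>))"
proof -
  have law: "gaussian_law (distr M borel (\<lambda>\<omega>. \<Sum>t\<in>F. a t * X t \<omega>))" if "finite F" for F a
    using gaussian that by (simp add: gaussian_process_def)
  have "integrable M (X t)" for t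
  proof -
    have "gaussian_law (distr M borel (X t))" using law[of "{t}" "\<lambda>_. 1"] by simp
    then have "centered_normal_law (distr M borel (X t))"
      using mean_zero by (intro centered_normal_lawI) (auto simp: integral_distr)
    then show ?thesis by (rule centered_normal_rv(1)[rotated]) simp
  qed
  then have "(\<integral>x. x \<partial>distr M borel (\<lambda>\<omega>. \<Sum>t\<in>F. a t * X t \<omega>)) = 0"
    using mean_zero by (simp add: integral_distr)
  then show ?thesis using law[OF F] by (intro centered_normal_lawI) auto
qed

lemma X_law: "centered_normal_law (distr M borel (X t))"
  using linear_combination_law[of "{t}" "\<lambda>_. 1"] by simp

lemma centered_gaussian_vector: "finite F \<Longrightarrow> centered_gaussian_vector M F X"
  using centered_normal_rv(2)[OF _ X_law] centered_normal_rv(3)[OF _ linear_combination_law]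
  by (auto simp: centered_gaussian_vector_def)

lemma integrable_XX: "integrable M (\<lambda>\<omega>. X s \<omega> * X t \<omega>)"
  using centered_normal_rv(2)[OF _ X_law] by (intro integrable_mult_if_integrable_squares) auto

lemma density_integrable: "integrable lborel p" and density_integral: "(\<integral>l. p l \<partial>lborel) = 1"
proof -
  interpret S: prob_space "density lborel p" using spectral by (simp add: spectral_measure_def)
  have 1: "(\<integral>\<^sup>+l. ennreal (p l) \<partial>lborel) = 1"
    using S.emeasure_space_1 by (simp add: emeasure_density)
  show "integrable lborel p"
    using 1 density_nonneg by (intro integrableI_nonneg) auto
  then have "ennreal (\<integral>l. p l \<partial>lborel) = 1"
    using 1 density_nonneg by (subst nn_integral_eq_integral[symmetric]) auto
  then show "(\<integral>l. p l \<partial>lborel) = 1" by simp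
qed

lemma covariance_eq: "(\<integral>\<omega>. X s \<omega> * X t \<omega> \<partial>M) = r (s - t)"
proof -
  have "complex_of_real (covariance M (X s) (X t)) =
      (\<integral>l. exp (- \<i> * complex_of_real (l * (s - t))) \<partial>density lborel p)"
    using spectral by (simp add: spectral_measure_def)
  also have "\<dots> = (\<integral>l. p l *\<^sub>R exp (- \<i> * complex_of_real (l * (s - t))) \<partial>lborel)"
    using density_nonneg by (intro integral_density) auto
  finally have *: "complex_of_real (covariance M (X s) (X t)) =
      (\<integral>l. p l *\<^sub>R exp (- \<i> * complex_of_real (l * (s - t))) \<partial>lborel)" .
  have "integrable lborel (\<lambda>l. p l *\<^sub>R exp (- \<i> * complex_of_real (l * (s - t))))"
    by (rule Bochner_Integration.integrable_bound[OF density_integrable]) auto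
  from integral_Re[OF this] have "covariance M (X s) (X t) = r (s - t)"
    unfolding *[symmetric] r_def by (simp add: Re_exp mult.commute)
  then show ?thesis by (simp add: covariance_def mean_zero)
qed

lemma r_0: "r 0 = 1"
  by (simp add: r_def density_integral)

lemma variance_increment_le: "1 - r t \<le> spectral_moment * t\<^sup>2 / 2"
proof -
  have i: "integrable lborel (\<lambda>l. cos (l * t) * p l)"
    by (rule Bochner_Integration.integrable_bound[OF density_integrable])
       (auto simp: abs_mult density_nonneg intro!: mult_left_le_one_le)
  have "1 - r t = (\<integral>l. p l - cos (l * t) * p l \<partial>lborel)"
    using i density_integrable by (simp add: r_def density_integral)
  also have "\<dots> \<le> (\<integral>l. (l\<^sup>2 * p l) * (t\<^sup>2 / 2) \<partial>lborel)"
  proof (rule integral_mono)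
    fix l
    have "1 - cos (l * t) \<le> (l * t)\<^sup>2 / 2"
    proof -
      have "1 - cos (l * t) = 2 * (sin (l * t / 2))\<^sup>2"
        using cos_double_sin[of "l * t / 2"] by simp
      also have "\<dots> \<le> 2 * (l * t / 2)\<^sup>2"
        using abs_sin_x_le_abs_x[of "l * t / 2"] unfolding abs_le_square_iff by simp
      finally show ?thesis by (simp add: power2_eq_square mult_ac)
    qed
    from mult_right_mono[OF this density_nonneg[of l]]
    show "p l - cos (l * t) * p l \<le> (l\<^sup>2 * p l) * (t\<^sup>2 / 2)"
      by (simp add: algebra_simps power_mult_distrib)
  qed (use i density_integrable second_moment in auto)
  also have "\<dots> = spectral_moment * t\<^sup>2 / 2" by (simp add: spectral_moment_def)
  finally show ?thesis .
qed

text \<open>All coefficients being bounded by \<open>w\<close>, the exponent is of order \<open>n * w\<^sup>2 / h\<close> as soon as \<open>n * h ^ 3\<close> is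
bounded.\<close>

lemma mgf_linear_combination_le:
  assumes h: "h > 0" and a: "\<And>k. k < n \<Longrightarrow> \<bar>a k\<bar> \<le> w"
  shows "(\<integral>\<^sup>+\<omega>. ennreal (exp (\<Sum>k<n. a k * X (s + real k * h) \<omega>)) \<partial>M)
    \<le> ennreal (exp ((P * (2 * pi / h) * (n * w\<^sup>2) + (n * w)\<^sup>2 * (h\<^sup>2 / pi\<^sup>2) * spectral_moment) / 2))"
proof -
  define F where "F = (\<lambda>k. s + real k * h) ` {..<n}"
  define b where "b t = a (nat \<lfloor>(t - s) / h\<rfloor>)" for t
  have inj: "inj_on (\<lambda>k. s + real k * h) {..<n}" using h by (auto simp: inj_on_def)
  have sum_eq: "(\<Sum>k<n. a k * X (s + real k * h) \<omega>) = (\<Sum>t\<in>F. b t * X t \<omega>)" for \<omega>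
    unfolding F_def using inj h by (simp add: sum.reindex b_def)
  have "0 \<le> P" using density_nonneg[of 0] density_le[of 0] by simp
  have "(\<integral>\<omega>. (\<Sum>k<n. a k * X (s + real k * h) \<omega>)\<^sup>2 \<partial>M)
      = (\<integral>\<omega>. (\<Sum>j<n. \<Sum>k<n. a j * a k * (X (s + real j * h) \<omega> * X (s + real k * h) \<omega>)) \<partial>M)"
    by (simp add: power2_eq_square sum_product mult_ac)
  also have "\<dots> = (\<Sum>j<n. \<Sum>k<n. a j * a k * r (s + real j * h - (s + real k * h)))"
    using integrable_XX by (simp add: covariance_eq)
  also have "\<dots> = (\<Sum>j<n. \<Sum>k<n. a j * a k * (\<integral>l. cos (l * (h * (real j - real k))) * p l \<partial>lborel))"
    by (simp add: r_def algebra_simps)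
  also have "\<dots> \<le> P * (2 * pi / h) * (\<Sum>k<n. (a k)\<^sup>2) + (\<Sum>k<n. \<bar>a k\<bar>)\<^sup>2 * (h\<^sup>2 / pi\<^sup>2) * spectral_moment"
    unfolding spectral_moment_def
    by (rule spectral_quadratic_form_le[OF density_nonneg density_le density_integrable second_moment h])
  also have "\<dots> \<le> P * (2 * pi / h) * (n * w\<^sup>2) + (n * w)\<^sup>2 * (h\<^sup>2 / pi\<^sup>2) * spectral_moment"
  proof -
    have "(\<Sum>k<n. (a k)\<^sup>2) \<le> (\<Sum>k<n. w\<^sup>2)"
      using a by (intro sum_mono) (auto intro!: power2_le_iff_abs_le[THEN iffD2] order_trans[OF abs_ge_zero])
    moreover have "(\<Sum>k<n. \<bar>a k\<bar>) \<le> (\<Sum>k<n. w)" using a by (intro sum_mono) auto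
    moreover have "0 \<le> (\<Sum>k<n. \<bar>a k\<bar>)" by (intro sum_nonneg) auto
    ultimately show ?thesis using \<open>0 \<le> P\<close> h spectral_moment_nonneg
      by (intro add_mono mult_left_mono mult_right_mono power_mono) auto
  qed
  finally have var: "(\<integral>\<omega>. (\<Sum>k<n. a k * X (s + real k * h) \<omega>)\<^sup>2 \<partial>M)
    \<le> P * (2 * pi / h) * (n * w\<^sup>2) + (n * w)\<^sup>2 * (h\<^sup>2 / pi\<^sup>2) * spectral_moment" .
  have "(\<integral>\<^sup>+\<omega>. ennreal (exp (\<Sum>k<n. a k * X (s + real k * h) \<omega>)) \<partial>M)
      = ennreal (exp ((\<integral>\<omega>. (\<Sum>k<n. a k * X (s + real k * h) \<omega>)\<^sup>2 \<partial>M) / 2))"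
    unfolding sum_eq by (rule centered_normal_rv(4)) (auto simp: F_def intro!: linear_combination_law)
  also have "\<dots> \<le> ennreal (exp ((P * (2 * pi / h) * (n * w\<^sup>2) + (n * w)\<^sup>2 * (h\<^sup>2 / pi\<^sup>2) * spectral_moment) / 2))"
    using var by (intro ennreal_leI) simp
  finally show ?thesis .
qed

text \<open>The probability that the values at distance \<open>d\<close> have opposite signs. Weak inequality is the convenient
form, as it reads \<open>\<bar>X 0 + X d\<bar> \<le> \<bar>X 0 - X d\<bar>\<close>; a vanishing factor has probability \<open>0\<close>.\<close>

definition crossing_prob :: "real \<Rightarrow> real" where
  "crossing_prob d = prob {\<omega> \<in> space M. X 0 \<omega> * X d \<omega> \<le> 0}"

lemma nn_integral_pair_shift:
  assumes [measurable]: "case_prod f \<in> borel_measurable (borel \<Otimes>\<^sub>M borel)"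
  shows "(\<integral>\<^sup>+\<omega>. f (X s \<omega>) (X (s + d) \<omega>) \<partial>M) = (\<integral>\<^sup>+\<omega>. f (X 0 \<omega>) (X d \<omega>) \<partial>M)"
proof -
  let ?B = "PiM {0, d} (\<lambda>_. borel :: real measure)"
  have g [measurable]: "(\<lambda>z. f (z 0) (z d)) \<in> borel_measurable ?B"
    using measurable_compose[OF _ assms, of "\<lambda>z. (z 0, z d)" ?B] by simp
  have m [measurable]: "(\<lambda>\<omega>. \<lambda>t\<in>{0, d}. X (t + s) \<omega>) \<in> M \<rightarrow>\<^sub>M ?B" for s
    by (intro measurable_restrict) simp
  have "(\<integral>\<^sup>+\<omega>. f (X s \<omega>) (X (s + d) \<omega>) \<partial>M)
      = (\<integral>\<^sup>+z. f (z 0) (z d) \<partial>distr M ?B (\<lambda>\<omega>. \<lambda>t\<in>{0, d}. X (t + s) \<omega>))"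
    by (subst nn_integral_distr) (auto simp: add.commute)
  also have "distr M ?B (\<lambda>\<omega>. \<lambda>t\<in>{0, d}. X (t + s) \<omega>) = distr M ?B (\<lambda>\<omega>. \<lambda>t\<in>{0, d}. X (t + 0) \<omega>)"
    using stationary unfolding stationary_process_def by simp
  also have "(\<integral>\<^sup>+z. f (z 0) (z d) \<partial>\<dots>) = (\<integral>\<^sup>+\<omega>. f (X 0 \<omega>) (X d \<omega>) \<partial>M)"
    by (subst nn_integral_distr) auto
  finally show ?thesis .
qed

lemma sum_difference_gaussian:
  "centered_normal_law (distr M borel (\<lambda>\<omega>. a * (X s \<omega> + X t \<omega>) + b * (X s \<omega> - X t \<omega>)))"
proof (cases "s = t")
  case True
  then show ?thesis using linear_combination_law[of "{t}" "\<lambda>_. 2 * a"] by (simp add: algebra_simps)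
next
  case False
  then have "(\<Sum>u\<in>{s, t}. (if u = s then a + b else a - b) * X u \<omega>)
      = a * (X s \<omega> + X t \<omega>) + b * (X s \<omega> - X t \<omega>)" for \<omega>
    by (simp add: algebra_simps)
  then show ?thesis using linear_combination_law[of "{s, t}" "\<lambda>u. if u = s then a + b else a - b"] by simp
qed

lemma sum_difference_uncorrelated: "(\<integral>\<omega>. (X s \<omega> + X t \<omega>) * (X s \<omega> - X t \<omega>) \<partial>M) = 0"
proof -
  have "(\<integral>\<omega>. (X s \<omega> + X t \<omega>) * (X s \<omega> - X t \<omega>) \<partial>M) = (\<integral>\<omega>. X s \<omega> * X s \<omega> - X t \<omega> * X t \<omega> \<partial>M)"
    by (intro Bochner_Integration.integral_cong) (auto simp: algebra_simps)
  then show ?thesis using integrable_XX by (simp add: covariance_eq)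
qed

text \<open>Sum and difference of two values of equal variance are uncorrelated, hence independent. The strip
contains the event that the level \<open>v / 2\<close> separates the two values, so no level is crossed with a larger
probability than the level \<open>0\<close>.\<close>

lemma prob_strip_le_crossing_prob:
  "prob {\<omega> \<in> space M. \<bar>(X s \<omega> + X (s + d) \<omega>) - v\<bar> \<le> \<bar>X s \<omega> - X (s + d) \<omega>\<bar>} \<le> crossing_prob d"
proof -
  have "prob {\<omega> \<in> space M. \<bar>(X s \<omega> + X (s + d) \<omega>) - v\<bar> \<le> \<bar>X s \<omega> - X (s + d) \<omega>\<bar>}
      \<le> prob {\<omega> \<in> space M. \<bar>X s \<omega> + X (s + d) \<omega>\<bar> \<le> \<bar>X s \<omega> - X (s + d) \<omega>\<bar>}"
    by (rule prob_strip_le) (auto intro: sum_difference_gaussian sum_difference_uncorrelated)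
  also have "\<dots> = prob {\<omega> \<in> space M. X s \<omega> * X (s + d) \<omega> \<le> 0}"
    by (simp add: sum_le_difference_iff)
  also have "\<dots> = crossing_prob d"
  proof -
    have "emeasure M {\<omega> \<in> space M. X s \<omega> * X (s + d) \<omega> \<le> 0}
        = (\<integral>\<^sup>+\<omega>. indicator {z. fst z * snd z \<le> 0} (X s \<omega>, X (s + d) \<omega>) \<partial>M)" for s
      by (rule emeasure_pair_eq_nn_integral) measurable
    from this[of s] this[of 0]
    have "emeasure M {\<omega> \<in> space M. X s \<omega> * X (s + d) \<omega> \<le> 0} = emeasure M {\<omega> \<in> space M. X 0 \<omega> * X d \<omega> \<le> 0}"
      using nn_integral_pair_shift[of "\<lambda>x y. indicator {z. fst z * snd z \<le> 0} (x, y)" s d] by simp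
    then show ?thesis by (simp add: crossing_prob_def emeasure_eq_measure)
  qed
  finally show ?thesis .
qed

lemma prob_abs_level_change_le:
  "prob {\<omega> \<in> space M. (\<bar>X s \<omega>\<bar> \<le> u) \<noteq> (\<bar>X (s + d) \<omega>\<bar> \<le> u)} \<le> 2 * crossing_prob d"
proof -
  let ?A = "\<lambda>v. {\<omega> \<in> space M. \<bar>(X s \<omega> + X (s + d) \<omega>) - v\<bar> \<le> \<bar>X s \<omega> - X (s + d) \<omega>\<bar>}"
  have "\<bar>(x + y) - 2 * u\<bar> \<le> \<bar>x - y\<bar> \<or> \<bar>(x + y) - (- 2 * u)\<bar> \<le> \<bar>x - y\<bar>"
    if "(\<bar>x\<bar> \<le> u) \<noteq> (\<bar>y\<bar> \<le> u)" for x y :: real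
    using that by (smt (verit))
  then have "prob {\<omega> \<in> space M. (\<bar>X s \<omega>\<bar> \<le> u) \<noteq> (\<bar>X (s + d) \<omega>\<bar> \<le> u)} \<le> prob (?A (2 * u) \<union> ?A (- 2 * u))"
    by (intro finite_measure_mono) (blast, measurable)
  moreover have "prob (?A (2 * u) \<union> ?A (- 2 * u)) \<le> prob (?A (2 * u)) + prob (?A (- 2 * u))"
    by (intro measure_Un_le) measurable
  ultimately show ?thesis
    using prob_strip_le_crossing_prob[of s d "2 * u"] prob_strip_le_crossing_prob[of s d "- 2 * u"] by linarith
qed

text \<open>The difference \<open>X 0 - X d\<close> has standard deviation of order \<open>d\<close>, while the sum keeps a variance of at least
\<open>1\<close>; this makes the expected number of zeros finite.\<close>

lemma crossing_prob_le:
  assumes "spectral_moment * d\<^sup>2 \<le> 2"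
  shows "crossing_prob d \<le> 2 * sqrt spectral_moment * \<bar>d\<bar>"
proof -
  have r: "r (0 - d) = r d" by (simp add: r_def)
  have G2: "(\<integral>\<omega>. (X 0 \<omega> + X d \<omega>)\<^sup>2 \<partial>M) = 2 + 2 * r d"
  proof -
    have "(\<integral>\<omega>. (X 0 \<omega> + X d \<omega>)\<^sup>2 \<partial>M) = (\<integral>\<omega>. X 0 \<omega> * X 0 \<omega> + X d \<omega> * X d \<omega> + 2 * (X 0 \<omega> * X d \<omega>) \<partial>M)"
      by (intro Bochner_Integration.integral_cong) (auto simp: power2_eq_square algebra_simps)
    then show ?thesis using integrable_XX r by (simp add: covariance_eq r_0)
  qed
  have H2: "(\<integral>\<omega>. (X 0 \<omega> - X d \<omega>)\<^sup>2 \<partial>M) = 2 - 2 * r d"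
  proof -
    have "(\<integral>\<omega>. (X 0 \<omega> - X d \<omega>)\<^sup>2 \<partial>M) = (\<integral>\<omega>. X 0 \<omega> * X 0 \<omega> + X d \<omega> * X d \<omega> - 2 * (X 0 \<omega> * X d \<omega>) \<partial>M)"
      by (intro Bochner_Integration.integral_cong) (auto simp: power2_eq_square algebra_simps)
    then show ?thesis using integrable_XX r by (simp add: covariance_eq r_0)
  qed
  have "crossing_prob d = prob {\<omega> \<in> space M. \<bar>X 0 \<omega> + X d \<omega>\<bar> \<le> \<bar>X 0 \<omega> - X d \<omega>\<bar>}"
    by (simp add: crossing_prob_def sum_le_difference_iff)
  also have "\<dots> \<le> 2 * sqrt (\<integral>\<omega>. (X 0 \<omega> - X d \<omega>)\<^sup>2 \<partial>M)"
    using variance_increment_le[of d] assms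
    by (intro prob_strip_le_deviation) (auto intro: sum_difference_gaussian sum_difference_uncorrelated simp: G2)
  also have "\<dots> \<le> 2 * sqrt (spectral_moment * d\<^sup>2)"
    unfolding H2 using variance_increment_le[of d] by simp
  finally show ?thesis by (simp add: real_sqrt_mult)
qed

lemma AE_nonzero: "AE \<omega> in M. X t \<omega> \<noteq> 0"
proof -
  have "measure (distr M borel (X t)) {- 0..0} \<le> 2 * 0"
    using covariance_eq[of t t]
    by (intro centered_normal_law_interval_le_length X_law) (auto simp: integral_distr r_0 power2_eq_square)
  then have "measure (distr M borel (X t)) {0} = 0" by (simp add: measure_le_0_iff)
  then have "prob {\<omega> \<in> space M. X t \<omega> = 0} = 0"
    by (subst (asm) measure_distr) (auto simp: vimage_def Int_def conj_commute)
  then have "emeasure M {\<omega> \<in> space M. X t \<omega> = 0} = 0" by (simp add: emeasure_eq_measure)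
  then show ?thesis by (intro AE_I'[of "{\<omega> \<in> space M. X t \<omega> = 0}"]) (auto simp: null_sets_def)
qed

lemma AE_continuous: "AE \<omega> in M. continuous_on UNIV (\<lambda>t. X t \<omega>)"
  using abs_cont by eventually_elim (rule absolutely_continuous_path_imp_continuous)

lemma level_changes_sum:
  "real (level_changes f n u)
    = (\<Sum>j<2 ^ n. indicator {z. (\<bar>fst z\<bar> \<le> u) \<noteq> (\<bar>snd z\<bar> \<le> u)} (f (real j / 2 ^ n), f (real (Suc j) / 2 ^ n)))"
  by (simp add: level_changes_def indicator_def sum.If_cases Int_def)

lemma level_changes_meas [measurable]: "(\<lambda>\<omega>. real (level_changes (\<lambda>t. X t \<omega>) n u)) \<in> borel_measurable M"
  unfolding level_changes_sum by measurable

lemma expected_level_changes_le: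
  "(\<integral>\<^sup>+\<omega>. ennreal (real (level_changes (\<lambda>t. X t \<omega>) n u) / 2) \<partial>M) \<le> ennreal (2 ^ n * crossing_prob (1 / 2 ^ n))"
proof -
  let ?E = "\<lambda>j. {\<omega> \<in> space M. (\<bar>X (real j / 2 ^ n) \<omega>\<bar> \<le> u) \<noteq> (\<bar>X (real (Suc j) / 2 ^ n) \<omega>\<bar> \<le> u)}"
  have sum_eq: "real (level_changes (\<lambda>t. X t \<omega>) n u) / 2 = (\<Sum>j<2 ^ n. indicator (?E j) \<omega> / 2)" if "\<omega> \<in> space M" for \<omega>
    using that unfolding level_changes_sum sum_divide_distrib by (intro sum.cong) (auto simp: indicator_def)
  have "(\<integral>\<^sup>+\<omega>. ennreal (real (level_changes (\<lambda>t. X t \<omega>) n u) / 2) \<partial>M)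
      = (\<integral>\<^sup>+\<omega>. ennreal (\<Sum>j<2 ^ n. indicator (?E j) \<omega> / 2) \<partial>M)"
    by (intro nn_integral_cong) (simp only: sum_eq)
  also have "\<dots> = ennreal (\<integral>\<omega>. (\<Sum>j<2 ^ n. indicator (?E j) \<omega> / 2) \<partial>M)"
    by (intro nn_integral_eq_integral) (auto intro!: sum_nonneg integrable_real_indicator simp: emeasure_eq_measure)
  also have "(\<integral>\<omega>. (\<Sum>j<2 ^ n. indicator (?E j) \<omega> / 2) \<partial>M) = (\<Sum>j<2 ^ n. prob (?E j) / 2)"
    by (subst Bochner_Integration.integral_sum) (auto intro!: integrable_real_indicator simp: emeasure_eq_measure)
  also have "\<dots> \<le> (\<Sum>j<(2::nat) ^ n. crossing_prob (1 / 2 ^ n))"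
  proof (rule sum_mono)
    fix j :: nat
    have "real (Suc j) / 2 ^ n = real j / 2 ^ n + 1 / 2 ^ n" by (simp add: field_simps)
    then show "prob (?E j) / 2 \<le> crossing_prob (1 / 2 ^ n)"
      using prob_abs_level_change_le[of "real j / 2 ^ n" u "1 / 2 ^ n"] by simp
  qed
  also have "\<dots> = 2 ^ n * crossing_prob (1 / 2 ^ n)" by simp
  finally show ?thesis by (simp add: ennreal_leI)
qed

text \<open>By Fatou's lemma for the limits in \<open>n\<close> and in the level: the expected number of zeros does not exceed the
limiting expected number of sign changes along dyadic grids. The zero count is compared
with a measurable function before integrating, as the nonnegative integral is monotone for arbitrary
functions.\<close>

lemma expected_zero_count_le:
  "expected_zero_count M X {0..1} \<le> liminf (\<lambda>n. ennreal (2 ^ n * crossing_prob (1 / 2 ^ n)))"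
proof -
  let ?c = "\<lambda>k n \<omega>. ennreal (real (level_changes (\<lambda>t. X t \<omega>) n (1 / real (Suc k))) / 2)"
  let ?L = "\<lambda>\<omega>. liminf (\<lambda>k. liminf (\<lambda>n. ?c k n \<omega>))"
  have "AE \<omega> in M. \<forall>n j. X (real j / 2 ^ n) \<omega> \<noteq> 0"
    by (simp add: AE_all_countable AE_nonzero)
  then have "AE \<omega> in M. zero_count X {0..1} \<omega> \<le> ?L \<omega>"
    using AE_continuous
  proof eventually_elim
    case (elim \<omega>)
    then show ?case
      unfolding zero_count_def by (intro zero_count_le_liminf_level_changes) auto
  qed
  then have "expected_zero_count M X {0..1} \<le> (\<integral>\<^sup>+\<omega>. ?L \<omega> \<partial>completion M)"
    unfolding expected_zero_count_def by (intro nn_integral_mono_AE AE_completion)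
  also have "\<dots> = (\<integral>\<^sup>+\<omega>. ?L \<omega> \<partial>M)"
    by (rule nn_integral_completion)
  also have "\<dots> \<le> liminf (\<lambda>k. liminf (\<lambda>n. \<integral>\<^sup>+\<omega>. ?c k n \<omega> \<partial>M))"
    by (intro order_trans[OF nn_integral_liminf] Liminf_mono always_eventually allI nn_integral_liminf) auto
  also have "\<dots> \<le> liminf (\<lambda>k::nat. liminf (\<lambda>n. ennreal (2 ^ n * crossing_prob (1 / 2 ^ n))))"
    by (intro Liminf_mono always_eventually allI expected_level_changes_le)
  finally show ?thesis by (simp add: Liminf_const)
qed

end

section \<open>A smooth minorant of the sign change\<close>

text \<open>A continuously differentiable function that increases, as \<open>N\<close> grows, to the indicator of the positive reals.\<close>

definition soft_pos :: "real \<Rightarrow> real \<Rightarrow> real" where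
  "soft_pos N x = N * (max 0 x)\<^sup>2 / (1 + N * (max 0 x)\<^sup>2)"

definition soft_pos_deriv :: "real \<Rightarrow> real \<Rightarrow> real" where
  "soft_pos_deriv N x = 2 * N * max 0 x / (1 + N * (max 0 x)\<^sup>2)\<^sup>2"

lemma has_real_derivative_pos_part_square:
  "((\<lambda>x. (max 0 x)\<^sup>2) has_real_derivative 2 * max 0 x) (at (x::real))"
proof -
  consider "x < 0" | "x = 0" | "x > 0" by linarith
  then show ?thesis
  proof cases
    case 1
    have "((\<lambda>_. 0) has_real_derivative 2 * max 0 x) (at x)" using 1 by simp
    then show ?thesis
      by (rule has_field_derivative_transform_within_open[where S="{..<0}"]) (use 1 in auto)
  next
    case 2
    have "(max 0 z)\<^sup>2 - (max 0 x)\<^sup>2 = max 0 z * (z - x)" for z :: real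
      using 2 by (simp add: max_def power2_eq_square)
    moreover have "isCont (\<lambda>z::real. max 0 z) x" by (intro continuous_intros)
    ultimately show ?thesis unfolding CARAT_DERIV using 2 by (intro exI[of _ "\<lambda>z. max 0 z"]) auto
  next
    case 3
    have "((\<lambda>x. x\<^sup>2) has_real_derivative 2 * max 0 x) (at x)"
      using 3 by (auto intro!: derivative_eq_intros)
    then show ?thesis
      by (rule has_field_derivative_transform_within_open[where S="{0<..}"]) (use 3 in auto)
  qed
qed

lemma soft_pos_has_derivative [derivative_intros]:
  assumes N: "N \<ge> 0" and g: "(g has_real_derivative g') (at t)"
  shows "((\<lambda>t. soft_pos N (g t)) has_real_derivative soft_pos_deriv N (g t) * g') (at t)"
proof -
  have pos: "1 + N * y\<^sup>2 \<noteq> 0" for y :: real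
    using mult_nonneg_nonneg[OF N, of "y\<^sup>2"] by (simp add: add_nonneg_eq_0_iff)
  note q = DERIV_chain2[OF has_real_derivative_pos_part_square g]
  show ?thesis
    unfolding soft_pos_def soft_pos_deriv_def
    by (rule derivative_eq_intros q pos refl)+
       (simp add: field_simps power2_eq_square)
qed

lemma continuous_soft_pos [continuous_intros]:
  assumes N: "N \<ge> 0" and g: "isCont g t"
  shows "isCont (\<lambda>t. soft_pos N (g t)) t" "isCont (\<lambda>t. soft_pos_deriv N (g t)) t"
proof -
  have pos: "1 + N * y\<^sup>2 \<noteq> 0" for y :: real
    using mult_nonneg_nonneg[OF N, of "y\<^sup>2"] by (simp add: add_nonneg_eq_0_iff)
  show "isCont (\<lambda>t. soft_pos N (g t)) t" "isCont (\<lambda>t. soft_pos_deriv N (g t)) t"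
    unfolding soft_pos_def soft_pos_deriv_def using g pos by (auto intro!: continuous_intros)
qed

lemma soft_pos_measurable [measurable]:
  "soft_pos N \<in> borel_measurable borel" "soft_pos_deriv N \<in> borel_measurable borel"
  unfolding soft_pos_def[abs_def] soft_pos_deriv_def[abs_def] by measurable

lemma soft_pos_nonneg: "N \<ge> 0 \<Longrightarrow> 0 \<le> soft_pos N x"
  by (simp add: soft_pos_def)

lemma soft_pos_le: "N \<ge> 0 \<Longrightarrow> soft_pos N x \<le> 1"
  by (simp add: soft_pos_def divide_le_eq_1 add_pos_nonneg)

lemma soft_pos_eq_0: "x \<le> 0 \<Longrightarrow> soft_pos N x = 0"
  by (simp add: soft_pos_def)

lemma soft_pos_deriv_bounds:
  assumes N: "N \<ge> 1"
  shows "0 \<le> soft_pos_deriv N x" "soft_pos_deriv N x \<le> N"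
proof -
  show "0 \<le> soft_pos_deriv N x" using N by (simp add: soft_pos_deriv_def)
  define y where "y = max 0 x"
  have y: "0 \<le> y" by (simp add: y_def)
  have "2 * y \<le> 1 + y\<^sup>2" using sum_squares_bound[of 1 y] by simp
  also have "\<dots> \<le> 1 + N * y\<^sup>2" using mult_right_mono[OF N, of "y\<^sup>2"] by simp
  also have "\<dots> \<le> (1 + N * y\<^sup>2)\<^sup>2" using N by (intro self_le_power) auto
  finally have "N * (2 * y) \<le> N * (1 + N * y\<^sup>2)\<^sup>2" using N by (intro mult_left_mono) auto
  moreover have "0 < (1 + N * y\<^sup>2)\<^sup>2" using N by (intro zero_less_power add_pos_nonneg) auto
  ultimately show "soft_pos_deriv N x \<le> N"
    by (simp add: soft_pos_deriv_def y_def divide_le_eq)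
qed

lemma soft_pos_tendsto: "(\<lambda>k. soft_pos (real (Suc k)) x) \<longlonglongrightarrow> (if x > 0 then 1 else 0)"
proof (cases "x > 0")
  case True
  have "(\<lambda>k. 1 / real (Suc k)) \<longlonglongrightarrow> 0"
    using LIMSEQ_inverse_real_of_nat by (simp add: inverse_eq_divide)
  then have "(\<lambda>k. x\<^sup>2 / (1 / real (Suc k) + x\<^sup>2)) \<longlonglongrightarrow> x\<^sup>2 / (0 + x\<^sup>2)"
    using True by (intro tendsto_intros) auto
  moreover have "x\<^sup>2 / (1 / real (Suc k) + x\<^sup>2) = soft_pos (real (Suc k)) x" for k
  proof -
    have "1 / real (Suc k) + x\<^sup>2 = (1 + real (Suc k) * x\<^sup>2) / real (Suc k)"
      by (simp add: add_divide_distrib)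
    then show ?thesis using True by (simp add: soft_pos_def mult.commute)
  qed
  ultimately show ?thesis using True by simp
qed (simp add: soft_pos_eq_0)

text \<open>A smooth minorant of the indicator of a sign change. By symmetry, its partial derivative in the second
variable is the one in the first with the variables exchanged.\<close>

definition soft_change :: "real \<Rightarrow> real \<Rightarrow> real \<Rightarrow> real" where
  "soft_change N x y = soft_pos N x * soft_pos N (- y) + soft_pos N (- x) * soft_pos N y"

definition soft_change_deriv :: "real \<Rightarrow> real \<Rightarrow> real \<Rightarrow> real" where
  "soft_change_deriv N x y = soft_pos_deriv N x * soft_pos N (- y) - soft_pos_deriv N (- x) * soft_pos N y"

lemma soft_change_has_derivative [derivative_intros]:
  assumes N: "N \<ge> 0" and f: "(f has_real_derivative f') (at t)" and g: "(g has_real_derivative g') (at t)"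
  shows "((\<lambda>t. soft_change N (f t) (g t)) has_real_derivative
    soft_change_deriv N (f t) (g t) * f' + soft_change_deriv N (g t) (f t) * g') (at t)"
  unfolding soft_change_def soft_change_deriv_def
  by (rule derivative_eq_intros N f g refl)+ (simp add: algebra_simps)

lemma continuous_soft_change_deriv [continuous_intros]:
  assumes "N \<ge> 0" "isCont f t" "isCont g t"
  shows "isCont (\<lambda>t. soft_change_deriv N (f t) (g t)) t"
  unfolding soft_change_deriv_def using assms by (auto intro!: continuous_intros)

lemma soft_change_measurable [measurable]:
  assumes [measurable]: "f \<in> borel_measurable M" "g \<in> borel_measurable M"
  shows "(\<lambda>x. soft_change N (f x) (g x)) \<in> borel_measurable M"
    "(\<lambda>x. soft_change_deriv N (f x) (g x)) \<in> borel_measurable M"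
  unfolding soft_change_def soft_change_deriv_def by measurable

lemma soft_change_nonneg: "N \<ge> 0 \<Longrightarrow> 0 \<le> soft_change N x y"
  by (simp add: soft_change_def soft_pos_nonneg)

lemma soft_change_le:
  assumes N: "N \<ge> 0"
  shows "soft_change N x y \<le> (if x * y < 0 then 1 else 0)"
proof -
  have "soft_pos N u * soft_pos N v \<le> 1" for u v
    using mult_mono[OF soft_pos_le[OF N, of u] soft_pos_le[OF N, of v]] soft_pos_nonneg[OF N] by simp
  then show ?thesis
    by (cases "0 < x"; cases "0 < y"; cases "x < 0"; cases "y < 0")
       (auto simp: soft_change_def soft_pos_eq_0 mult_less_0_iff)
qed

lemma abs_soft_change_deriv_le:
  assumes N: "N \<ge> 1"
  shows "\<bar>soft_change_deriv N x y\<bar> \<le> 2 * N"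
proof -
  have "0 \<le> soft_pos_deriv N u * soft_pos N v \<and> soft_pos_deriv N u * soft_pos N v \<le> N * 1" for u v
    using soft_pos_deriv_bounds[OF N, of u] soft_pos_nonneg[of N v] soft_pos_le[of N v] N
    by (intro conjI mult_mono mult_nonneg_nonneg) auto
  from this[of x "- y"] this[of "- x" y] show ?thesis
    unfolding soft_change_deriv_def by linarith
qed

lemma soft_change_tendsto:
  "(\<lambda>k. soft_change (real (Suc k)) x y) \<longlonglongrightarrow> (if x * y < 0 then 1 else 0)"
proof -
  have "(\<lambda>k. soft_change (real (Suc k)) x y) \<longlonglongrightarrow>
      (if x > 0 then 1 else 0) * (if - y > 0 then 1 else 0) + (if - x > 0 then 1 else 0) * (if y > 0 then 1 else 0)"
    unfolding soft_change_def by (intro tendsto_intros soft_pos_tendsto)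
  also have "(if x > 0 then 1 else 0) * (if - y > 0 then 1 else 0) + (if - x > 0 then 1 else 0) * (if y > 0 then 1 else 0)
      = (if x * y < 0 then 1 else (0::real))"
    by (auto simp: mult_less_0_iff)
  finally show ?thesis .
qed

section \<open>The lower tail of the zero count\<close>

context spectral_density_process
begin

lemma spectral_bound_nonneg: "0 \<le> P"
  using density_nonneg[of 0] density_le[of 0] by simp

text \<open>The smoothed number of sign changes over the distance \<open>d\<close>, averaged over \<open>m\<close> shifted grids of \<open>Q\<close> steps.\<close>

definition soft_count :: "real \<Rightarrow> real \<Rightarrow> nat \<Rightarrow> nat \<Rightarrow> (real \<Rightarrow> real) \<Rightarrow> real" where
  "soft_count N d m Q x = (\<Sum>k<Q * m. soft_change N (x (real k * (d / m))) (x (real (k + m) * (d / m)))) / m"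

definition soft_count_deriv :: "real \<Rightarrow> real \<Rightarrow> nat \<Rightarrow> nat \<Rightarrow> (real \<Rightarrow> real) \<Rightarrow> (real \<Rightarrow> real) \<Rightarrow> real" where
  "soft_count_deriv N d m Q x y = (\<Sum>k<Q * m.
      soft_change_deriv N (x (real k * (d / m))) (x (real (k + m) * (d / m))) * y (real k * (d / m))
    + soft_change_deriv N (x (real (k + m) * (d / m))) (x (real k * (d / m))) * y (real (k + m) * (d / m))) / m"

text \<open>\<open>tail_constant N d * T\<close> bounds the variance of the directional derivatives of \<open>soft_count\<close> on an interval of
length \<open>T\<close>. The summand \<open>1\<close> only makes it positive.\<close>

definition tail_constant :: "real \<Rightarrow> real \<Rightarrow> real" where
  "tail_constant N d = 32 * pi * N\<^sup>2 * P / d\<^sup>2 + 16 * N\<^sup>2 * spectral_moment + 1"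

lemma tail_constant_pos: "tail_constant N d > 0"
  unfolding tail_constant_def using spectral_bound_nonneg spectral_moment_nonneg
  by (intro add_nonneg_pos add_nonneg_nonneg) auto

text \<open>The derivative splits into a linear form in the values \<open>X (k * h)\<close> and one in the values \<open>X (d + k * h)\<close>,
each with \<open>Q * m\<close> coefficients of order \<open>1 / m\<close>. Convexity of the exponential separates the two. Taking
\<open>m\<^sup>2 \<ge> T\<close> makes the contribution of high frequencies linear in \<open>T\<close>, as the other one is.\<close>

lemma mgf_soft_count_deriv_le:
  assumes N: "N \<ge> 1" and d: "d > 0" and m: "m > 0" and Q: "real Q * d \<le> T" and T: "T \<le> (real m)\<^sup>2"
  shows "(\<integral>\<^sup>+\<omega>. ennreal (exp (\<kappa> * soft_count_deriv N d m Q x (\<lambda>t. X t \<omega>))) \<partial>M)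
    \<le> ennreal (exp (\<kappa>\<^sup>2 * (tail_constant N d * T) / 2))"
proof -
  define h where "h = d / m"
  define n where "n = Q * m"
  define w where "w = 4 * N * \<bar>\<kappa>\<bar> / m"
  have h: "h > 0" using d m by (simp add: h_def)
  have T0: "0 \<le> T" using Q d by (meson mult_nonneg_nonneg of_nat_0_le_iff less_imp_le order_trans)
  define a b where "a k = \<kappa> / m * soft_change_deriv N (x (real k * h)) (x (real (k + m) * h))"
    and "b k = \<kappa> / m * soft_change_deriv N (x (real (k + m) * h)) (x (real k * h))" for k
  define A B where "A \<omega> = (\<Sum>k<n. a k * X (0 + real k * h) \<omega>)" and "B \<omega> = (\<Sum>k<n. b k * X (d + real k * h) \<omega>)" for \<omega>
  define V where "V = P * (2 * pi / h) * (real n * w\<^sup>2) + (real n * w)\<^sup>2 * (h\<^sup>2 / pi\<^sup>2) * spectral_moment"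
  have [measurable]: "A \<in> borel_measurable M" "B \<in> borel_measurable M" unfolding A_def B_def by measurable
  have coef: "\<bar>2 * (\<kappa> / m * soft_change_deriv N u v)\<bar> \<le> w" for u v
  proof -
    have "\<bar>2 * (\<kappa> / m * soft_change_deriv N u v)\<bar> = 2 * \<bar>\<kappa>\<bar> / m * \<bar>soft_change_deriv N u v\<bar>"
      by (simp add: abs_mult)
    also have "\<dots> \<le> 2 * \<bar>\<kappa>\<bar> / m * (2 * N)"
      by (intro mult_left_mono abs_soft_change_deriv_le N) auto
    finally show ?thesis by (simp add: w_def mult_ac)
  qed
  have coef_ab: "\<bar>2 * a k\<bar> \<le> w" "\<bar>2 * b k\<bar> \<le> w" for k
    unfolding a_def b_def by (rule coef)+
  have mgf: "(\<integral>\<^sup>+\<omega>. ennreal (exp (2 * (\<Sum>k<n. c k * X (s + real k * h) \<omega>))) \<partial>M) \<le> ennreal (exp (V / 2))"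
    if "\<And>k. \<bar>2 * c k\<bar> \<le> w" for c s
    using mgf_linear_combination_le[OF h, of n "\<lambda>k. 2 * c k" w s] that
    by (simp add: V_def sum_distrib_left mult.assoc)
  have AB: "\<kappa> * soft_count_deriv N d m Q x (\<lambda>t. X t \<omega>) = A \<omega> + B \<omega>" for \<omega>
  proof -
    have "real (k + m) * h = d + real k * h" for k using m by (simp add: h_def field_simps)
    then show ?thesis
      by (simp add: soft_count_deriv_def A_def B_def a_def b_def h_def[symmetric] n_def[symmetric]
        sum.distrib[symmetric] sum_distrib_left sum_divide_distrib algebra_simps add_divide_distrib)
  qed
  have split: "exp (u + v) \<le> (exp (2 * u) + exp (2 * v)) / 2" for u v :: real
    using sum_squares_bound[of "exp u" "exp v"] by (simp add: exp_add exp_double)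
  have "(\<integral>\<^sup>+\<omega>. ennreal (exp (\<kappa> * soft_count_deriv N d m Q x (\<lambda>t. X t \<omega>))) \<partial>M)
      \<le> (\<integral>\<^sup>+\<omega>. (ennreal (exp (2 * A \<omega>)) + ennreal (exp (2 * B \<omega>))) * ennreal (1 / 2) \<partial>M)"
    unfolding AB
  proof (intro nn_integral_mono)
    fix \<omega>
    have "ennreal (exp (A \<omega> + B \<omega>)) \<le> ennreal ((exp (2 * A \<omega>) + exp (2 * B \<omega>)) * (1 / 2))"
      using split[of "A \<omega>" "B \<omega>"] by (intro ennreal_leI) simp
    also have "\<dots> = (ennreal (exp (2 * A \<omega>)) + ennreal (exp (2 * B \<omega>))) * ennreal (1 / 2)"
      by (subst ennreal_mult) (auto simp: ennreal_plus)
    finally show "ennreal (exp (A \<omega> + B \<omega>)) \<le> (ennreal (exp (2 * A \<omega>)) + ennreal (exp (2 * B \<omega>))) * ennreal (1 / 2)" .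
  qed
  also have "\<dots> = ((\<integral>\<^sup>+\<omega>. ennreal (exp (2 * A \<omega>)) \<partial>M) + (\<integral>\<^sup>+\<omega>. ennreal (exp (2 * B \<omega>)) \<partial>M)) * ennreal (1 / 2)"
    by (subst nn_integral_multc) (auto simp: nn_integral_add)
  also have "\<dots> \<le> (ennreal (exp (V / 2)) + ennreal (exp (V / 2))) * ennreal (1 / 2)"
    unfolding A_def B_def by (intro mult_right_mono add_mono mgf coef_ab) auto
  also have "\<dots> = ennreal ((exp (V / 2) + exp (V / 2)) * (1 / 2))"
    by (subst ennreal_mult, simp, simp, subst ennreal_plus) simp_all
  also have "\<dots> \<le> ennreal (exp (\<kappa>\<^sup>2 * (tail_constant N d * T) / 2))"
  proof -
    have "V \<le> \<kappa>\<^sup>2 * (tail_constant N d * T)"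
    proof -
      have w2: "w\<^sup>2 = 16 * N\<^sup>2 * \<kappa>\<^sup>2 / (real m)\<^sup>2" by (simp add: w_def power_divide power_mult_distrib)
      have QT: "real Q / d \<le> T / d\<^sup>2" using Q d by (simp add: divide_simps power2_eq_square)
      have "P * (2 * pi / h) * (real n * w\<^sup>2) = 32 * pi * N\<^sup>2 * P * \<kappa>\<^sup>2 * (real Q / d)"
        unfolding w2 using m d by (simp add: h_def n_def power2_eq_square field_simps)
      also have "\<dots> \<le> 32 * pi * N\<^sup>2 * P * \<kappa>\<^sup>2 * (T / d\<^sup>2)"
        using QT spectral_bound_nonneg by (intro mult_left_mono) auto
      finally have 1: "P * (2 * pi / h) * (real n * w\<^sup>2) \<le> \<kappa>\<^sup>2 * (32 * pi * N\<^sup>2 * P / d\<^sup>2 * T)"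
        by (simp add: mult_ac)
      have "(real Q * d)\<^sup>2 \<le> T\<^sup>2" using Q d by (intro power_mono) auto
      also have "\<dots> \<le> T * (real m)\<^sup>2" using T T0 by (simp add: power2_eq_square mult_left_mono)
      finally have QTm: "(real Q * d)\<^sup>2 / (real m)\<^sup>2 \<le> T" using m by (simp add: divide_simps)
      have pi1: "1 / pi\<^sup>2 \<le> 1" using pi_gt3 by (simp add: divide_le_eq one_le_power)
      have "(real n * w)\<^sup>2 * (h\<^sup>2 / pi\<^sup>2) * spectral_moment
          = 16 * N\<^sup>2 * spectral_moment * \<kappa>\<^sup>2 * ((real Q * d)\<^sup>2 / (real m)\<^sup>2 * (1 / pi\<^sup>2))"
        unfolding power_mult_distrib w2 using m d by (simp add: h_def n_def power_divide power_mult_distrib field_simps)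
      also have "\<dots> \<le> 16 * N\<^sup>2 * spectral_moment * \<kappa>\<^sup>2 * (T * 1)"
        using QTm pi1 T0 spectral_moment_nonneg by (intro mult_left_mono mult_mono) auto
      finally have 2: "(real n * w)\<^sup>2 * (h\<^sup>2 / pi\<^sup>2) * spectral_moment \<le> \<kappa>\<^sup>2 * (16 * N\<^sup>2 * spectral_moment * T)"
        by (simp add: mult_ac)
      have "V \<le> \<kappa>\<^sup>2 * (32 * pi * N\<^sup>2 * P / d\<^sup>2 * T) + \<kappa>\<^sup>2 * (16 * N\<^sup>2 * spectral_moment * T)"
        unfolding V_def by (rule add_mono[OF 1 2])
      also have "\<dots> \<le> \<dots> + \<kappa>\<^sup>2 * T" using T0 by simp
      also have "\<dots> = \<kappa>\<^sup>2 * (tail_constant N d * T)"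
        by (simp add: tail_constant_def algebra_simps)
      finally show ?thesis .
    qed
    then show ?thesis by (intro ennreal_leI) simp
  qed
  finally show ?thesis .
qed

lemma soft_count_meas [measurable]: "(\<lambda>\<omega>. soft_count N d m Q (\<lambda>t. X t \<omega>)) \<in> borel_measurable M"
  unfolding soft_count_def by measurable

lemma abs_soft_change_le_1: "N \<ge> 0 \<Longrightarrow> \<bar>soft_change N x y\<bar> \<le> 1"
  using soft_change_nonneg[of N x y] soft_change_le[of N x y] by (auto split: if_splits)

lemma soft_count_lower_tail:
  assumes N: "N \<ge> 1" and d: "d > 0" and m: "m > 0" and Q: "real Q * d \<le> T" and T: "0 < T" "T \<le> (real m)\<^sup>2"
    and s: "s > 0"
  shows "prob {\<omega> \<in> space M. soft_count N d m Q (\<lambda>t. X t \<omega>) \<le> (\<integral>\<omega>. soft_count N d m Q (\<lambda>t. X t \<omega>) \<partial>M) - s}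
    \<le> exp (- (2 * s\<^sup>2 / (pi\<^sup>2 * (tail_constant N d * T))))"
proof (rule gaussian_concentration[where I="(\<lambda>k. real k * (d / m)) ` {..<Q * m + m}" and b="real (Q * m) / m"
      and F="soft_count N d m Q" and D="soft_count_deriv N d m Q" and X=X and s=s])
  let ?I = "(\<lambda>k. real k * (d / m)) ` {..<Q * m + m}"
  have I: "real k * (d / m) \<in> ?I" "real (k + m) * (d / m) \<in> ?I" if "k < Q * m" for k
    using that by (intro imageI; simp)+
  show "centered_gaussian_vector M ?I X" by (rule centered_gaussian_vector) simp
  show "\<bar>soft_count N d m Q x\<bar> \<le> real (Q * m) / m" for x
  proof -
    have "\<bar>\<Sum>k<Q * m. soft_change N (x (real k * (d / m))) (x (real (k + m) * (d / m)))\<bar> \<le> (\<Sum>k<Q * m. 1)"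
      using N by (intro order_trans[OF sum_abs] sum_mono abs_soft_change_le_1) auto
    then show ?thesis unfolding soft_count_def abs_divide abs_of_nat by (intro divide_right_mono) auto
  qed
  show "(\<lambda>z. soft_count_deriv N d m Q (\<lambda>t. z (True, t)) (\<lambda>t. z (False, t)))
      \<in> borel_measurable (PiM (UNIV \<times> ?I) (\<lambda>_. borel))"
  proof -
    have [measurable]: "(\<lambda>z. z (c, real k * (d / m))) \<in> borel_measurable (PiM (UNIV \<times> ?I) (\<lambda>_. borel))"
      "(\<lambda>z. z (c, real (k + m) * (d / m))) \<in> borel_measurable (PiM (UNIV \<times> ?I) (\<lambda>_. borel))" if "k \<in> {..<Q * m}" for k c
      using I[of k] that by (auto intro!: measurable_component_singleton)
    show ?thesis unfolding soft_count_deriv_def by measurable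
  qed
  show "soft_count_deriv N d m Q x y = soft_count_deriv N d m Q x' y'"
    if "\<And>t. t \<in> ?I \<Longrightarrow> x t = x' t" "\<And>t. t \<in> ?I \<Longrightarrow> y t = y' t" for x x' y y'
    unfolding soft_count_deriv_def
    using that(1)[OF I(1)] that(1)[OF I(2)] that(2)[OF I(1)] that(2)[OF I(2)]
    by (intro arg_cong2[where f="(/)"] sum.cong refl) (simp del: of_nat_add)
  show "((\<lambda>\<theta>. soft_count N d m Q (\<lambda>t. cos \<theta> * x t + sin \<theta> * y t)) has_real_derivative
        soft_count_deriv N d m Q (\<lambda>t. cos \<theta> * x t + sin \<theta> * y t) (\<lambda>t. - sin \<theta> * x t + cos \<theta> * y t)) (at \<theta>)"
    for x y \<theta>
    unfolding soft_count_def soft_count_deriv_def using N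
    by (intro DERIV_cdivide DERIV_sum soft_change_has_derivative) (auto intro!: derivative_eq_intros)
  show "isCont (\<lambda>\<theta>. soft_count_deriv N d m Q (\<lambda>t. cos \<theta> * x t + sin \<theta> * y t) (\<lambda>t. - sin \<theta> * x t + cos \<theta> * y t)) \<theta>"
    for x y \<theta>
    unfolding soft_count_deriv_def using N m by (intro continuous_intros) auto
  show "0 < tail_constant N d * T" using T tail_constant_pos by simp
qed (use mgf_soft_count_deriv_le[OF N d m Q T(2)] s prob_space_axioms in auto)

lemma expectation_soft_count:
  assumes N: "N \<ge> 0" and m: "m > 0"
  shows "(\<integral>\<omega>. soft_count N d m Q (\<lambda>t. X t \<omega>) \<partial>M) = Q * (\<integral>\<omega>. soft_change N (X 0 \<omega>) (X d \<omega>) \<partial>M)"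
proof -
  have int: "integrable M (\<lambda>\<omega>. soft_change N (X s \<omega>) (X t \<omega>))" for s t
    using abs_soft_change_le_1[OF N] by (intro integrable_const_bound[where B=1]) auto
  have shift: "(\<integral>\<omega>. soft_change N (X s \<omega>) (X (s + d) \<omega>) \<partial>M) = (\<integral>\<omega>. soft_change N (X 0 \<omega>) (X d \<omega>) \<partial>M)" for s
  proof -
    have "(\<integral>\<omega>. soft_change N (X u \<omega>) (X v \<omega>) \<partial>M) = enn2real (\<integral>\<^sup>+\<omega>. ennreal (soft_change N (X u \<omega>) (X v \<omega>)) \<partial>M)" for u v
      using soft_change_nonneg[OF N] by (intro integral_eq_nn_integral) auto
    then show ?thesis using nn_integral_pair_shift[of "\<lambda>x y. ennreal (soft_change N x y)" s d] by simp
  qed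
  have "real (k + m) * (d / m) = real k * (d / m) + d" for k using m by (simp add: field_simps)
  then have "(\<integral>\<omega>. soft_count N d m Q (\<lambda>t. X t \<omega>) \<partial>M)
      = (\<Sum>k<Q * m. (\<integral>\<omega>. soft_change N (X 0 \<omega>) (X d \<omega>) \<partial>M)) / m"
    unfolding soft_count_def using int by (simp add: shift del: sum_constant)
  then show ?thesis using m by simp
qed

lemma crossing_prob_eq: "crossing_prob d = (\<integral>\<omega>. (if X 0 \<omega> * X d \<omega> < 0 then 1 else 0) \<partial>M)"
proof -
  have "crossing_prob d = prob {\<omega> \<in> space M. X 0 \<omega> * X d \<omega> < 0}"
    unfolding crossing_prob_def
    by (rule finite_measure_eq_AE) (use AE_nonzero[of 0] AE_nonzero[of d] in \<open>auto simp: less_le\<close>)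
  also have "\<dots> = (\<integral>\<omega>. indicator {\<omega> \<in> space M. X 0 \<omega> * X d \<omega> < 0} \<omega> \<partial>M)"
    by simp
  also have "\<dots> = (\<integral>\<omega>. (if X 0 \<omega> * X d \<omega> < 0 then 1 else 0) \<partial>M)"
    by (intro Bochner_Integration.integral_cong) (auto simp: indicator_def)
  finally show ?thesis .
qed

lemma expectation_soft_change_tendsto:
  "(\<lambda>k. \<integral>\<omega>. soft_change (real (Suc k)) (X 0 \<omega>) (X d \<omega>) \<partial>M) \<longlonglongrightarrow> crossing_prob d"
  unfolding crossing_prob_eq
proof (rule integral_dominated_convergence[where w="\<lambda>_. 1"])
  show "AE \<omega> in M. (\<lambda>k. soft_change (real (Suc k)) (X 0 \<omega>) (X d \<omega>)) \<longlonglongrightarrow> (if X 0 \<omega> * X d \<omega> < 0 then 1 else 0)"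
    by (intro AE_I2 soft_change_tendsto)
  show "AE \<omega> in M. norm (soft_change (real (Suc k)) (X 0 \<omega>) (X d \<omega>)) \<le> 1" for k
    using abs_soft_change_le_1[of "real (Suc k)"] by (intro AE_I2) (simp del: of_nat_Suc)
qed auto

lemma expected_zero_count_finite: "expected_zero_count M X {0..1} < \<top>"
proof -
  have "(\<lambda>n. 1 / 2 ^ n :: real) \<longlonglongrightarrow> 0"
    using LIMSEQ_realpow_zero[of "1/2::real"] by (simp add: power_one_over)
  then have "(\<lambda>n. spectral_moment * (1 / 2 ^ n)\<^sup>2) \<longlonglongrightarrow> spectral_moment * 0\<^sup>2" by (intro tendsto_intros)
  then have "\<forall>\<^sub>F n in sequentially. spectral_moment * (1 / 2 ^ n)\<^sup>2 < 2"
    by (rule order_tendstoD) simp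
  then have "\<forall>\<^sub>F n in sequentially. ennreal (2 ^ n * crossing_prob (1 / 2 ^ n)) \<le> ennreal (2 * sqrt spectral_moment)"
  proof eventually_elim
    case (elim n)
    then have "crossing_prob (1 / 2 ^ n) \<le> 2 * sqrt spectral_moment * \<bar>1 / 2 ^ n\<bar>"
      by (intro crossing_prob_le) simp
    then have "2 ^ n * crossing_prob (1 / 2 ^ n) \<le> 2 ^ n * (2 * sqrt spectral_moment * \<bar>1 / 2 ^ n\<bar>)"
      by (intro mult_left_mono) auto
    then show ?case by (intro ennreal_leI) simp
  qed
  then have "liminf (\<lambda>n. ennreal (2 ^ n * crossing_prob (1 / 2 ^ n))) \<le> liminf (\<lambda>n::nat. ennreal (2 * sqrt spectral_moment))"
    by (rule Liminf_mono)
  then have "expected_zero_count M X {0..1} \<le> ennreal (2 * sqrt spectral_moment)"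
    using expected_zero_count_le by (simp add: Liminf_const)
  also have "\<dots> < \<top>" by simp
  finally show ?thesis .
qed

text \<open>One half of \<open>\<eta>\<close> is spent on choosing the distance \<open>d = 1 / 2 ^ n\<close>, the other on smoothing the indicator.\<close>

lemma exists_soft_change_expectation:
  assumes \<eta>: "\<eta> > 0"
  obtains N d where "N \<ge> 1" "d > 0"
    "(enn2real (expected_zero_count M X {0..1}) - \<eta>) * d \<le> (\<integral>\<omega>. soft_change N (X 0 \<omega>) (X d \<omega>) \<partial>M)"
proof -
  define a where "a = enn2real (expected_zero_count M X {0..1})"
  have a: "ennreal a = expected_zero_count M X {0..1}"
    using expected_zero_count_finite by (simp add: a_def)
  obtain n :: nat where n: "a - \<eta> / 2 \<le> 2 ^ n * crossing_prob (1 / 2 ^ n)"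
  proof (cases "a - \<eta> / 2 < 0")
    case True
    moreover have "0 \<le> crossing_prob (1 / 2 ^ 0)" by (simp add: crossing_prob_def)
    ultimately show ?thesis using that[of 0] by simp
  next
    case False
    then have "ennreal (a - \<eta> / 2) < ennreal a" using \<eta> by (intro ennreal_lessI) auto
    also have "\<dots> \<le> liminf (\<lambda>n. ennreal (2 ^ n * crossing_prob (1 / 2 ^ n)))"
      unfolding a by (rule expected_zero_count_le)
    finally have "\<forall>\<^sub>F n in sequentially. ennreal (a - \<eta> / 2) < ennreal (2 ^ n * crossing_prob (1 / 2 ^ n))"
      by (rule less_LiminfD)
    then obtain n where "ennreal (a - \<eta> / 2) < ennreal (2 ^ n * crossing_prob (1 / 2 ^ n))"
      by (auto simp: eventually_sequentially)
    then show ?thesis using False that[of n] by (simp add: ennreal_less_iff)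
  qed
  define d :: real where "d = 1 / 2 ^ n"
  have d: "d > 0" by (simp add: d_def)
  have cd: "(a - \<eta> / 2) * d \<le> crossing_prob d"
    using n by (simp add: d_def divide_simps mult.commute)
  have "crossing_prob d - \<eta> / 2 * d < crossing_prob d" using \<eta> d by simp
  with expectation_soft_change_tendsto[of d]
  have "\<forall>\<^sub>F k in sequentially. crossing_prob d - \<eta> / 2 * d < (\<integral>\<omega>. soft_change (real (Suc k)) (X 0 \<omega>) (X d \<omega>) \<partial>M)"
    by (rule order_tendstoD)
  then obtain k where k: "crossing_prob d - \<eta> / 2 * d < (\<integral>\<omega>. soft_change (real (Suc k)) (X 0 \<omega>) (X d \<omega>) \<partial>M)"
    by (auto simp: eventually_sequentially simp del: of_nat_Suc)
  have "(a - \<eta>) * d = (a - \<eta> / 2) * d - \<eta> / 2 * d" by (simp add: algebra_simps)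
  then show ?thesis using that[of "real (Suc k)" d] d cd k by (simp add: a_def del: of_nat_Suc)
qed

text \<open>The mean of the smoothed count falls below \<open>a * T\<close> by at most \<open>\<eta> * T / 2\<close> for the choice of the spacing and
of \<open>N\<close>, and by at most a further \<open>2 \<le> \<eta> * T / 4\<close> for the two steps that are lost at the ends of the interval. A
deviation of \<open>\<eta> * T\<close> of the zero count thus forces the smoothed count to fall short of its mean by
\<open>\<eta> * T / 4\<close>, and a deviation of order \<open>T\<close> against a variance of order \<open>T\<close> has exponentially small probability.\<close>

lemma zero_count_lower_tail_large:
  fixes a :: real
  assumes \<eta>: "\<eta> > 0" and a: "a = enn2real (expected_zero_count M X {0..1})"
  shows "\<exists>c>0. \<exists>T0>0. \<forall>T\<ge>T0. measure (completion M)
      {\<omega> \<in> space M. enn2ereal (zero_count X {0..T} \<omega>) - ereal a * ereal T \<le> - (ereal (\<eta> * T))} \<le> exp (- c * T)"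
proof -
  obtain N d where N: "N \<ge> 1" and d: "d > 0"
    and e: "(a - \<eta> / 2) * d \<le> (\<integral>\<omega>. soft_change N (X 0 \<omega>) (X d \<omega>) \<partial>M)"
    using exists_soft_change_expectation[of "\<eta> / 2"] \<eta> unfolding a by auto
  define e1 where "e1 = (\<integral>\<omega>. soft_change N (X 0 \<omega>) (X d \<omega>) \<partial>M)"
  have N0: "N \<ge> 0" using N by simp
  have int: "integrable M (\<lambda>\<omega>. soft_change N (X 0 \<omega>) (X d \<omega>))"
    using abs_soft_change_le_1[OF N0] by (intro integrable_const_bound[where B=1]) auto
  have e1: "0 \<le> e1" "e1 \<le> 1"
    unfolding e1_def using soft_change_nonneg[OF N0] abs_soft_change_le_1[OF N0] int
    by (auto intro!: integral_nonneg_AE integral_le_const simp: abs_le_iff)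
  define c where "c = \<eta>\<^sup>2 / (8 * pi\<^sup>2 * tail_constant N d)"
  define T0 where "T0 = max (2 * d) (8 / \<eta>)"
  have c: "c > 0" using \<eta> tail_constant_pos[of N d] by (simp add: c_def)
  have T0: "T0 > 0" using d by (simp add: T0_def less_max_iff_disj)
  have "measure (completion M)
      {\<omega> \<in> space M. enn2ereal (zero_count X {0..T} \<omega>) - ereal a * ereal T \<le> - (ereal (\<eta> * T))} \<le> exp (- c * T)"
    if T: "T \<ge> T0" for T
  proof -
    have Tpos: "T > 0" and Td: "2 * d \<le> T" and T\<eta>: "8 / \<eta> \<le> T" using T T0 by (auto simp: T0_def)
    define Q where "Q = nat \<lfloor>T / d\<rfloor> - 1"
    \<comment> \<open>Any number with \<open>T \<le> m\<^sup>2\<close> will do.\<close>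
    define m where "m = Suc (nat \<lceil>T\<rceil>)"
    have m: "m > 0" by (simp add: m_def)
    have Tm: "T \<le> (real m)\<^sup>2"
    proof -
      have "T \<le> real m" unfolding m_def by linarith
      also have "real m \<le> (real m)\<^sup>2" using m by (intro self_le_power) auto
      finally show ?thesis .
    qed
    have "2 \<le> T / d" using Td d by (simp add: le_divide_eq)
    then have "2 \<le> \<lfloor>T / d\<rfloor>" by (simp add: le_floor_iff)
    then have SQ: "real (Suc Q) = of_int \<lfloor>T / d\<rfloor>" by (simp add: Q_def)
    then have "real (Suc Q) \<le> T / d" and SQ_ge: "T / d - 1 \<le> real (Suc Q)"
      using floor_correct[of "T / d"] by linarith+
    then have SQ_le: "real (Suc Q) * d \<le> T" using d by (simp only: pos_le_divide_eq)
    have Qd: "real Q * d \<le> T" using SQ_le d by (simp add: algebra_simps)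
    let ?F = "\<lambda>\<omega>. soft_count N d m Q (\<lambda>t. X t \<omega>)"
    have EF: "(\<integral>\<omega>. ?F \<omega> \<partial>M) = real Q * e1"
      unfolding e1_def by (rule expectation_soft_count[OF N0 m])
    have low: "a * T - \<eta> * T \<le> (\<integral>\<omega>. ?F \<omega> \<partial>M) - \<eta> * T / 4"
    proof -
      have "a - \<eta> / 2 \<le> e1 / d" using e d by (simp add: le_divide_eq e1_def)
      then have "T * (a - \<eta> / 2) \<le> T * (e1 / d)" using Tpos by (intro mult_left_mono) auto
      also have "\<dots> = (T / d - 2) * e1 + 2 * e1" by (simp add: algebra_simps)
      also have "\<dots> \<le> real Q * e1 + 2 * 1"
        using SQ_ge e1 by (intro add_mono mult_right_mono mult_left_mono) auto
      also have "2 * 1 \<le> \<eta> * T / 4" using T\<eta> \<eta> by (simp add: divide_le_eq mult.commute)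
      finally show ?thesis unfolding EF by (simp add: algebra_simps)
    qed
    let ?A = "{\<omega> \<in> space M. enn2ereal (zero_count X {0..T} \<omega>) - ereal a * ereal T \<le> - (ereal (\<eta> * T))}"
    let ?B = "{\<omega> \<in> space M. ?F \<omega> \<le> (\<integral>\<omega>. ?F \<omega> \<partial>M) - \<eta> * T / 4}"
    have AB: "AE \<omega> in M. \<omega> \<in> ?A \<longrightarrow> \<omega> \<in> ?B"
      using AE_continuous AE_space
    proof eventually_elim
      case (elim \<omega>)
      show ?case
      proof
        assume A: "\<omega> \<in> ?A"
        have "ennreal (?F \<omega>) \<le> zero_count X {0..T} \<omega>"
          unfolding soft_count_def zero_count_def
        proof (rule averaged_sign_changes_le_zero_count[OF elim(1)])
          show "0 < d / real m" using d m by simp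
          have "real (m * Suc Q) * (d / m) = real (Suc Q) * d"
            using m by (simp only: of_nat_mult) simp
          then show "real (m * Suc Q) * (d / m) \<le> T" using SQ_le by simp
        qed (use m soft_change_le[OF N0] in auto)
        then have "ereal (?F \<omega>) \<le> enn2ereal (zero_count X {0..T} \<omega>)"
        proof -
          assume le: "ennreal (?F \<omega>) \<le> zero_count X {0..T} \<omega>"
          have "0 \<le> ?F \<omega>" unfolding soft_count_def using soft_change_nonneg[OF N0] by (auto intro!: divide_nonneg_nonneg sum_nonneg)
          then have "ereal (?F \<omega>) = enn2ereal (ennreal (?F \<omega>))" by (simp add: enn2ereal_ennreal)
          also have "\<dots> \<le> enn2ereal (zero_count X {0..T} \<omega>)" using le by (simp add: less_eq_ennreal.rep_eq)
          finally show ?thesis .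
        qed
        then have "ereal (?F \<omega>) - ereal a * ereal T \<le> enn2ereal (zero_count X {0..T} \<omega>) - ereal a * ereal T"
          by (rule ereal_minus_mono[OF _ order_refl])
        also have "\<dots> \<le> - ereal (\<eta> * T)" using A by simp
        finally have "ereal (?F \<omega>) - ereal a * ereal T \<le> - ereal (\<eta> * T)" .
        then have "?F \<omega> \<le> a * T - \<eta> * T" by simp
        then show "\<omega> \<in> ?B" using low elim(2) by auto
      qed
    qed
    have B: "?B \<in> sets M" by measurable
    \<comment> \<open>A set that is not measurable has measure \<open>0\<close> by convention.\<close>
    have "measure (completion M) ?A \<le> prob ?B"
    proof (cases "?A \<in> sets (completion M)")
      case True
      interpret cM: prob_space "completion M" by (rule prob_space_completion)
      have "measure (completion M) ?A \<le> measure (completion M) ?B"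
        using AE_completion[OF AB] B by (intro cM.finite_measure_mono_AE) auto
      then show ?thesis using B by (simp add: measure_completion)
    qed (simp add: measure_notin_sets)
    also have "\<dots> \<le> exp (- (2 * (\<eta> * T / 4)\<^sup>2 / (pi\<^sup>2 * (tail_constant N d * T))))"
      by (rule soft_count_lower_tail[OF N d m Qd Tpos Tm]) (use \<eta> Tpos in simp)
    also have "2 * (\<eta> * T / 4)\<^sup>2 / (pi\<^sup>2 * (tail_constant N d * T)) = c * T"
      using Tpos tail_constant_pos[of N d] by (simp add: c_def power2_eq_square field_simps)
    finally show ?thesis by simp
  qed
  then show ?thesis using c T0 by blast
qed

end

theorem proposition1p3:
  fixes M :: "'a measure" and X :: "real \<Rightarrow> 'a \<Rightarrow> real" and p :: "real \<Rightarrow> real"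
    and \<alpha> :: ereal
  assumes "prob_space M"
    and "gaussian_process M X"
    and "stationary_process M X"
    and "\<And>t. (\<integral>\<omega>. X t \<omega> \<partial>M) = 0"
    and "\<And>t. covariance M (X t) (X t) = 1"
    and "AE \<omega> in M. absolutely_continuous_path (\<lambda>t. X t \<omega>)"
    and "\<And>l. 0 \<le> p l"
    and "bounded (range p)"
    and "continuous_on UNIV p"
    and "spectral_measure M X (density lborel p)"
    and "integrable lborel (\<lambda>l. l\<^sup>2 * p l)"
    and "\<alpha> = enn2ereal (expected_zero_count M X {0..1})"
  shows "\<exists>(C::real) (c::real \<Rightarrow> real). (\<forall>\<eta>>0. c \<eta> > 0) \<and>
    (\<forall>\<eta>>0. \<forall>T>0.
      measure (completion M)
        {\<omega> \<in> space M. enn2ereal (zero_count X {0..T} \<omega>) - \<alpha> * ereal T \<le> - (ereal (\<eta> * T))}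
      \<le> C * exp (- c \<eta> * T))"
proof -
  obtain P where P: "\<And>l. p l \<le> P"
    using assms(8) unfolding bounded_iff by (metis abs_le_D1 rangeI real_norm_def)
  interpret prob_space M by fact
  interpret spectral_density_process M X p P
    using assms P by unfold_locales (auto intro: borel_measurable_continuous_onI)
  define a where "a = enn2real (expected_zero_count M X {0..1})"
  have \<alpha>: "\<alpha> = ereal a"
    using expected_zero_count_finite assms(12)
    by (cases "expected_zero_count M X {0..1}" rule: ennreal_cases) (auto simp: a_def enn2ereal_ennreal)
  let ?A = "\<lambda>\<eta> T. {\<omega> \<in> space M. enn2ereal (zero_count X {0..T} \<omega>) - \<alpha> * ereal T \<le> - (ereal (\<eta> * T))}"
  interpret cM: prob_space "completion M" by (rule prob_space_completion)
  have "\<exists>c>0. \<forall>T>0. measure (completion M) (?A \<eta> T) \<le> exp 1 * exp (- c * T)" if eta: "\<eta> > 0" for \<eta>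
  proof -
    obtain c T0 where c: "c > 0" and T0: "T0 > 0"
      and le: "\<And>T. T \<ge> T0 \<Longrightarrow> measure (completion M) (?A \<eta> T) \<le> exp (- c * T)"
      using zero_count_lower_tail_large[OF eta a_def] unfolding \<alpha> by blast
    \<comment> \<open>Below \<open>T0\<close> the bound is trivial: for \<open>c \<le> 1 / T0\<close> the right-hand side is at least \<open>1\<close>.\<close>
    have "measure (completion M) (?A \<eta> T) \<le> exp 1 * exp (- min c (1 / T0) * T)" if T: "T > 0" for T
    proof (cases "T \<ge> T0")
      case True
      have "min c (1 / T0) * T \<le> c * T" using T by (intro mult_right_mono) auto
      then have "exp (- c * T) \<le> exp (1 + - min c (1 / T0) * T)" by simp
      then show ?thesis using le[OF True] by (simp only: exp_add) 
    next
      case False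
      have "min c (1 / T0) * T \<le> 1 / T0 * T" using T by (intro mult_right_mono) auto
      also have "\<dots> \<le> 1" using False T0 by simp
      finally have "1 \<le> exp (1 + - min c (1 / T0) * T)" by simp
      then show ?thesis using cM.prob_le_1[of "?A \<eta> T"] by (simp only: exp_add)
    qed
    moreover have "min c (1 / T0) > 0" using c T0 by simp
    ultimately show ?thesis by blast
  qed
  then have "\<forall>\<eta>\<in>{0<..}. \<exists>c. c > 0 \<and> (\<forall>T>0. measure (completion M) (?A \<eta> T) \<le> exp 1 * exp (- c * T))"
    by blast
  from bchoice[OF this] obtain c where
    "\<forall>\<eta>\<in>{0<..}. c \<eta> > 0 \<and> (\<forall>T>0. measure (completion M) (?A \<eta> T) \<le> exp 1 * exp (- c \<eta> * T))" ..
  then show ?thesis by (intro exI[of _ "exp 1"] exI[of _ c]) blast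
qed

end
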